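(* Let $n\geq1$, $\sigma\geq 1$, $s\geq 0$, $\kappa\in[0,1]$, $0\le s_0\le s$, and let $w_0\in H^s\cap L^{1,\kappa}$ (with values in $\mathbb{C}^3$). Let $w$ be the solution of $$w_t-D_0(-\Delta)^{\sigma/2}w-D_1(-\Delta)^{\sigma\alpha}w=0\quad (x\in\mathbb{R}^n,\ t>0),\qquad w(0,x)=w_0(x),$$ and let $Q_{\mathrm{int}}$ (for $\alpha\in[0,1/2)$) and $\widetilde Q_{\mathrm{int}}$ (for $\alpha\in(1/2,1]$) be the profiles built from $w_0$ defined in the context. Then for all $t\ge0$, with implicit constants independent of $t$ and $w_0$: (i) if $\alpha\in[0,1/2)$, $$\|(\chi_{\mathrm{int}}(D)w-Q_{\mathrm{int}})(t,\cdot)\|_{\dot H^{s_0}}\lesssim (1+t)^{-\frac{n+2(s_0+\kappa)}{2(2\sigma-2\sigma\alpha)}-\frac{1-2\alpha}{2(1-\alpha)}}\|w_0\|_{L^{1,\kappa}}+(1+t)^{-\frac{n+2s_0}{2(2\sigma-2\sigma\alpha)}-\frac{1-2\alpha}{2(1-\alpha)}}|P_{w_0}|;$$ (ii) if $\alpha\in(1/2,1]$, $$\|(\chi_{\mathrm{int}}(D)w-\widetilde Q_{\mathrm{int}})(t,\cdot)\|_{\dot H^{s_0}}\lesssim (1+t)^{-\frac{n+2(s_0+\kappa)}{4\sigma\alpha}-\frac{2\alpha-1}{2\alpha}}\|w_0\|_{L^{1,\kappa}}+(1+t)^{-\frac{n+2s_0}{4\sigma\alpha}-\frac{2\alpha-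1}{2\alpha}}|P_{w_0}|.$$
   Context: The coefficient matrices are $$D_0=\begin{pmatrix} i-\frac12&-\frac12&0\\-\frac12&-i-\frac12&0\\0&0&0\end{pmatrix},\qquad D_1=\begin{pmatrix}0&0&1\\0&0&1\\-\frac12&-\frac12&-1\end{pmatrix}.$$ $(-\Delta)^{\nu}$ is the Fourier multiplier with symbol $|\xi|^{2\nu}$ (the identity if $\nu=0$); solutions are understood through the Fourier transform in $x$, e.g. $\hat w_t=(D_0|\xi|^\sigma+D_1|\xi|^{2\sigma\alpha})\hat w$, $\hat w(0,\xi)=\hat w_0(\xi)$. Spaces: $H^s$, $\dot H^s$ are the Bessel and Riesz potential spaces on $\mathbb{R}^n$ based on $L^2$; $\|f\|_{L^{1,\kappa}}=\int_{\mathbb{R}^n}(1+|x|)^\kappa|f(x)|\,dx$; $P_f=\int_{\mathbb{R}^n}f(x)\,dx$. Cut-off: $\chi_{\mathrm{int}}\in\mathcal{C}^\infty$ is supported in $\{|\xi|\le\varepsilon\}$ with a fixed sufficiently small $\varepsilon\ll1$ (it is part of a smooth partition $\chi_{\mathrm{int}}+\chi_{\mathrm{mid}}+\chi_{\mathrm{ext}}=1$ with $\mathrm{supp}\,\chi_{\mathrm{mid}}\subset\{\varepsilon/2\le|\xi|\le2N\}$, $\mathrm{supp}\,\chi_{\mathrm{ext}}\subset\{|\xi|\ge N\}$, $N\gg1$); $\chi_{\mathrm{int}}(D)$ is the Fourier multiplier with symbol $\chi_{\mathrm{int}}(\xi)$. The matrix $I+M_2$ below (for $\alpha<1/2$) is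 invertible on its support. Matrices ($I$ is the $3\times3$ identity): $$M_1=\begin{pmatrix}-1&\frac{i\sqrt3-1}{2}&\frac{-i\sqrt3-1}{2}\\1&\frac{i\sqrt3-1}{2}&\frac{-i\sqrt3-1}{2}\\0&1&1\end{pmatrix},\qquad M_2(|\xi|)=|\xi|^{\sigma-2\sigma\alpha}\begin{pmatrix}0&-\frac{\sqrt3+i}{1+\sqrt3i}&\frac{\sqrt3-i}{1-\sqrt3i}\\-\frac{2\sqrt3}{3(1+\sqrt3i)}&0&\frac{\sqrt3-i}{6i}\\\frac{2\sqrt3}{3(1-\sqrt3i)}&-\frac{\sqrt3+i}{6i}&0\end{pmatrix},$$ $$M_4=\begin{pmatrix}0&i(\sqrt3-2)&-i(\sqrt3+2)\\0&1&1\\1&0&0\end{pmatrix}.$$ Reference system for $\alpha\in[0,1/2)$: $\widetilde w$ solves $$\widetilde w_t+\widetilde D_0(-\Delta)^{\sigma\alpha}\widetilde w+\widetilde D_1(-\Delta)^{\sigma}\widetilde w+\widetilde D_2(-\Delta)^{\sigma-\sigma\alpha}\widetilde w=0$$ with initial data whose Fourier transform is $(I+M_2(|\xi|))^{-1}M_1^{-1}\hat w_0(\xi)$, where $\widetilde D_0=\mathrm{diag}(0,\frac12+\frac{\sqrt3}2i,\frac12-\frac{\sqrt3}2i)$, $\widetilde D_1=\mathrm{diag}(0,\frac12+\frac{\sqrt3}6i,\frac12-\frac{\sqrt3}6i)$, $\widetilde D_2=\mathrm{diag}(1,-\frac12+\frac{\sqrt3}{18}i,-\frac12-\frac{\sqrt3}{18}i)$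 (only frequencies in the support of $\chi_{\mathrm{int}}$ are used). Reference system for $\alpha\in(1/2,1]$: $\overline w$ solves $$\overline w_t+\overline D_0(-\Delta)^{\sigma/2}\overline w+\overline D_1(-\Delta)^{\sigma\alpha}\overline w=0,\qquad \overline w(0,x)=M_4^{-1}w_0(x),$$ where $\overline D_0=\mathrm{diag}(0,\frac12+\frac{\sqrt3}2i,\frac12-\frac{\sqrt3}2i)$, $\overline D_1=\mathrm{diag}(1,0,0)$. Profiles (defined through their Fourier transforms in $x$): $$\widehat{Q_{\mathrm{int}}}(t,\xi)=\chi_{\mathrm{int}}(\xi)M_1(I+M_2(|\xi|))\,\widehat{\widetilde w}(t,\xi)\quad(\alpha\in[0,1/2)),\qquad \widehat{\widetilde Q_{\mathrm{int}}}(t,\xi)=\chi_{\mathrm{int}}(\xi)M_4\,\widehat{\overline w}(t,\xi)\quad(\alpha\in(1/2,1]).$$ *)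

theory Defs
  imports "HOL-Analysis.Analysis"
begin

definition L2_fun :: "(real^'n \<Rightarrow> complex^3) \<Rightarrow> bool" where
  "L2_fun f \<longleftrightarrow> f \<in> borel_measurable lebesgue \<and> integrable lebesgue (\<lambda>x. (norm (f x))\<^sup>2)"

definition L2_norm :: "(real^'n \<Rightarrow> complex^3) \<Rightarrow> real" where
  "L2_norm f = sqrt (LINT x|lebesgue. (norm (f x))\<^sup>2)"

definition L1_weighted :: "real \<Rightarrow> (real^'n \<Rightarrow> complex^3) \<Rightarrow> bool" where
  "L1_weighted \<kappa> f \<longleftrightarrow> f \<in> borel_measurable lebesgue \<and>
     integrable lebesgue (\<lambda>x. (1 + norm x) powr \<kappa> * norm (f x))"

definition L1_weighted_norm :: "real \<Rightarrow> (real^'n \<Rightarrow> complex^3) \<Rightarrow> real" where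
  "L1_weighted_norm \<kappa> f = (LINT x|lebesgue. (1 + norm x) powr \<kappa> * norm (f x))"

definition total_mass :: "(real^'n \<Rightarrow> complex^3) \<Rightarrow> complex^3" where
  "total_mass f = (LINT x|lebesgue. f x)"

text \<open>The Fourier transform of an integrable function. The unitary normalisation is chosen, so
  that the homogeneous Sobolev norm of order 0 below is the \<open>L\<^sup>2\<close> norm.\<close>

definition fourier :: "(real^'n \<Rightarrow> complex^3) \<Rightarrow> real^'n \<Rightarrow> complex^3" where
  "fourier f \<xi> = (1 / (2 * pi) powr (real CARD('n) / 2)) *\<^sub>R
     (LINT x|lebesgue. cis (- (x \<bullet> \<xi>)) *s f x)"

text \<open>The Fourier--Plancherel transform: \<open>F\<close> is the transform of \<open>f \<in> L\<^sup>2\<close> if it is the \<open>L\<^sup>2\<close> limit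
  of the transforms of the truncations of \<open>f\<close> to the balls of radius \<open>k\<close>. It is
  determined up to null sets; \<open>fourier_L2\<close> selects a representative. The convergence is stated
  with the nonnegative integral, which is \<open>\<infinity>\<close> (rather than 0) when the difference is not
  in \<open>L\<^sup>2\<close>.\<close>

definition has_fourier_L2 ::
  "(real^'n \<Rightarrow> complex^3) \<Rightarrow> (real^'n \<Rightarrow> complex^3) \<Rightarrow> bool" where
  "has_fourier_L2 f F \<longleftrightarrow> L2_fun f \<and> L2_fun F \<and>
     (\<lambda>k::nat. \<integral>\<^sup>+ \<xi>. ennreal ((norm (F \<xi> -
        fourier (\<lambda>x. indicator (cball 0 (real k)) x *\<^sub>R f x) \<xi>))\<^sup>2) \<partial>lebesgue)
       \<longlonglongrightarrow> 0"

definition fourier_L2 :: "(real^'n \<Rightarrow> complex^3) \<Rightarrow> real^'n \<Rightarrow> complex^3" where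
  "fourier_L2 f = (SOME F. has_fourier_L2 f F)"

text \<open>The symbol \<open>|\<xi>|\<^bsup>2\<nu>\<^esup>\<close> of \<open>(-\<Delta>)\<^sup>\<nu>\<close>. The case distinction is needed because \<open>0 powr 0 = 0\<close>.\<close>

definition lap_symbol :: "real \<Rightarrow> real^'n \<Rightarrow> real" where
  "lap_symbol \<nu> \<xi> = (if \<nu> = 0 then 1 else norm \<xi> powr (2 * \<nu>))"

definition Hs_fun :: "real \<Rightarrow> (real^'n \<Rightarrow> complex^3) \<Rightarrow> bool" where
  "Hs_fun s f \<longleftrightarrow>
     (\<exists>F. has_fourier_L2 f F \<and> L2_fun (\<lambda>\<xi>. (1 + (norm \<xi>)\<^sup>2) powr (s / 2) *\<^sub>R F \<xi>))"

text \<open>Membership in the Riesz potential space of order \<open>s\<close>, for functions that are in \<open>L\<^sup>2\<close>, and its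
  norm, i.e. the \<open>L\<^sup>2\<close> norm of \<open>(-\<Delta>)\<^bsup>s/2\<^esup> f\<close> computed on the Fourier side.\<close>

definition Hdot_fun :: "real \<Rightarrow> (real^'n \<Rightarrow> complex^3) \<Rightarrow> bool" where
  "Hdot_fun s f \<longleftrightarrow>
     (\<exists>F. has_fourier_L2 f F \<and> L2_fun (\<lambda>\<xi>. lap_symbol (s / 2) \<xi> *\<^sub>R F \<xi>))"

definition Hdot_norm :: "real \<Rightarrow> (real^'n \<Rightarrow> complex^3) \<Rightarrow> real" where
  "Hdot_norm s f = L2_norm (\<lambda>\<xi>. lap_symbol (s / 2) \<xi> *\<^sub>R fourier_L2 f \<xi>)"

text \<open>\<open>is_multiplier m f g\<close> says \<open>g = m(D) f\<close>.\<close>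

definition is_multiplier ::
  "(real^'n \<Rightarrow> real) \<Rightarrow> (real^'n \<Rightarrow> complex^3) \<Rightarrow> (real^'n \<Rightarrow> complex^3) \<Rightarrow> bool" where
  "is_multiplier m f g \<longleftrightarrow> has_fourier_L2 g (\<lambda>\<xi>. m \<xi> *\<^sub>R fourier_L2 f \<xi>)"

primrec Ck :: "nat \<Rightarrow> (real^'n \<Rightarrow> real) \<Rightarrow> bool" where
  "Ck 0 f \<longleftrightarrow> continuous_on UNIV f"
| "Ck (Suc k) f \<longleftrightarrow> (\<forall>x. f differentiable at x) \<and>
     (\<forall>b\<in>Basis. Ck k (\<lambda>x. frechet_derivative f (at x) b))"

definition smooth :: "(real^'n \<Rightarrow> real) \<Rightarrow> bool" where
  "smooth f \<longleftrightarrow> (\<forall>k. Ck k f)"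

definition supp :: "(real^'n \<Rightarrow> real) \<Rightarrow> (real^'n) set" where
  "supp f = closure {x. f x \<noteq> 0}"

definition cutoff_partition ::
  "real \<Rightarrow> real \<Rightarrow> (real^'n \<Rightarrow> real) \<Rightarrow> (real^'n \<Rightarrow> real) \<Rightarrow> (real^'n \<Rightarrow> real) \<Rightarrow> bool" where
  "cutoff_partition \<epsilon> N \<chi>int \<chi>mid \<chi>ext \<longleftrightarrow>
     smooth \<chi>int \<and> smooth \<chi>mid \<and> smooth \<chi>ext \<and>
     (\<forall>\<xi>. \<chi>int \<xi> + \<chi>mid \<xi> + \<chi>ext \<xi> = 1) \<and>
     supp \<chi>int \<subseteq> {\<xi>. norm \<xi> \<le> \<epsilon>} \<and>
     supp \<chi>mid \<subseteq> {\<xi>. \<epsilon> / 2 \<le> norm \<xi> \<and> norm \<xi> \<le> 2 * N} \<and>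
     supp \<chi>ext \<subseteq> {\<xi>. N \<le> norm \<xi>}"

abbreviation r3 :: complex where "r3 \<equiv> complex_of_real (sqrt 3)"

definition diag3 :: "complex \<Rightarrow> complex \<Rightarrow> complex \<Rightarrow> complex^3^3" where
  "diag3 a b c = vector [vector [a, 0, 0], vector [0, b, 0], vector [0, 0, c]]"

definition D0 :: "complex^3^3" where
  "D0 = vector [vector [\<i> - 1/2, -1/2, 0],
                vector [-1/2, -\<i> - 1/2, 0],
                vector [0, 0, 0]]"

definition D1 :: "complex^3^3" where
  "D1 = vector [vector [0, 0, 1],
                vector [0, 0, 1],
                vector [-1/2, -1/2, -1]]"

definition M1 :: "complex^3^3" where
  "M1 = vector [vector [-1, (\<i> * r3 - 1) / 2, (-\<i> * r3 - 1) / 2],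
                vector [1, (\<i> * r3 - 1) / 2, (-\<i> * r3 - 1) / 2],
                vector [0, 1, 1]]"

definition M2 :: "real \<Rightarrow> real \<Rightarrow> real \<Rightarrow> complex^3^3" where
  "M2 \<sigma> \<alpha> r = (r powr (\<sigma> - 2 * \<sigma> * \<alpha>)) *\<^sub>R
     vector [vector [0, - ((r3 + \<i>) / (1 + r3 * \<i>)), (r3 - \<i>) / (1 - r3 * \<i>)],
             vector [- (2 * r3 / (3 * (1 + r3 * \<i>))), 0, (r3 - \<i>) / (6 * \<i>)],
             vector [2 * r3 / (3 * (1 - r3 * \<i>)), - ((r3 + \<i>) / (6 * \<i>)), 0]]"

definition M4 :: "complex^3^3" where
  "M4 = vector [vector [0, \<i> * (r3 - 2), -\<i> * (r3 + 2)],
                vector [0, 1, 1],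
                vector [1, 0, 0]]"

definition Dt0 :: "complex^3^3" where
  "Dt0 = diag3 0 (1/2 + r3 / 2 * \<i>) (1/2 - r3 / 2 * \<i>)"

definition Dt1 :: "complex^3^3" where
  "Dt1 = diag3 0 (1/2 + r3 / 6 * \<i>) (1/2 - r3 / 6 * \<i>)"

definition Dt2 :: "complex^3^3" where
  "Dt2 = diag3 1 (-1/2 + r3 / 18 * \<i>) (-1/2 - r3 / 18 * \<i>)"

definition Db0 :: "complex^3^3" where
  "Db0 = diag3 0 (1/2 + r3 / 2 * \<i>) (1/2 - r3 / 2 * \<i>)"

definition Db1 :: "complex^3^3" where
  "Db1 = diag3 1 0 0"

text \<open>\<open>solves_system S A V0 v\<close>: the function \<open>v\<close> of time and space solves \<open>v\<^sub>t = A(D) v\<close>,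
  understood through the Fourier transform in space, with initial data whose Fourier transform is
  \<open>V0\<close>, as far as the frequencies in \<open>S\<close> are concerned. Here \<open>V t\<close> is a representative
  of the transform of \<open>v t\<close>. The initial data considered below are integrable, so that \<open>V0\<close> is
  given by the classical \<open>fourier\<close> integral.\<close>

definition solves_system ::
  "(real^'n) set \<Rightarrow> (real^'n \<Rightarrow> complex^3^3) \<Rightarrow> (real^'n \<Rightarrow> complex^3)
    \<Rightarrow> (real \<Rightarrow> real^'n \<Rightarrow> complex^3) \<Rightarrow> bool" where
  "solves_system S A V0 v \<longleftrightarrow>
     (\<exists>V. (\<forall>t\<ge>0. has_fourier_L2 (v t) (V t)) \<and>
          (AE \<xi> in lebesgue. \<xi> \<in> S \<longrightarrow>
             V 0 \<xi> = V0 \<xi> \<and> continuous_on {0..} (\<lambda>t. V t \<xi>) \<and>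
             (\<forall>t>0. ((\<lambda>\<tau>. V \<tau> \<xi>) has_vector_derivative (A \<xi> *v V t \<xi>)) (at t))))"

definition is_solution ::
  "real \<Rightarrow> real \<Rightarrow> (real^'n \<Rightarrow> complex^3) \<Rightarrow> (real \<Rightarrow> real^'n \<Rightarrow> complex^3) \<Rightarrow> bool" where
  "is_solution \<sigma> \<alpha> w0 w \<longleftrightarrow>
     solves_system UNIV
       (\<lambda>\<xi>. lap_symbol (\<sigma> / 2) \<xi> *\<^sub>R D0 + lap_symbol (\<sigma> * \<alpha>) \<xi> *\<^sub>R D1)
       (fourier w0) w"

text \<open>The reference system for \<open>\<alpha> < 1/2\<close>. It is only imposed on the frequencies in \<open>S\<close>, which
  will be the support of \<open>\<chi>int\<close>: elsewhere \<open>I + M2\<close> need not be invertible.\<close>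

definition is_reference_lt ::
  "(real^'n) set \<Rightarrow> real \<Rightarrow> real \<Rightarrow> (real^'n \<Rightarrow> complex^3)
    \<Rightarrow> (real \<Rightarrow> real^'n \<Rightarrow> complex^3) \<Rightarrow> bool" where
  "is_reference_lt S \<sigma> \<alpha> w0 wt \<longleftrightarrow>
     solves_system S
       (\<lambda>\<xi>. - (lap_symbol (\<sigma> * \<alpha>) \<xi> *\<^sub>R Dt0 + lap_symbol \<sigma> \<xi> *\<^sub>R Dt1
                + lap_symbol (\<sigma> - \<sigma> * \<alpha>) \<xi> *\<^sub>R Dt2))
       (\<lambda>\<xi>. (matrix_inv (mat 1 + M2 \<sigma> \<alpha> (norm \<xi>)) ** matrix_inv M1) *v fourier w0 \<xi>) wt"

definition is_reference_gt ::
  "real \<Rightarrow> real \<Rightarrow> (real^'n \<Rightarrow> complex^3) \<Rightarrow> (real \<Rightarrow> real^'n \<Rightarrow> complex^3) \<Rightarrow> bool" where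
  "is_reference_gt \<sigma> \<alpha> w0 wb \<longleftrightarrow>
     solves_system UNIV
       (\<lambda>\<xi>. - (lap_symbol (\<sigma> / 2) \<xi> *\<^sub>R Db0 + lap_symbol (\<sigma> * \<alpha>) \<xi> *\<^sub>R Db1))
       (fourier (\<lambda>x. matrix_inv M4 *v w0 x)) wb"

text \<open>The profiles: \<open>\<chi>int\<close> is the low-frequency cut-off, \<open>wt\<close> and \<open>wb\<close> solve the reference systems.\<close>

definition is_profile_lt ::
  "(real^'n \<Rightarrow> real) \<Rightarrow> real \<Rightarrow> real \<Rightarrow> (real \<Rightarrow> real^'n \<Rightarrow> complex^3)
    \<Rightarrow> (real \<Rightarrow> real^'n \<Rightarrow> complex^3) \<Rightarrow> bool" where
  "is_profile_lt \<chi>int \<sigma> \<alpha> wt Q \<longleftrightarrow>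
     (\<forall>t\<ge>0. has_fourier_L2 (Q t)
        (\<lambda>\<xi>. \<chi>int \<xi> *\<^sub>R ((M1 ** (mat 1 + M2 \<sigma> \<alpha> (norm \<xi>))) *v fourier_L2 (wt t) \<xi>)))"

definition is_profile_gt ::
  "(real^'n \<Rightarrow> real) \<Rightarrow> (real \<Rightarrow> real^'n \<Rightarrow> complex^3)
    \<Rightarrow> (real \<Rightarrow> real^'n \<Rightarrow> complex^3) \<Rightarrow> bool" where
  "is_profile_gt \<chi>int wb Q \<longleftrightarrow>
     (\<forall>t\<ge>0. has_fourier_L2 (Q t) (\<lambda>\<xi>. \<chi>int \<xi> *\<^sub>R (M4 *v fourier_L2 (wb t) \<xi>)))"

end

theory Submission
  imports Defs "HOL-Real_Asymp.Real_Asymp"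
begin

text \<open>
The estimate is a statement about one frequency \<open>\<xi> \<noteq> 0\<close> at a time. There both \<open>w\<close> and its reference
system solve a constant-coefficient \<open>3 \<times> 3\<close> system in \<open>t\<close> whose right-hand side has two competing
sizes, \<open>|\<xi>|\<^sup>\<sigma>\<close> and \<open>|\<xi>|\<close> to the power \<open>2\<sigma>\<alpha>\<close>. For small \<open>|\<xi>|\<close> one of them dominates; call it \<open>p\<close> and let
\<open>\<delta>\<close> be the ratio of the other to it, so \<open>\<delta> = |\<xi>|\<close> to the power \<open>|\<sigma> - 2\<sigma>\<alpha>|\<close>. The dominant matrix
(\<open>D1\<close> if \<open>\<alpha> < 1/2\<close>, \<open>D0\<close> if \<open>\<alpha> > 1/2\<close>) has the eigenvalues \<open>0\<close>, \<open>\<omega>\<close>, \<open>\<omega>'\<close>, the latter two being the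
primitive cube roots of unity with real part \<open>-1/2\<close>. Hence two components decay fast, at rate \<open>p/2\<close>,
and one is slow: perturbation turns the eigenvalue \<open>0\<close> into \<open>-\<eta>\<close> up to higher order, where \<open>\<eta> = \<delta>\<close> for
\<open>\<alpha> > 1/2\<close>, and \<open>\<eta> = \<delta>\<^sup>2\<close> for \<open>\<alpha> < 1/2\<close> because the first-order correction vanishes there.

What is needed is only that the profile agrees with the solution up to the factor \<open>\<delta>\<close>, with the decay
\<open>exp (-p\<eta>t/2)\<close> of the slow component; \<open>\<delta>\<close> is precisely the extra power of \<open>|\<xi>|\<close> that
appears as the extra time decay of the theorem. The fast components may therefore be
perturbed freely at relative size \<open>\<delta>\<close>, and \<open>I + M2\<close> can be replaced by \<open>I\<close>. The argument avoids
diagonalising the perturbed matrix: in coordinates where the coupling has the right size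
(\<open>slow_fast\<close>), an energy estimate bounds all components, Duhamel's formula then shows that the
fast ones are within \<open>O(\<delta>)\<close> of their reference, and a second use of it gives the same for the slow one
(\<open>comparison\<close>). For \<open>\<alpha> > 1/2\<close> the eigencoordinates of \<open>D0\<close> already have this form
(\<open>frequency_error_gt\<close>); for \<open>\<alpha> < 1/2\<close> they have to be corrected at order \<open>\<delta>\<close>, which is where the
term \<open>-\<delta>\<^sup>2\<close> comes from (\<open>frequency_error_lt\<close>).

It remains to integrate (\<open>low_frequency_bound\<close>). The transform of \<open>w\<^sub>0\<close> at \<open>\<xi>\<close> is \<open>P\<close> up to
\<open>|\<xi>|\<close> to the power \<open>\<kappa>\<close> times the weighted \<open>L\<^sup>1\<close> norm, and the \<open>L\<^sup>2\<close> norm of a power of \<open>|\<xi>|\<close> times the exponential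
over a ball has the asserted decay in \<open>t\<close> by scaling.
\<close>


section \<open>Linear differential inequalities\<close>

text \<open>Duhamel's formula for \<open>z' = a z + h\<close>, with the forcing split by whether it decays slower (\<open>b < A\<close>) or
faster (\<open>A < c\<close>) than the homogeneous solution: a slower part dictates its own rate, a faster
part only adds to the amplitude of the homogeneous solution. The integral is avoided by comparing \<open>exp (-a t) z\<close>
with a primitive \<open>m\<close> of the bound on its derivative.\<close>

lemma duhamel_bound:
  fixes z :: "real \<Rightarrow> complex"
  assumes cont: "continuous_on {0..} z"
    and der: "\<And>t. t > 0 \<Longrightarrow> (z has_vector_derivative a * z t + h t) (at t)"
    and a: "Re a = - A" and bA: "b < A" and Ac: "A < c"
    and h: "\<And>t. t > 0 \<Longrightarrow> norm (h t) \<le> G1 * exp (- b * t) + G2 * exp (- c * t)"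
    and G: "0 \<le> G1" "0 \<le> G2" and t: "0 \<le> t"
  shows "norm (z t) \<le> exp (- A * t) * (norm (z 0) + G2 / (c - A)) + G1 / (A - b) * exp (- b * t)"
proof (cases "t = 0")
  case True
  then show ?thesis using bA Ac G by simp
next
  case False
  with t have t0: "0 < t" by simp
  define u where "u \<tau> = exp (- (of_real \<tau> * a)) * z \<tau>" for \<tau> :: real
  define m where "m \<tau> = G1 / (A - b) * exp ((A - b) * \<tau>) - G2 / (c - A) * exp (- (c - A) * \<tau>)" for \<tau> :: real
  have "norm (u t - u 0) \<le> m t - m 0"
  proof (rule differentiable_bound_general[OF t0])
    show "continuous_on {0..t} u" unfolding u_def
      by (intro continuous_intros continuous_on_subset[OF cont]) auto
    show "continuous_on {0..t} m" unfolding m_def by (intro continuous_intros)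
    fix \<tau> assume \<tau>: "0 < \<tau>" "\<tau> < t"
    have 1: "((\<lambda>\<tau>. exp (- (of_real \<tau> * a))) has_vector_derivative - a * exp (- (of_real \<tau> * a))) (at \<tau>)"
      by (rule has_vector_derivative_real_field) (auto intro!: derivative_eq_intros)
    show "(u has_vector_derivative exp (- (of_real \<tau> * a)) * h \<tau>) (at \<tau>)"
      unfolding u_def
      by (rule has_vector_derivative_eq_rhs[OF has_vector_derivative_mult[OF 1 der[OF \<tau>(1)]]])
         (simp add: algebra_simps)
    show "(m has_vector_derivative G1 * exp ((A - b) * \<tau>) + G2 * exp (- (c - A) * \<tau>)) (at \<tau>)"
      unfolding m_def has_real_derivative_iff_has_vector_derivative[symmetric]
      using bA Ac by (auto intro!: derivative_eq_intros simp: divide_simps) (simp add: algebra_simps)?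
    have "norm (exp (- (of_real \<tau> * a)) * h \<tau>) = exp (A * \<tau>) * norm (h \<tau>)"
      using a by (simp add: norm_mult norm_exp_eq_Re mult.commute)
    also have "\<dots> \<le> exp (A * \<tau>) * (G1 * exp (- b * \<tau>) + G2 * exp (- c * \<tau>))"
      using h[OF \<tau>(1)] by simp
    also have "\<dots> = G1 * exp ((A - b) * \<tau>) + G2 * exp (- (c - A) * \<tau>)"
      by (simp add: algebra_simps flip: exp_add)
    finally show "norm (exp (- (of_real \<tau> * a)) * h \<tau>) \<le> \<dots>" .
  qed
  also have "m t - m 0 \<le> G1 / (A - b) * exp ((A - b) * t) + G2 / (c - A)"
  proof -
    have "0 \<le> G2 / (c - A) * exp (- (c - A) * t)" "0 \<le> G1 / (A - b)" using G Ac bA by auto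
    then show ?thesis unfolding m_def by simp
  qed
  finally have "norm (u t) \<le> norm (z 0) + G1 / (A - b) * exp ((A - b) * t) + G2 / (c - A)"
    using norm_triangle_ineq2[of "u t" "u 0"] by (simp add: u_def)
  moreover have "norm (u t) = exp (A * t) * norm (z t)"
    using a by (simp add: u_def norm_mult norm_exp_eq_Re mult.commute)
  ultimately have "exp (- A * t) * (exp (A * t) * norm (z t))
      \<le> exp (- A * t) * (norm (z 0) + G1 / (A - b) * exp ((A - b) * t) + G2 / (c - A))"
    by (intro mult_left_mono) auto
  also have "exp (- A * t) * (exp (A * t) * norm (z t)) = norm (z t)"
    by (simp add: mult.assoc[symmetric] flip: exp_add)
  also have "exp (- A * t) * (norm (z 0) + G1 / (A - b) * exp ((A - b) * t) + G2 / (c - A))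
     = exp (- A * t) * (norm (z 0) + G2 / (c - A)) + G1 / (A - b) * (exp (- A * t) * exp ((A - b) * t))"
    by (simp add: algebra_simps)
  also have "exp (- A * t) * exp ((A - b) * t) = exp (- b * t)"
    by (simp add: algebra_simps flip: exp_add)
  finally show ?thesis .
qed

lemma gronwall_decay:
  fixes E :: "real \<Rightarrow> real"
  assumes cont: "continuous_on {0..} E"
    and der: "\<And>t. t > 0 \<Longrightarrow> (E has_real_derivative E' t) (at t)"
    and le: "\<And>t. t > 0 \<Longrightarrow> E' t \<le> - k * E t" and t: "0 \<le> t"
  shows "E t \<le> exp (- k * t) * E 0"
proof -
  have "exp (k * t) * E t \<le> exp (k * 0) * E 0"
  proof (rule DERIV_nonpos_imp_decreasing_open[OF t])
    fix \<tau> assume \<tau>: "0 < \<tau>" "\<tau> < t"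
    have "((\<lambda>\<tau>. exp (k * \<tau>) * E \<tau>) has_real_derivative exp (k * \<tau>) * (k * E \<tau> + E' \<tau>)) (at \<tau>)"
      by (auto intro!: derivative_eq_intros der[OF \<tau>(1)] simp: algebra_simps)
    moreover have "exp (k * \<tau>) * (k * E \<tau> + E' \<tau>) \<le> 0"
      using le[OF \<tau>(1)] by (simp add: mult_le_0_iff)
    ultimately show "\<exists>y. ((\<lambda>\<tau>. exp (k * \<tau>) * E \<tau>) has_real_derivative y) (at \<tau>) \<and> y \<le> 0" by blast
  next
    show "continuous_on {0..t} (\<lambda>\<tau>. exp (k * \<tau>) * E \<tau>)"
      by (intro continuous_intros continuous_on_subset[OF cont]) auto
  qed
  then have "exp (- k * t) * (exp (k * t) * E t) \<le> exp (- k * t) * E 0"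
    by (intro mult_left_mono) auto
  then show ?thesis by (simp add: mult.assoc[symmetric] flip: exp_add)
qed

lemma has_real_derivative_norm_sq:
  fixes z :: "real \<Rightarrow> complex"
  assumes "(z has_vector_derivative z') (at t)"
  shows "((\<lambda>t. (norm (z t))\<^sup>2) has_real_derivative 2 * (z t \<bullet> z')) (at t)"
proof -
  have "((\<lambda>t. z t \<bullet> z t) has_vector_derivative z t \<bullet> z' + z' \<bullet> z t) (at t)"
    by (rule bounded_bilinear.has_vector_derivative[OF bounded_bilinear_inner assms assms])
  then show ?thesis
    by (simp add: has_real_derivative_iff_has_vector_derivative power2_norm_eq_inner inner_commute)
qed

lemma inner_complex_mult_self: "(z::complex) \<bullet> (a * z) = Re a * (norm z)\<^sup>2"
  unfolding cmod_power2 by (simp add: inner_complex_def power2_eq_square algebra_simps)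

section \<open>Slow-fast systems\<close>

text \<open>The normal form to which both cases are reduced: \<open>y\<close> is the slow component, \<open>f\<close> and \<open>g\<close> are the fast
ones, and time is measured in units of \<open>1/p\<close>. The sizes of the couplings are what makes the
comparison below work. The fast components may act on the slow one at the size \<open>\<eta>\<close> of the slow rate itself, since
they are present only for a time of order \<open>1/p\<close>; but \<open>y\<close> may act on itself only at the smaller size \<open>\<eta>\<delta>\<close>, because
this error accumulates over the time \<open>1/(p\<eta>)\<close>.\<close>

locale slow_fast =
  fixes p \<eta> \<delta> K :: real and \<mu> \<nu> :: complex
    and y f g h1 h2 h3 :: "real \<Rightarrow> complex"
  assumes p: "0 < p" and \<eta>: "0 < \<eta>" and \<eta>\<delta>: "\<eta> \<le> \<delta>" and K: "1 \<le> K"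
    and small: "128 * K\<^sup>2 * \<delta> \<le> 1"
    and re: "Re \<mu> = - 1/2" "Re \<nu> = - 1/2"
    and cont: "continuous_on {0..} y" "continuous_on {0..} f" "continuous_on {0..} g"
    and dy: "\<And>t. t > 0 \<Longrightarrow> (y has_vector_derivative of_real p * (- of_real \<eta> * y t + h1 t)) (at t)"
    and df: "\<And>t. t > 0 \<Longrightarrow> (f has_vector_derivative of_real p * (\<mu> * f t + h2 t)) (at t)"
    and dg: "\<And>t. t > 0 \<Longrightarrow> (g has_vector_derivative of_real p * (\<nu> * g t + h3 t)) (at t)"
    and h1: "\<And>t. t > 0 \<Longrightarrow> norm (h1 t) \<le> K * \<eta> * (\<delta> * norm (y t) + (norm (f t) + norm (g t)))"
    and h2: "\<And>t. t > 0 \<Longrightarrow> norm (h2 t) \<le> K * (\<delta> * (norm (f t) + norm (g t)) + \<eta> * norm (y t))"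
    and h3: "\<And>t. t > 0 \<Longrightarrow> norm (h3 t) \<le> K * (\<delta> * (norm (f t) + norm (g t)) + \<eta> * norm (y t))"
begin

definition init_size :: real where "init_size = norm (y 0) + norm (f 0) + norm (g 0)"

lemma \<delta>_pos: "0 < \<delta>" using \<eta> \<eta>\<delta> by simp

lemma K\<delta>_le: "K * \<delta> \<le> 1/128"
proof -
  have "K * \<delta> \<le> K\<^sup>2 * \<delta>" using K \<delta>_pos by (simp add: power2_eq_square)
  with small show ?thesis by simp
qed

lemma \<delta>_small: "\<delta> \<le> 1/128"
proof -
  have "1 * \<delta> \<le> K * \<delta>" using K \<delta>_pos by (intro mult_right_mono) auto
  with K\<delta>_le show ?thesis by simp
qed

text \<open>The mixed terms are absorbed by Young's inequality; the weight is chosen such that \<open>Y\<^sup>2\<close> receives only a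
quarter of its own coefficient \<open>\<eta>\<close>, and what falls on \<open>F\<^sup>2 + G\<^sup>2\<close> is then of size \<open>K\<^sup>2 \<eta>\<close>.\<close>

lemma energy_inequality:
  fixes Y F G :: real
  assumes "0 \<le> Y" "0 \<le> F" "0 \<le> G"
  shows "- \<eta> * Y\<^sup>2 + - 1/2 * F\<^sup>2 + - 1/2 * G\<^sup>2 + Y * (K * \<eta> * (\<delta> * Y + (F + G)))
     + (F + G) * (K * (\<delta> * (F + G) + \<eta> * Y)) \<le> - (\<eta> / 2) * (Y\<^sup>2 + F\<^sup>2 + G\<^sup>2)"
proof -
  have FG: "(F + G)\<^sup>2 \<le> 2 * (F\<^sup>2 + G\<^sup>2)"
    using sum_squares_ge_zero[of "F - G" 0] by (simp add: power2_eq_square algebra_simps)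
  have 1: "2 * Y * (K * (F + G)) \<le> Y\<^sup>2 / 4 + 4 * (K * (F + G))\<^sup>2"
    using sum_squares_ge_zero[of "Y / 2 - 2 * (K * (F + G))" 0] by (simp add: power2_eq_square algebra_simps)
  have "K\<^sup>2 * \<eta> \<le> 1/128"
    using mult_left_mono[OF \<eta>\<delta>, of "K\<^sup>2"] small by simp
  then have 2: "4 * (K\<^sup>2 * \<eta>) * (F + G)\<^sup>2 \<le> 1/32 * (F + G)\<^sup>2" by (intro mult_right_mono) auto
  have 3: "\<eta> * (2 * Y * (K * (F + G))) \<le> \<eta> * Y\<^sup>2 / 4 + 4 * (K\<^sup>2 * \<eta>) * (F + G)\<^sup>2"
    using mult_left_mono[OF 1, of \<eta>] \<eta> by (simp add: power2_eq_square algebra_simps)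
  have 4: "(K * \<delta>) * (\<eta> * Y\<^sup>2) \<le> 1/128 * (\<eta> * Y\<^sup>2)" using K\<delta>_le \<eta> by (intro mult_right_mono) auto
  have 5: "(K * \<delta>) * (F + G)\<^sup>2 \<le> 1/128 * (F + G)\<^sup>2" using K\<delta>_le by (intro mult_right_mono) auto
  have 6: "\<eta> / 2 * (F\<^sup>2 + G\<^sup>2) \<le> 1/256 * (F\<^sup>2 + G\<^sup>2)" using \<delta>_small \<eta>\<delta> by (intro mult_right_mono) auto
  have 7: "0 \<le> \<eta> * Y\<^sup>2" using \<eta> by simp
  have 8: "0 \<le> F\<^sup>2 + G\<^sup>2" by simp
  have "- \<eta> * Y\<^sup>2 + - 1/2 * F\<^sup>2 + - 1/2 * G\<^sup>2 + Y * (K * \<eta> * (\<delta> * Y + (F + G)))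
     + (F + G) * (K * (\<delta> * (F + G) + \<eta> * Y))
     = - (\<eta> * Y\<^sup>2) - 1/2 * (F\<^sup>2 + G\<^sup>2) + (K * \<delta>) * (\<eta> * Y\<^sup>2) + (K * \<delta>) * (F + G)\<^sup>2
       + \<eta> * (2 * Y * (K * (F + G)))"
    by (simp add: power2_eq_square algebra_simps)
  also have "\<dots> \<le> - (\<eta> * Y\<^sup>2) / 2 - \<eta> / 2 * (F\<^sup>2 + G\<^sup>2)"
  proof -
    have "- R - 1/2 * P + U + V + W \<le> - R / 2 - T"
      if "Q \<le> 2 * P" "X \<le> 1/32 * Q" "W \<le> R / 4 + X" "U \<le> 1/128 * R" "V \<le> 1/128 * Q"
         "T \<le> 1/256 * P" "0 \<le> R" "0 \<le> P" for R P Q T U V W X :: real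
      using that by linarith
    from this[OF FG 2 3 4 5 6 7 8] show ?thesis .
  qed
  also have "\<dots> = - (\<eta> / 2) * (Y\<^sup>2 + F\<^sup>2 + G\<^sup>2)" by (simp add: algebra_simps)
  finally show ?thesis .
qed

text \<open>Every component decays at half the slow rate. This first bound loses the \<open>O(\<delta>)\<close> smallness, but it is all that is
needed to treat the couplings as forcing terms.\<close>

lemma energy_decay:
  assumes t: "0 \<le> t"
  shows "norm (y t) \<le> exp (- (p * \<eta> / 2) * t) * init_size"
    and "norm (f t) \<le> exp (- (p * \<eta> / 2) * t) * init_size"
    and "norm (g t) \<le> exp (- (p * \<eta> / 2) * t) * init_size"
proof -
  define E where "E t = (norm (y t))\<^sup>2 + (norm (f t))\<^sup>2 + (norm (g t))\<^sup>2" for t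
  have "E t \<le> exp (- (p * \<eta>) * t) * E 0"
  proof (rule gronwall_decay[OF _ _ _ t])
    show "continuous_on {0..} E" unfolding E_def by (intro continuous_intros cont)
  next
    fix t :: real assume t: "t > 0"
    let ?E' = "2 * (y t \<bullet> (of_real p * (- of_real \<eta> * y t + h1 t)))
        + 2 * (f t \<bullet> (of_real p * (\<mu> * f t + h2 t))) + 2 * (g t \<bullet> (of_real p * (\<nu> * g t + h3 t)))"
    show "(E has_real_derivative ?E') (at t)"
      unfolding E_def by (intro DERIV_add has_real_derivative_norm_sq dy df dg t)
    have exp: "z \<bullet> (of_real p * (a * z + h)) \<le> p * (Re a * (norm z)\<^sup>2 + norm z * norm h)" for z a h :: complex
    proof -
      have "z \<bullet> (of_real p * (a * z + h)) = p * (z \<bullet> (a * z) + z \<bullet> h)"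
        by (simp add: inner_complex_def algebra_simps)
      also have "\<dots> \<le> p * (Re a * (norm z)\<^sup>2 + norm z * norm h)"
        using p norm_cauchy_schwarz[of z h] by (simp add: inner_complex_mult_self)
      finally show ?thesis .
    qed
    have "?E' \<le> 2 * (p * (Re (- of_real \<eta>) * (norm (y t))\<^sup>2 + norm (y t) * norm (h1 t)))
       + 2 * (p * (Re \<mu> * (norm (f t))\<^sup>2 + norm (f t) * norm (h2 t)))
       + 2 * (p * (Re \<nu> * (norm (g t))\<^sup>2 + norm (g t) * norm (h3 t)))"
      using exp[of "y t" "- of_real \<eta>" "h1 t"] exp[of "f t" \<mu> "h2 t"] exp[of "g t" \<nu> "h3 t"] by linarith
    also have "\<dots> = 2 * p * (- \<eta> * (norm (y t))\<^sup>2 + - 1/2 * (norm (f t))\<^sup>2 + - 1/2 * (norm (g t))\<^sup>2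
       + norm (y t) * norm (h1 t) + (norm (f t) * norm (h2 t) + norm (g t) * norm (h3 t)))"
      by (simp add: re algebra_simps)
    also have "\<dots> \<le> 2 * p * (- \<eta> * (norm (y t))\<^sup>2 + - 1/2 * (norm (f t))\<^sup>2 + - 1/2 * (norm (g t))\<^sup>2
       + norm (y t) * (K * \<eta> * (\<delta> * norm (y t) + (norm (f t) + norm (g t))))
       + (norm (f t) * (K * (\<delta> * (norm (f t) + norm (g t)) + \<eta> * norm (y t)))
          + norm (g t) * (K * (\<delta> * (norm (f t) + norm (g t)) + \<eta> * norm (y t)))))"
      using p h1[OF t] h2[OF t] h3[OF t] by (intro mult_left_mono add_mono order_refl) auto
    also have "\<dots> \<le> 2 * p * (- (\<eta> / 2) * ((norm (y t))\<^sup>2 + (norm (f t))\<^sup>2 + (norm (g t))\<^sup>2))"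
      using p energy_inequality[of "norm (y t)" "norm (f t)" "norm (g t)"]
      by (intro mult_left_mono) (auto simp: algebra_simps)
    also have "\<dots> = - (p * \<eta>) * E t" by (simp add: E_def)
    finally show "?E' \<le> - (p * \<eta>) * E t" .
  qed
  also have "exp (- (p * \<eta>) * t) * E 0 \<le> exp (- (p * \<eta>) * t) * init_size\<^sup>2"
    by (intro mult_left_mono) (auto simp: E_def init_size_def power2_eq_square algebra_simps)
  also have "\<dots> = (exp (- (p * \<eta> / 2) * t) * init_size)\<^sup>2"
    by (simp add: power_mult_distrib flip: exp_double)
  finally have E: "E t \<le> (exp (- (p * \<eta> / 2) * t) * init_size)\<^sup>2" .
  have init_size: "0 \<le> exp (- (p * \<eta> / 2) * t) * init_size" by (simp add: init_size_def)
  show "norm (y t) \<le> exp (- (p * \<eta> / 2) * t) * init_size"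
    by (rule power2_le_imp_le[OF order_trans[OF _ E] init_size]) (simp add: E_def)
  show "norm (f t) \<le> exp (- (p * \<eta> / 2) * t) * init_size"
    by (rule power2_le_imp_le[OF order_trans[OF _ E] init_size]) (simp add: E_def)
  show "norm (g t) \<le> exp (- (p * \<eta> / 2) * t) * init_size"
    by (rule power2_le_imp_le[OF order_trans[OF _ E] init_size]) (simp add: E_def)
qed

lemma init_size_nonneg: "0 \<le> init_size" by (simp add: init_size_def)

lemma fast_forcing:
  assumes t: "0 < t" and h: "norm h \<le> K * (\<delta> * (norm (f t) + norm (g t)) + \<eta> * norm (y t))"
  shows "norm h \<le> 3 * K * \<delta> * init_size * exp (- (p * \<eta> / 2) * t)"
proof -
  let ?e = "exp (- (p * \<eta> / 2) * t) * init_size"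
  note d = energy_decay[OF less_imp_le[OF t]]
  have e: "0 \<le> ?e" using init_size_nonneg by simp
  have "norm h \<le> K * (\<delta> * (?e + ?e) + \<delta> * ?e)"
    by (rule order_trans[OF h]) (use K \<delta>_pos \<eta> \<eta>\<delta> d e in \<open>intro mult_left_mono add_mono mult_mono; simp\<close>)
  then show ?thesis by (simp add: algebra_simps)
qed

text \<open>One fast component \<open>z\<close> against its reference \<open>v\<close>, whose coefficient may differ by \<open>O(\<delta>)\<close>. Both the coupling \<open>H\<close>
and this difference are forcing terms of relative size \<open>\<delta>\<close>, and the fast rate \<open>p/2\<close> integrates them without loss.\<close>

lemma fast_difference:
  fixes z v H :: "real \<Rightarrow> complex"
  assumes reg: "Re \<omega> = - 1/2" and cz: "continuous_on {0..} z"
    and dz: "\<And>t. t > 0 \<Longrightarrow> (z has_vector_derivative of_real p * (\<omega> * z t + H t)) (at t)"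
    and H: "\<And>t. t > 0 \<Longrightarrow> norm (H t) \<le> 3 * K * \<delta> * init_size * exp (- (p * \<eta> / 2) * t)"
    and cv: "continuous_on {0..} v"
    and dv: "\<And>t. t > 0 \<Longrightarrow> (v has_vector_derivative of_real p * ((\<omega> + \<rho>) * v t)) (at t)"
    and \<rho>: "norm \<rho> \<le> K * \<delta>"
    and init: "norm (z 0 - v 0) \<le> K * \<delta> * init_size" and z0: "norm (z 0) \<le> init_size" and t: "0 \<le> t"
  shows "norm (z t - v t) \<le> 21 * K * \<delta> * init_size * exp (- (p * \<eta> / 2) * t)"
    and "norm (v t) \<le> 2 * init_size * exp (- (p / 4) * t)"
proof -
  have "norm (v 0) \<le> norm (z 0) + norm (z 0 - v 0)"
    by (metis norm_minus_commute norm_triangle_sub)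
  also have "\<dots> \<le> init_size + 1 * init_size"
    using init z0 mult_right_mono[OF K\<delta>_le init_size_nonneg] init_size_nonneg by simp
  finally have v0: "norm (v 0) \<le> 2 * init_size" by simp
  have re\<rho>: "\<bar>Re \<rho>\<bar> \<le> 1/128" using abs_Re_le_cmod[of \<rho>] \<rho> K\<delta>_le by linarith
  have vb: "norm (v t) \<le> 2 * init_size * exp (- (p / 4) * t)" if t: "0 \<le> t" for t
  proof -
    define A where "A = p * (1/2 - Re \<rho>)"
    have "p * (1/4) \<le> A" unfolding A_def using re\<rho> p by (intro mult_left_mono) (auto simp: abs_le_iff)
    then have Ap: "p / 4 \<le> A" by simp
    have "norm (v t) \<le> exp (- A * t) * (norm (v 0) + 0 / ((A + 1) - A)) + 0 / (A - (A - 1)) * exp (- (A - 1) * t)"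
      by (rule duhamel_bound[where a = "of_real p * (\<omega> + \<rho>)" and h = "\<lambda>_. 0", OF cv _ _ _ _ _ _ _ t])
         (use dv reg in \<open>auto simp: mult.assoc A_def algebra_simps\<close>)
    also have "\<dots> \<le> exp (- (p / 4) * t) * (2 * init_size)"
      using v0 mult_right_mono[OF Ap t] by (auto intro!: mult_mono)
    finally show ?thesis by (simp add: mult.commute)
  qed
  from vb[OF t] show "norm (v t) \<le> 2 * init_size * exp (- (p / 4) * t)" .
  let ?b = "p * \<eta> / 2" and ?G = "5 * K * p * \<delta> * init_size"
  have \<eta>4: "\<eta> \<le> 1/128" using \<eta>\<delta> \<delta>_small by simp
  have bA: "?b \<le> p / 4" using p \<eta>4 by simp
  have "norm (z t - v t) \<le> exp (- (p / 2) * t) * (norm (z 0 - v 0) + 0 / ((p / 2 + 1) - p / 2))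
       + ?G / (p / 2 - ?b) * exp (- ?b * t)"
  proof (rule duhamel_bound[where a = "of_real p * \<omega>" and h = "\<lambda>t. of_real p * (H t - \<rho> * v t)"
        and z = "\<lambda>t. z t - v t", OF _ _ _ _ _ _ _ _ t])
    show "continuous_on {0..} (\<lambda>t. z t - v t)" by (intro continuous_intros cz cv)
    show "0 \<le> ?G" using K p \<delta>_pos init_size_nonneg by simp
    fix t :: real assume t: "0 < t"
    show "((\<lambda>t. z t - v t) has_vector_derivative of_real p * \<omega> * (z t - v t) + of_real p * (H t - \<rho> * v t)) (at t)"
      by (rule has_vector_derivative_eq_rhs[OF has_vector_derivative_diff[OF dz[OF t] dv[OF t]]])
         (simp add: algebra_simps)
    have "norm (\<rho> * v t) \<le> (K * \<delta>) * (2 * init_size * exp (- (p / 4) * t))"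
      unfolding norm_mult using \<rho> vb[of t] t K \<delta>_pos by (intro mult_mono) auto
    also have "\<dots> \<le> (K * \<delta>) * (2 * init_size * exp (- ?b * t))"
      using K \<delta>_pos init_size_nonneg mult_right_mono[OF bA less_imp_le[OF t]] by (intro mult_left_mono) auto
    finally have "norm (H t - \<rho> * v t) \<le> 5 * K * \<delta> * init_size * exp (- ?b * t)"
      using H[OF t] norm_triangle_ineq4[of "H t" "\<rho> * v t"] by (simp add: algebra_simps)
    then have "p * norm (H t - \<rho> * v t) \<le> p * (5 * K * \<delta> * init_size * exp (- ?b * t))" using p by simp
    moreover have "norm (of_real p * (H t - \<rho> * v t)) = p * norm (H t - \<rho> * v t)"
      using p by (simp only: norm_mult) simp
    ultimately show "norm (of_real p * (H t - \<rho> * v t)) \<le> ?G * exp (- ?b * t) + 0 * exp (- (p / 2 + 1) * t)"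
      by (simp add: algebra_simps)
  qed (use reg p \<eta>4 in auto)
  also have "\<dots> \<le> exp (- ?b * t) * (K * \<delta> * init_size) + 20 * K * \<delta> * init_size * exp (- ?b * t)"
  proof (intro add_mono mult_mono)
    have "?G / (p / 2 - ?b) \<le> ?G / (p / 4)"
      using p \<eta>4 bA K \<delta>_pos init_size_nonneg by (intro divide_left_mono) (auto intro!: mult_pos_pos)
    also have "\<dots> = 20 * K * \<delta> * init_size" using p by simp
    finally show "?G / (p / 2 - ?b) \<le> 20 * K * \<delta> * init_size" .
    have "?b * t \<le> p / 2 * t" using bA p t by (intro mult_right_mono) auto
    then show "exp (- (p / 2) * t) \<le> exp (- ?b * t)" by simp
  qed (use init K \<delta>_pos init_size_nonneg in auto)
  finally show "norm (z t - v t) \<le> 21 * K * \<delta> * init_size * exp (- ?b * t)" by (simp add: algebra_simps)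
qed

text \<open>For the slow component the fast ones are now known to be a sum of a part decaying at rate \<open>p/4\<close> and
a part of size \<open>\<delta>\<close>. In Duhamel's formula the first contributes \<open>O(\<eta>)\<close>, and the second, multiplied by the coupling
\<open>\<eta>\<close> and integrated at rate \<open>p\<eta>\<close>, contributes \<open>O(\<delta>)\<close>. The constant is \<open>119 = 1 + 32 + 86\<close>.\<close>

theorem comparison:
  fixes yR fR gR :: "real \<Rightarrow> complex"
  assumes cR: "continuous_on {0..} yR" "continuous_on {0..} fR" "continuous_on {0..} gR"
    and dyR: "\<And>t. t > 0 \<Longrightarrow> (yR has_vector_derivative of_real p * (- of_real \<eta> * yR t)) (at t)"
    and dfR: "\<And>t. t > 0 \<Longrightarrow> (fR has_vector_derivative of_real p * ((\<mu> + \<rho>) * fR t)) (at t)"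
    and dgR: "\<And>t. t > 0 \<Longrightarrow> (gR has_vector_derivative of_real p * ((\<nu> + \<rho>') * gR t)) (at t)"
    and \<rho>: "norm \<rho> \<le> K * \<delta>" "norm \<rho>' \<le> K * \<delta>"
    and init: "norm (y 0 - yR 0) \<le> K * \<delta> * init_size" "norm (f 0 - fR 0) \<le> K * \<delta> * init_size"
      "norm (g 0 - gR 0) \<le> K * \<delta> * init_size"
    and t: "0 \<le> t"
  shows "norm (y t - yR t) \<le> 119 * K\<^sup>2 * \<delta> * init_size * exp (- (p * \<eta> / 2) * t)"
    and "norm (f t - fR t) \<le> 119 * K\<^sup>2 * \<delta> * init_size * exp (- (p * \<eta> / 2) * t)"
    and "norm (g t - gR t) \<le> 119 * K\<^sup>2 * \<delta> * init_size * exp (- (p * \<eta> / 2) * t)"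
proof -
  let ?b = "p * \<eta> / 2"
  have S: "norm (f 0) \<le> init_size" "norm (g 0) \<le> init_size" by (simp_all add: init_size_def)
  note F = fast_difference[OF re(1) cont(2) df fast_forcing[OF _ h2] cR(2) dfR \<rho>(1) init(2) S(1)]
  note G = fast_difference[OF re(2) cont(3) dg fast_forcing[OF _ h3] cR(3) dgR \<rho>(2) init(3) S(2)]
  have KK: "21 * K * \<delta> * init_size * exp (- ?b * t) \<le> 119 * K\<^sup>2 * \<delta> * init_size * exp (- ?b * t)"
    using K \<delta>_pos init_size_nonneg
    by (intro mult_right_mono) (auto simp: power2_eq_square intro!: mult_mono)
  show "norm (f t - fR t) \<le> 119 * K\<^sup>2 * \<delta> * init_size * exp (- ?b * t)"
      using order_trans[OF F(1)[OF _ _ _ _ t] KK] by simp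
  show "norm (g t - gR t) \<le> 119 * K\<^sup>2 * \<delta> * init_size * exp (- ?b * t)"
      using order_trans[OF G(1)[OF _ _ _ _ t] KK] by simp
  have \<eta>4: "\<eta> \<le> 1/128" using \<eta>\<delta> \<delta>_small by simp
  let ?G1 = "43 * K\<^sup>2 * p * \<eta> * \<delta> * init_size" and ?G2 = "4 * K * p * \<eta> * init_size"
  have "norm (y t - yR t) \<le> exp (- (p * \<eta>) * t) * (norm (y 0 - yR 0) + ?G2 / (p / 4 - p * \<eta>))
      + ?G1 / (p * \<eta> - ?b) * exp (- ?b * t)"
  proof (rule duhamel_bound[where a = "- of_real (p * \<eta>)" and h = "\<lambda>t. of_real p * h1 t"
        and z = "\<lambda>t. y t - yR t", OF _ _ _ _ _ _ _ _ t])
    show "continuous_on {0..} (\<lambda>t. y t - yR t)" by (intro continuous_intros cont cR)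
    show "0 \<le> ?G1" "0 \<le> ?G2" using K p \<eta> \<delta>_pos init_size_nonneg by auto
    show "p * \<eta> < p / 4" "?b < p * \<eta>" using p \<eta> \<eta>4 by auto
    fix t :: real assume t: "0 < t"
    show "((\<lambda>t. y t - yR t) has_vector_derivative - of_real (p * \<eta>) * (y t - yR t) + of_real p * h1 t) (at t)"
      by (rule has_vector_derivative_eq_rhs[OF has_vector_derivative_diff[OF dy[OF t] dyR[OF t]]])
         (simp add: algebra_simps)
    let ?e = "exp (- ?b * t)" and ?q = "exp (- (p / 4) * t)"
    have f: "norm (f t) \<le> 21 * K * \<delta> * init_size * ?e + 2 * init_size * ?q"
      using F[of t] t norm_triangle_sub[of "f t" "fR t"] by force
    have g: "norm (g t) \<le> 21 * K * \<delta> * init_size * ?e + 2 * init_size * ?q"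
      using G[of t] t norm_triangle_sub[of "g t" "gR t"] by force
    have y: "\<delta> * norm (y t) \<le> K * \<delta> * init_size * ?e"
    proof -
      have "\<delta> * norm (y t) \<le> \<delta> * (?e * init_size)" using energy_decay(1)[of t] t \<delta>_pos by (intro mult_left_mono) auto
      also have "\<dots> \<le> K * (\<delta> * (?e * init_size))" using K \<delta>_pos init_size_nonneg mult_right_mono[of 1 K "\<delta> * (?e
          * init_size)"] by simp
      finally show ?thesis by (simp add: algebra_simps)
    qed
    have "norm (of_real p * h1 t) \<le> p * (K * \<eta> * (\<delta> * norm (y t) + (norm (f t) + norm (g t))))"
      using p h1[OF t] by (simp add: norm_mult)
    also have "\<dots> \<le> p * (K * \<eta> * (43 * K * \<delta> * init_size * ?e + 4 * init_size * ?q))"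
      using p K \<eta> y f g by (intro mult_left_mono) auto
    also have "\<dots> = ?G1 * ?e + ?G2 * ?q" by (simp add: power2_eq_square algebra_simps)
    finally show "norm (of_real p * h1 t) \<le> ?G1 * ?e + ?G2 * ?q" .
  qed simp
  also have "\<dots> \<le> exp (- ?b * t) * (K * \<delta> * init_size + 32 * K * \<delta> * init_size) + 86 * K\<^sup>2 * \<delta> * init_size * exp
      (- ?b * t)"
  proof (intro add_mono mult_mono)
    have "?G2 / (p / 4 - p * \<eta>) \<le> ?G2 / (p / 8)"
      using p \<eta>4 K \<eta> init_size_nonneg by (intro divide_left_mono) (auto intro!: mult_pos_pos)
    also have "\<dots> = 32 * K * init_size * \<eta>" using p by simp
    also have "\<dots> \<le> 32 * K * init_size * \<delta>" using \<eta>\<delta> K init_size_nonneg by (intro mult_left_mono) auto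
    finally show "?G2 / (p / 4 - p * \<eta>) \<le> 32 * K * \<delta> * init_size" by (simp add: algebra_simps)
    show "?G1 / (p * \<eta> - ?b) \<le> 86 * K\<^sup>2 * \<delta> * init_size" using p \<eta> by (simp add: field_simps)
    show "exp (- (p * \<eta>) * t) \<le> exp (- ?b * t)" using p \<eta> t by simp
    show "0 \<le> norm (y 0 - yR 0) + ?G2 / (p / 4 - p * \<eta>)" using p \<eta>4 \<eta> K init_size_nonneg
      by (auto intro!: add_nonneg_nonneg divide_nonneg_nonneg)
  qed (use init K \<delta>_pos init_size_nonneg in auto)
  also have "\<dots> \<le> 119 * K\<^sup>2 * \<delta> * init_size * exp (- ?b * t)"
  proof -
    have "K * (\<delta> * init_size * exp (- ?b * t)) \<le> K\<^sup>2 * (\<delta> * init_size * exp (- ?b * t))"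
      using K \<delta>_pos init_size_nonneg by (intro mult_right_mono) (auto simp: power2_eq_square)
    then show ?thesis by (simp add: algebra_simps)
  qed
  finally show "norm (y t - yR t) \<le> 119 * K\<^sup>2 * \<delta> * init_size * exp (- ?b * t)" .
qed

end

section \<open>The symbol in adapted coordinates\<close>

text \<open>\<open>D0\<close> and \<open>D1\<close> are sparse in the coordinates \<open>s = w\<^sub>1 + w\<^sub>2\<close>, \<open>d = w\<^sub>1 - w\<^sub>2\<close>, \<open>c = w\<^sub>3\<close>: \<open>D1\<close> couples only \<open>s\<close>
and \<open>c\<close>, and \<open>D0\<close> only \<open>s\<close> and \<open>d\<close>.\<close>

definition sum12 :: "complex^3 \<Rightarrow> complex" where "sum12 w = w $ 1 + w $ 2"
definition diff12 :: "complex^3 \<Rightarrow> complex" where "diff12 w = w $ 1 - w $ 2"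

lemma bounded_linear_coords: "bounded_linear sum12" "bounded_linear diff12"
  unfolding sum12_def[abs_def] diff12_def[abs_def]
  by (intro bounded_linear_add bounded_linear_sub bounded_linear_vec_nth)+

lemma coords_diff: "sum12 (v - w) = sum12 v - sum12 w" "diff12 (v - w) = diff12 v - diff12 w"
  by (simp_all add: sum12_def diff12_def)

lemma norm_coords_le: "norm (sum12 w) \<le> 2 * norm w" "norm (diff12 w) \<le> 2 * norm w"
  using Finite_Cartesian_Product.norm_nth_le[of w 1] Finite_Cartesian_Product.norm_nth_le[of w 2]
    norm_triangle_ineq[of "w $ 1" "w $ 2"] norm_triangle_ineq4[of "w $ 1" "w $ 2"]
  by (auto simp: sum12_def diff12_def)

lemma norm_le_coords: "norm w \<le> norm (sum12 w) + norm (diff12 w) + norm (w $ 3)"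
proof -
  have "norm w \<le> norm (w $ 1) + norm (w $ 2) + norm (w $ 3)"
    unfolding norm_vec_def using L2_set_le_sum[of UNIV "\<lambda>i. norm (w $ i)"] by (simp add: sum_3)
  moreover have "sum12 w + diff12 w = 2 * w $ 1" "sum12 w - diff12 w = 2 * w $ 2"
    by (simp_all add: sum12_def diff12_def)
  then have "2 * norm (w $ 1) = norm (sum12 w + diff12 w)" "2 * norm (w $ 2) = norm (sum12 w - diff12 w)"
    by (simp_all add: norm_mult)
  ultimately show ?thesis
    using norm_triangle_ineq[of "sum12 w" "diff12 w"] norm_triangle_ineq4[of "sum12 w" "diff12 w"] by linarith
qed

text \<open>The nonzero eigenvalues of \<open>D0\<close> and also of \<open>D1\<close>: the primitive cube roots of unity.\<close>

definition \<omega> :: complex where "\<omega> = - (1/2) - r3 / 2 * \<i>"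
definition \<omega>' :: complex where "\<omega>' = - (1/2) + r3 / 2 * \<i>"

lemma \<omega>_char: "\<omega> * \<omega> + \<omega> + 1 = 0" "\<omega>' * \<omega>' + \<omega>' + 1 = 0"
  by (simp_all add: \<omega>_def \<omega>'_def complex_eq_iff)

lemma \<omega>_simps: "Re \<omega> = - 1/2" "Re \<omega>' = - 1/2" "norm \<omega> = 1" "norm \<omega>' = 1" "\<omega> - \<omega>' = - (r3 * \<i>)"
  by (simp_all add: \<omega>_def \<omega>'_def cmod_def power_divide)

lemma norm_r3: "1 \<le> norm r3" "norm r3 \<le> 2"
  using real_sqrt_le_mono[of 1 3] real_sqrt_le_mono[of 3 4] by simp_all

lemma M1_invertible: "invertible M1"
  unfolding invertible_det_nz det_3 M1_def by (simp add: vector_3 complex_eq_iff)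

lemma M4_invertible: "invertible M4"
  unfolding invertible_det_nz det_3 M4_def by (simp add: vector_3 complex_eq_iff)

lemma matrix_bound:
  fixes A :: "complex^3^3"
  obtains k where "1 \<le> k" "\<And>v. norm (A *v v) \<le> k * norm v"
proof -
  from bounded_linear.bounded[OF matrix_vector_mul_bounded_linear[of A]]
  obtain K where K: "\<And>v. norm (A *v v) \<le> norm v * K" by blast
  have "norm (A *v v) \<le> max 1 K * norm v" for v
    using K[of v] mult_right_mono[of K "max 1 K" "norm v"] by (simp add: mult.commute)
  then show ?thesis using that[of "max 1 K"] by auto
qed

lemma matrix_inv_mult_right:
  fixes A :: "complex^3^3"
  assumes "invertible A" shows "A *v (matrix_inv A *v x) = x"
proof -
  have "A ** matrix_inv A = mat 1 \<and> matrix_inv A ** A = mat 1"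
    using assms unfolding invertible_def matrix_inv_def by (rule someI_ex)
  then show ?thesis by (simp add: matrix_vector_mul_assoc)
qed

lemma vector_derivative_nth:
  assumes "(W has_vector_derivative D) F" shows "((\<lambda>t. W t $ i) has_vector_derivative D $ i) F"
  by (rule bounded_linear.has_vector_derivative[OF bounded_linear_vec_nth assms])

lemma vector_derivative_coords:
  assumes "(W has_vector_derivative D) F"
  shows "((\<lambda>t. sum12 (W t)) has_vector_derivative sum12 D) F"
    "((\<lambda>t. diff12 (W t)) has_vector_derivative diff12 D) F"
  by (rule bounded_linear.has_vector_derivative[OF bounded_linear_coords(1) assms]
      bounded_linear.has_vector_derivative[OF bounded_linear_coords(2) assms])+

lemma continuous_on_coords:
  assumes "continuous_on A W"
  shows "continuous_on A (\<lambda>t. sum12 (W t))" "continuous_on A (\<lambda>t. diff12 (W t))"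
  by (rule bounded_linear.continuous_on[OF bounded_linear_coords(1) assms]
      bounded_linear.continuous_on[OF bounded_linear_coords(2) assms])+

lemma system_coords:
  fixes p q :: real
  defines "A \<equiv> q *\<^sub>R D0 + p *\<^sub>R D1"
  shows "sum12 (A *v w) = of_real p * (2 * w $ 3) + of_real q * (\<i> * diff12 w - sum12 w)"
    "diff12 (A *v w) = of_real q * (\<i> * sum12 w)"
    "(A *v w) $ 3 = - of_real p * (sum12 w / 2 + w $ 3)"
  by (simp_all add: A_def sum12_def diff12_def D0_def D1_def matrix_vector_mult_def sum_3 vector_3
      scaleR_conv_of_real[where 'a = complex] algebra_simps)

text \<open>The two fast left eigenvectors differ only through \<open>\<omega>\<close> and \<open>\<omega>'\<close>, and \<open>|\<omega> - \<omega>'| = \<surd>3\<close>; so the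
difference of the two fast coordinates controls one of the original ones.\<close>

lemma recover_from_fast:
  shows "norm z \<le> norm ((\<omega> - \<omega>') * z)"
    "norm ((x - 2 * \<omega> * z) - (x - 2 * \<omega>' * z)) = 2 * norm ((\<omega> - \<omega>') * z)"
proof -
  show "norm z \<le> norm ((\<omega> - \<omega>') * z)"
    using norm_r3 mult_right_mono[of 1 "norm r3" "norm z"] by (simp add: \<omega>_simps(5) norm_mult)
  have "(x - 2 * \<omega> * z) - (x - 2 * \<omega>' * z) = - (2 * ((\<omega> - \<omega>') * z))" by (simp add: algebra_simps)
  then show "norm ((x - 2 * \<omega> * z) - (x - 2 * \<omega>' * z)) = 2 * norm ((\<omega> - \<omega>') * z)"
    by (simp only: norm_minus_cancel norm_mult) simp
qed

section \<open>Fixed frequencies, \<open>\<alpha> > 1/2\<close>\<close>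

text \<open>The linear forms \<open>d - \<i> \<omega> s\<close> and \<open>d - \<i> \<omega>' s\<close> are the left eigenvectors of \<open>D0\<close> for \<open>\<omega>\<close> and \<open>\<omega>'\<close>.\<close>

lemma fast_coords_gt:
  fixes s d :: complex
  shows "norm s \<le> norm (d - \<i> * \<omega> * s) + norm (d - \<i> * \<omega>' * s)"
    "norm d \<le> 2 * (norm (d - \<i> * \<omega> * s) + norm (d - \<i> * \<omega>' * s))"
proof -
  let ?f = "d - \<i> * \<omega> * s" and ?g = "d - \<i> * \<omega>' * s"
  have "?f - ?g = - \<i> * ((\<omega> - \<omega>') * s)" by (simp add: algebra_simps)
  then have "norm (?f - ?g) = norm ((\<omega> - \<omega>') * s)" by (simp add: norm_mult)
  then show 1: "norm s \<le> norm ?f + norm ?g"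
    using recover_from_fast(1)[of s] norm_triangle_ineq4[of ?f ?g] by linarith
  have "d = ?f + \<i> * \<omega> * s" by simp
  then have "norm d \<le> norm ?f + norm s"
    by (metis norm_triangle_ineq norm_mult \<omega>_simps(3) norm_ii mult_1)
  then have "norm d \<le> norm ?f + (norm ?f + norm ?g)" using 1 by simp
  then show "norm d \<le> 2 * (norm ?f + norm ?g)" using norm_ge_zero[of ?g] by argo
qed

text \<open>The columns of \<open>M4\<close> are right eigenvectors of \<open>D0\<close>, so each left eigenvector sees just one component of \<open>V\<close>.
Each such component of the reference solution therefore solves the equation of its left eigencoordinate.\<close>

lemma M4_coords:
  "(M4 *v V) $ 3 = V $ 1"
  "diff12 (M4 *v V) - \<i> * \<omega> * sum12 (M4 *v V) = (\<i> * (2 * r3 - 3) - r3) * V $ 2"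
  "diff12 (M4 *v V) - \<i> * \<omega>' * sum12 (M4 *v V) = (r3 - \<i> * (2 * r3 + 3)) * V $ 3"
proof -
  have M: "(M4 *v V) $ 1 = \<i> * (r3 - 2) * V $ 2 - \<i> * (r3 + 2) * V $ 3" "(M4 *v V) $ 2 = V $ 2 + V $ 3"
    by (simp_all add: M4_def matrix_vector_mult_def sum_3 vector_3)
  show "(M4 *v V) $ 3 = V $ 1" by (simp add: M4_def matrix_vector_mult_def sum_3 vector_3)
  have c: "\<i> * (r3 - 2) - 1 - \<i> * \<omega> * (\<i> * (r3 - 2) + 1) = \<i> * (2 * r3 - 3) - r3"
     "- \<i> * (r3 + 2) - 1 - \<i> * \<omega> * (- \<i> * (r3 + 2) + 1) = 0"
     "\<i> * (r3 - 2) - 1 - \<i> * \<omega>' * (\<i> * (r3 - 2) + 1) = 0"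
     "- \<i> * (r3 + 2) - 1 - \<i> * \<omega>' * (- \<i> * (r3 + 2) + 1) = r3 - \<i> * (2 * r3 + 3)"
    by (simp_all add: \<omega>_def \<omega>'_def complex_eq_iff field_simps)
  have e: "diff12 (M4 *v V) - \<i> * z * sum12 (M4 *v V)
     = (\<i> * (r3 - 2) - 1 - \<i> * z * (\<i> * (r3 - 2) + 1)) * V $ 2
       + (- \<i> * (r3 + 2) - 1 - \<i> * z * (- \<i> * (r3 + 2) + 1)) * V $ 3" for z
    unfolding sum12_def diff12_def M by (simp add: algebra_simps)
  show "diff12 (M4 *v V) - \<i> * \<omega> * sum12 (M4 *v V) = (\<i> * (2 * r3 - 3) - r3) * V $ 2"
    unfolding e c by simp
  show "diff12 (M4 *v V) - \<i> * \<omega>' * sum12 (M4 *v V) = (r3 - \<i> * (2 * r3 + 3)) * V $ 3"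
    unfolding e c by simp
qed

lemma reference_gt_coords:
  fixes p q :: real
  defines "A \<equiv> - (q *\<^sub>R Db0 + p *\<^sub>R Db1)"
  shows "(A *v V) $ 1 = - of_real p * V $ 1" "(A *v V) $ 2 = of_real q * (\<omega> * V $ 2)"
    "(A *v V) $ 3 = of_real q * (\<omega>' * V $ 3)"
  by (simp_all add: A_def Db0_def Db1_def diag3_def matrix_vector_mult_def sum_3 vector_3 \<omega>_def \<omega>'_def
      scaleR_conv_of_real[where 'a = complex] algebra_simps)

text \<open>In eigencoordinates of \<open>D0\<close> the perturbation \<open>\<delta> D1\<close> sends \<open>c\<close> to \<open>-\<delta> c\<close>, and everything else is coupling of
size \<open>\<delta>\<close>. This is the normal form with \<open>\<eta> = \<delta>\<close> and \<open>K = 2\<close>. The bound on \<open>\<delta>\<close> is \<open>1 / (128 K\<^sup>2)\<close>.\<close>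

lemma frequency_error_gt:
  fixes W V :: "real \<Rightarrow> complex^3"
  assumes q: "0 < q" and \<delta>: "0 < \<delta>" "\<delta> \<le> 1/512"
    and cW: "continuous_on {0..} W" and cV: "continuous_on {0..} V"
    and dW: "\<And>t. t > 0 \<Longrightarrow> (W has_vector_derivative (q *\<^sub>R D0 + (q * \<delta>) *\<^sub>R D1) *v W t) (at t)"
    and dV: "\<And>t. t > 0 \<Longrightarrow> (V has_vector_derivative - (q *\<^sub>R Db0 + (q * \<delta>) *\<^sub>R Db1) *v V t) (at t)"
    and init: "M4 *v V 0 = W 0" and t: "0 \<le> t"
  shows "norm (W t - M4 *v V t) \<le> 29988 * \<delta> * exp (- (q * \<delta> / 2) * t) * norm (W 0)"
proof -
  define R where "R t = M4 *v V t" for t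
  let ?F = "\<lambda>\<omega> w. diff12 w - \<i> * \<omega> * sum12 w"
  note WW = vector_derivative_nth[OF dW] vector_derivative_coords[OF dW]
  have F: "((\<lambda>t. ?F z (W t)) has_vector_derivative of_real q * (z * ?F z (W t) + (- 2 * \<i> * z * of_real \<delta> * W t
      $ 3))) (at t)"
    if z: "z * z + z + 1 = 0" and t: "t > 0" for z t
  proof (rule has_vector_derivative_eq_rhs)
    show "((\<lambda>t. ?F z (W t)) has_vector_derivative
        (diff12 ((q *\<^sub>R D0 + (q * \<delta>) *\<^sub>R D1) *v W t) - \<i> * z * sum12 ((q *\<^sub>R D0 + (q * \<delta>) *\<^sub>R D1) *v W t))) (at t)"
      by (intro has_vector_derivative_diff has_vector_derivative_mult_right vector_derivative_coords dW t)
    show "diff12 ((q *\<^sub>R D0 + (q * \<delta>) *\<^sub>R D1) *v W t) - \<i> * z * sum12 ((q *\<^sub>R D0 + (q * \<delta>) *\<^sub>R D1) *v W t)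
       = of_real q * (z * ?F z (W t) + (- 2 * \<i> * z * of_real \<delta> * W t $ 3))"
      unfolding system_coords of_real_mult using z i_squared by algebra
  qed
  interpret slow_fast q \<delta> \<delta> 2 \<omega> \<omega>' "\<lambda>t. W t $ 3" "\<lambda>t. ?F \<omega> (W t)" "\<lambda>t. ?F \<omega>' (W t)"
      "\<lambda>t. - of_real \<delta> * sum12 (W t) / 2" "\<lambda>t. - 2 * \<i> * \<omega> * of_real \<delta> * W t $ 3"
      "\<lambda>t. - 2 * \<i> * \<omega>' * of_real \<delta> * W t $ 3"
  proof
    show "continuous_on {0..} (\<lambda>t. W t $ 3)" "continuous_on {0..} (\<lambda>t. ?F \<omega> (W t))"
      "continuous_on {0..} (\<lambda>t. ?F \<omega>' (W t))"
      by (intro continuous_intros continuous_on_coords cW)+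
    fix t :: real assume t: "t > 0"
    show "((\<lambda>t. W t $ 3) has_vector_derivative
        of_real q * (- of_real \<delta> * W t $ 3 + - of_real \<delta> * sum12 (W t) / 2)) (at t)"
      by (rule has_vector_derivative_eq_rhs[OF WW(1)[OF t]]) (simp only: system_coords, simp add: algebra_simps)
    show "((\<lambda>t. ?F \<omega> (W t)) has_vector_derivative of_real q * (\<omega> * ?F \<omega> (W t) + (- 2 * \<i> * \<omega> * of_real \<delta> * W t $
        3))) (at t)"
      by (rule F[OF \<omega>_char(1) t])
    show "((\<lambda>t. ?F \<omega>' (W t)) has_vector_derivative of_real q * (\<omega>' * ?F \<omega>' (W t) + (- 2 * \<i> * \<omega>' * of_real \<delta> * W
        t $ 3))) (at t)"
      by (rule F[OF \<omega>_char(2) t])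
    have "norm (- of_real \<delta> * sum12 (W t) / 2) = \<delta> * (norm (sum12 (W t)) / 2)"
      using \<delta> by (simp add: norm_mult norm_divide)
    also have "\<dots> \<le> \<delta> * (2 * (\<delta> * norm (W t $ 3) + (norm (?F \<omega> (W t)) + norm (?F \<omega>' (W t)))))"
    proof (intro mult_left_mono)
      show "norm (sum12 (W t)) / 2 \<le> 2 * (\<delta> * norm (W t $ 3) + (norm (?F \<omega> (W t)) + norm (?F \<omega>' (W t))))"
        using fast_coords_gt(1)[of "sum12 (W t)" "diff12 (W t)"] mult_nonneg_nonneg[of \<delta> "norm (W t $ 3)"]
          \<delta> norm_ge_zero[of "sum12 (W t)"] norm_ge_zero[of "W t $ 3"] by argo
    qed (use \<delta> in simp)
    finally show "norm (- of_real \<delta> * sum12 (W t) / 2)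
       \<le> 2 * \<delta> * (\<delta> * norm (W t $ 3) + (norm (?F \<omega> (W t)) + norm (?F \<omega>' (W t))))"
      by (simp only: mult.assoc mult.left_commute[of 2])
    show "norm (- 2 * \<i> * \<omega> * of_real \<delta> * W t $ 3)
        \<le> 2 * (\<delta> * (norm (?F \<omega> (W t)) + norm (?F \<omega>' (W t))) + \<delta> * norm (W t $ 3))"
      "norm (- 2 * \<i> * \<omega>' * of_real \<delta> * W t $ 3)
        \<le> 2 * (\<delta> * (norm (?F \<omega> (W t)) + norm (?F \<omega>' (W t))) + \<delta> * norm (W t $ 3))"
      using \<delta> by (simp_all add: norm_mult \<omega>_simps)
  qed (use q \<delta> in \<open>auto simp: \<omega>_simps\<close>)
  have cR: "continuous_on {0..} R" unfolding R_def
    by (rule bounded_linear.continuous_on[OF matrix_vector_mul_bounded_linear cV])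
  have R0: "R 0 = W 0" by (simp add: R_def init)
  note VV = vector_derivative_nth[OF dV]
  let ?b = "119 * 2\<^sup>2 * \<delta> * init_size * exp (- (q * \<delta> / 2) * t)"
  note FR = M4_coords[of "V _", folded R_def]
  note cR' = cR[THEN continuous_on_coords(1)] cR[THEN continuous_on_coords(2)]
  have 1: "((\<lambda>t. R t $ 3) has_vector_derivative of_real q * (- of_real \<delta> * R t $ 3)) (at t)" if "t > 0" for t
    unfolding FR by (rule has_vector_derivative_eq_rhs[OF VV[OF that]]) (simp only: reference_gt_coords, simp)
  have 2: "((\<lambda>t. ?F \<omega> (R t)) has_vector_derivative of_real q * ((\<omega> + 0) * ?F \<omega> (R t))) (at t)" if "t > 0" for t
    unfolding FR by (rule has_vector_derivative_eq_rhs[OF has_vector_derivative_mult_right[OF VV[OF that]]])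
      (simp only: reference_gt_coords, simp)
  have 3: "((\<lambda>t. ?F \<omega>' (R t)) has_vector_derivative of_real q * ((\<omega>' + 0) * ?F \<omega>' (R t))) (at t)" if "t > 0" for t
    unfolding FR by (rule has_vector_derivative_eq_rhs[OF has_vector_derivative_mult_right[OF VV[OF that]]])
      (simp only: reference_gt_coords, simp)
  have cmp: "norm (W t $ 3 - R t $ 3) \<le> ?b" "norm (?F \<omega> (W t) - ?F \<omega> (R t)) \<le> ?b"
    "norm (?F \<omega>' (W t) - ?F \<omega>' (R t)) \<le> ?b"
    by (rule comparison[where \<rho> = 0 and \<rho>' = 0, OF _ _ _ 1 2 3 _ _ _ _ _ t];
        use \<delta> init_size_nonneg in \<open>auto simp: R0 intro!: continuous_intros cR cR'\<close>)+
  let ?D = "W t - R t"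
  have FD: "?F z ?D = ?F z (W t) - ?F z (R t)" for z by (simp add: coords_diff algebra_simps)
  have "norm ?D \<le> norm (sum12 ?D) + norm (diff12 ?D) + norm (?D $ 3)" by (rule norm_le_coords)
  also have "\<dots> \<le> 7 * ?b"
    using fast_coords_gt[where s = "sum12 ?D" and d = "diff12 ?D"] cmp unfolding FD vector_minus_component by argo
  also have "init_size \<le> 9 * norm (W 0)"
  proof -
    have "norm (?F z w) \<le> 4 * norm w" if "norm z = 1" for z w
      using norm_triangle_ineq4[of "diff12 w" "\<i> * z * sum12 w"] norm_coords_le[of w] that
      by (simp add: norm_mult)
    from this[of \<omega> "W 0"] this[of \<omega>' "W 0"] show ?thesis
      using Finite_Cartesian_Product.norm_nth_le[of "W 0" 3] unfolding init_size_def by (simp add: \<omega>_simps)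
  qed
  finally show ?thesis
    using \<delta> unfolding R_def by (simp add: mult_left_mono algebra_simps)
qed

section \<open>Fixed frequencies, \<open>\<alpha> < 1/2\<close>\<close>

text \<open>The constant matrix in \<open>M2\<close>. The error estimate depends on it only through its norm.\<close>

definition N3 :: "complex^3^3" where
  "N3 = vector [vector [0, - ((r3 + \<i>) / (1 + r3 * \<i>)), (r3 - \<i>) / (1 - r3 * \<i>)],
             vector [- (2 * r3 / (3 * (1 + r3 * \<i>))), 0, (r3 - \<i>) / (6 * \<i>)],
             vector [2 * r3 / (3 * (1 - r3 * \<i>)), - ((r3 + \<i>) / (6 * \<i>)), 0]]"

lemma M2_eq: "M2 \<sigma> \<alpha> r = (r powr (\<sigma> - 2 * \<sigma> * \<alpha>)) *\<^sub>R N3"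
  by (simp add: M2_def N3_def)

lemma M1_coords:
  "diff12 (M1 *v V) = - 2 * V $ 1"
  "sum12 (M1 *v V) - 2 * \<omega> * (M1 *v V) $ 3 = 2 * (\<omega>' - \<omega>) * V $ 2"
  "sum12 (M1 *v V) - 2 * \<omega>' * (M1 *v V) $ 3 = 2 * (\<omega> - \<omega>') * V $ 3"
proof -
  have w: "(\<i> * r3 - 1) / 2 = \<omega>'" "(- \<i> * r3 - 1) / 2 = \<omega>"
    by (simp_all add: \<omega>_def \<omega>'_def complex_eq_iff field_simps)
  have M: "(M1 *v V) $ 1 = - V $ 1 + \<omega>' * V $ 2 + \<omega> * V $ 3" "(M1 *v V) $ 2 = V $ 1 + \<omega>' * V $ 2 + \<omega> * V $ 3"
    "(M1 *v V) $ 3 = V $ 2 + V $ 3"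
    unfolding M1_def w by (simp_all add: matrix_vector_mult_def sum_3 vector_3)
  show "diff12 (M1 *v V) = - 2 * V $ 1"
    "sum12 (M1 *v V) - 2 * \<omega> * (M1 *v V) $ 3 = 2 * (\<omega>' - \<omega>) * V $ 2"
    "sum12 (M1 *v V) - 2 * \<omega>' * (M1 *v V) $ 3 = 2 * (\<omega> - \<omega>') * V $ 3"
    unfolding sum12_def diff12_def M by (simp_all add: algebra_simps)
qed

text \<open>The reference system is diagonal, with \<open>\<omega>\<close>, \<open>\<omega>'\<close> shifted by terms of relative
size \<open>O(\<delta>)\<close> as long as \<open>e\<close> and \<open>x\<close> are at most \<open>p \<delta>\<close>.\<close>

lemma reference_lt_coords:
  fixes p e x :: real
  assumes p: "0 < p"
  defines "A \<equiv> - (p *\<^sub>R Dt0 + e *\<^sub>R Dt1 + x *\<^sub>R Dt2)"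
  shows "(A *v V) $ 1 = - of_real x * V $ 1"
    "(A *v V) $ 2 = of_real p * ((\<omega> + - (of_real (e / p) * (1/2 + r3 / 6 * \<i>) + of_real (x / p) * (-1/2 + r3 /
        18 * \<i>))) * V $ 2)"
    "(A *v V) $ 3 = of_real p * ((\<omega>' + - (of_real (e / p) * (1/2 - r3 / 6 * \<i>) + of_real (x / p) * (-1/2 - r3 /
        18 * \<i>))) * V $ 3)"
  using p by (simp_all add: A_def Dt0_def Dt1_def Dt2_def diag3_def matrix_vector_mult_def sum_3 vector_3 \<omega>_def \<omega>'_def
      scaleR_conv_of_real[where 'a = complex] field_simps)

lemma reference_lt_shift:
  fixes e x p \<delta> :: real
  assumes p: "0 < p" and e: "0 \<le> e" "e \<le> p * \<delta>" and x: "0 \<le> x" "x \<le> p * \<delta>"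
  shows "norm (- (of_real (e / p) * (1/2 + r3 / 6 * \<i>) + of_real (x / p) * (-1/2 + r3 / 18 * \<i>))) \<le> 4 * \<delta>"
    "norm (- (of_real (e / p) * (1/2 - r3 / 6 * \<i>) + of_real (x / p) * (-1/2 - r3 / 18 * \<i>))) \<le> 4 * \<delta>"
proof -
  have ep: "0 \<le> e / p" "e / p \<le> \<delta>" and xp: "0 \<le> x / p" "x / p \<le> \<delta>"
    using p e x by (simp_all add: field_simps)
  have n: "norm (1/2 + r3 / 6 * \<i>) \<le> 2" "norm (1/2 - r3 / 6 * \<i>) \<le> 2"
      "norm (-1/2 + r3 / 18 * \<i>) \<le> 2" "norm (-1/2 - r3 / 18 * \<i>) \<le> 2"
    by (simp_all add: cmod_def power_divide real_le_lsqrt)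
  have *: "norm (- (of_real (e / p) * a + of_real (x / p) * b)) \<le> 4 * \<delta>" if "norm a \<le> 2" "norm b \<le> 2" for a b :: complex
  proof -
    have "norm (of_real (e / p) * a) = e / p * norm a" "norm (of_real (x / p) * b) = x / p * norm b"
      using ep xp by (simp_all only: norm_mult norm_of_real abs_of_nonneg)
    moreover have "e / p * norm a \<le> \<delta> * 2" "x / p * norm b \<le> \<delta> * 2"
      by (rule mult_mono; use ep xp that in simp)+
    ultimately show ?thesis
      using norm_triangle_ineq[of "of_real (e / p) * a" "of_real (x / p) * b"] unfolding norm_minus_cancel by linarith
  qed
  show "norm (- (of_real (e / p) * (1/2 + r3 / 6 * \<i>) + of_real (x / p) * (-1/2 + r3 / 18 * \<i>))) \<le> 4 * \<delta>"
    "norm (- (of_real (e / p) * (1/2 - r3 / 6 * \<i>) + of_real (x / p) * (-1/2 - r3 / 18 * \<i>))) \<le> 4 * \<delta>"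
    by (rule *; rule n)+
qed

text \<open>Left eigenvectors of \<open>D1\<close>, corrected at order \<open>\<delta>\<close>. The fast pair \<open>(s, c)\<close> relaxes to the slow manifold
\<open>s = \<i> \<delta> d\<close>, \<open>c = -\<i> \<delta> d / 2\<close>, and \<open>fast_lt\<close> measures the deviation from it in the eigencoordinates of \<open>D1\<close>.
The correction in \<open>slow_lt\<close> removes from \<open>d' = \<i> \<delta> s\<close> the coupling of size \<open>\<delta>\<close> to the fast
variables and leaves one of size \<open>\<delta>\<^sup>2\<close>.\<close>

definition slow_lt :: "real \<Rightarrow> complex^3 \<Rightarrow> complex" where
  "slow_lt \<delta> w = diff12 w + \<i> * of_real \<delta> * (sum12 w + 2 * w $ 3)"
definition fast_lt :: "real \<Rightarrow> complex \<Rightarrow> complex^3 \<Rightarrow> complex" where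
  "fast_lt \<delta> z w = sum12 w - 2 * z * w $ 3 - \<i> * of_real \<delta> * (1 + z) * diff12 w"

text \<open>Here \<open>S - 2 \<omega> C\<close> and \<open>S - 2 \<omega>' C\<close> are the fast left eigenvectors of \<open>D1\<close>.\<close>

lemma fast_pair_bound:
  fixes S C :: complex
  shows "2 * norm C \<le> norm (S - 2 * \<omega> * C) + norm (S - 2 * \<omega>' * C)"
    "norm S \<le> 2 * (norm (S - 2 * \<omega> * C) + norm (S - 2 * \<omega>' * C))"
proof -
  let ?f = "S - 2 * \<omega> * C" and ?g = "S - 2 * \<omega>' * C"
  show 1: "2 * norm C \<le> norm ?f + norm ?g"
    using recover_from_fast(1)[of C] recover_from_fast(2)[of S C] norm_triangle_ineq4[of ?f ?g] by linarith
  have "S = ?f + 2 * \<omega> * C" by simp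
  then have "norm S \<le> norm ?f + norm (2 * \<omega> * C)" by (metis norm_triangle_ineq)
  also have "norm (2 * \<omega> * C) = 2 * norm C" by (simp add: norm_mult \<omega>_simps)
  finally show "norm S \<le> 2 * (norm ?f + norm ?g)" using 1 norm_ge_zero[of ?g] by argo
qed

text \<open>With \<open>S\<close> and \<open>C\<close> the deviations of \<open>s\<close> and \<open>c\<close> from the slow manifold, \<open>fast_lt \<delta> z w = S - 2 z C\<close>, so
the coordinate change is inverted as for \<open>\<delta> = 0\<close>, and the corrections are absorbed by \<open>\<delta> \<le> 1\<close>.\<close>

lemma coords_bound_lt:
  fixes w :: "complex^3"
  assumes \<delta>: "0 \<le> \<delta>" "\<delta> \<le> 1"
  defines "F \<equiv> norm (fast_lt \<delta> \<omega> w) + norm (fast_lt \<delta> \<omega>' w)"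
  shows "norm (sum12 w + 2 * w $ 3) \<le> 3 * F"
    and "norm (sum12 w) \<le> 5 * F + \<delta> * norm (slow_lt \<delta> w)"
    and "norm w \<le> 13 * (norm (slow_lt \<delta> w) + F)"
proof -
  define S where "S = sum12 w - \<i> * of_real \<delta> * diff12 w"
  define C where "C = w $ 3 + \<i> * of_real \<delta> * diff12 w / 2"
  have f: "fast_lt \<delta> z w = S - 2 * z * C" for z
    by (simp add: fast_lt_def S_def C_def algebra_simps)
  have C: "2 * norm C \<le> F" and S: "norm S \<le> 2 * F"
    using fast_pair_bound[where S = S and C = C] unfolding F_def f by auto
  have F: "0 \<le> F" by (simp add: F_def)
  have SC: "sum12 w + 2 * w $ 3 = S + 2 * C" by (simp add: S_def C_def)
  have "norm (2 * C) = 2 * norm C" by (simp add: norm_mult)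
  then show 1: "norm (sum12 w + 2 * w $ 3) \<le> 3 * F"
    using norm_triangle_ineq[of S "2 * C"] C S unfolding SC by linarith
  have "diff12 w = slow_lt \<delta> w - \<i> * of_real \<delta> * (sum12 w + 2 * w $ 3)" by (simp add: slow_lt_def)
  then have "norm (diff12 w) \<le> norm (slow_lt \<delta> w) + norm (\<i> * of_real \<delta> * (sum12 w + 2 * w $ 3))"
    by (metis norm_triangle_ineq4)
  also have "norm (\<i> * of_real \<delta> * (sum12 w + 2 * w $ 3)) = \<delta> * norm (sum12 w + 2 * w $ 3)"
    using \<delta> by (simp add: norm_mult)
  also have "\<dots> \<le> 1 * (3 * F)" using \<delta> 1 by (intro mult_mono) auto
  finally have d: "norm (diff12 w) \<le> norm (slow_lt \<delta> w) + 3 * F" by simp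
  have \<delta>d: "\<delta> * norm (diff12 w) \<le> \<delta> * norm (slow_lt \<delta> w) + 3 * F"
    using mult_left_mono[OF d \<delta>(1)] mult_right_mono[OF \<delta>(2) F] by (simp add: algebra_simps)
  have "sum12 w = S + \<i> * of_real \<delta> * diff12 w" by (simp add: S_def)
  then have "norm (sum12 w) \<le> norm S + norm (\<i> * of_real \<delta> * diff12 w)" by (metis norm_triangle_ineq)
  also have nd: "norm (\<i> * of_real \<delta> * diff12 w) = \<delta> * norm (diff12 w)" using \<delta> by (simp add: norm_mult)
  finally show s: "norm (sum12 w) \<le> 5 * F + \<delta> * norm (slow_lt \<delta> w)" using S \<delta>d by linarith
  have "w $ 3 = C - \<i> * of_real \<delta> * diff12 w / 2" by (simp add: C_def)
  then have "norm (w $ 3) \<le> norm C + norm (\<i> * of_real \<delta> * diff12 w / 2)" by (metis norm_triangle_ineq4)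
  then have c: "norm (w $ 3) \<le> norm C + \<delta> * norm (diff12 w) / 2" using nd by (simp add: norm_divide)
  have "\<delta> * norm (slow_lt \<delta> w) \<le> 1 * norm (slow_lt \<delta> w)" using \<delta> by (intro mult_right_mono) auto
  moreover have "0 \<le> norm (slow_lt \<delta> w)" by simp
  ultimately have "norm (sum12 w) + norm (diff12 w) + norm (w $ 3) \<le> 13 * (norm (slow_lt \<delta> w) + F)"
    using s d c \<delta>d C F unfolding distrib_left mult_1 by argo
  then show "norm w \<le> 13 * (norm (slow_lt \<delta> w) + F)" using norm_le_coords[of w] by linarith
qed

lemma norm_fast_corr:
  assumes "norm z = 1" "0 \<le> \<delta>"
  shows "norm (\<i> * of_real \<delta> * (1 + z) * diff12 w) \<le> 4 * \<delta> * norm w"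
proof -
  have "norm (\<i> * of_real \<delta> * (1 + z) * diff12 w) = \<delta> * (norm (1 + z) * norm (diff12 w))"
    using assms by (simp add: norm_mult mult.assoc)
  also have "\<dots> \<le> \<delta> * (2 * (2 * norm w))"
    using norm_triangle_ineq[of 1 z] norm_coords_le[of w] assms by (intro mult_left_mono mult_mono) auto
  finally show ?thesis by simp
qed

lemma norm_slow_corr:
  assumes "0 \<le> \<delta>"
  shows "norm (\<i> * of_real \<delta> * (sum12 w + 2 * w $ 3)) \<le> 4 * \<delta> * norm w"
proof -
  have "norm (\<i> * of_real \<delta> * (sum12 w + 2 * w $ 3)) = \<delta> * norm (sum12 w + 2 * w $ 3)"
    using assms by (simp add: norm_mult)
  also have "\<dots> \<le> \<delta> * (2 * norm w + 2 * norm w)"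
    using norm_triangle_ineq[of "sum12 w" "2 * w $ 3"] norm_coords_le[of w]
      Finite_Cartesian_Product.norm_nth_le[of w 3] assms by (intro mult_left_mono) (auto simp: norm_mult)
  finally show ?thesis by simp
qed

lemma norm_fast_pair:
  assumes "norm z = 1"
  shows "norm (sum12 w - 2 * z * w $ 3) \<le> 4 * norm w"
  using norm_triangle_ineq4[of "sum12 w" "2 * z * w $ 3"] norm_coords_le[of w]
      Finite_Cartesian_Product.norm_nth_le[of w 3] assms by (simp add: norm_mult)

text \<open>On the slow manifold \<open>d' = \<i> \<delta> s\<close> becomes \<open>d' = -\<delta>\<^sup>2 d\<close>, which is the first diagonal entry of the reference
system; the corrected coordinates satisfy the normal form with \<open>\<eta> = \<delta>\<^sup>2\<close>. They are compared with the uncorrected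
coordinates of \<open>M1 V\<close>, that is, the corrections and \<open>M2\<close> all go into the error \<open>O(\<delta>)\<close>. The same happens
at \<open>t = 0\<close>: the initial data of \<open>V\<close> contain \<open>(I + M2)\<^sup>-\<^sup>1\<close>, so \<open>M1 V\<close> starts within \<open>O(\<delta>)\<close> of \<open>W\<close>.
The constant \<open>K\<close> depends on the norms of the matrices only.\<close>

lemma frequency_error_lt:
  fixes W V :: "real \<Rightarrow> complex^3" and k p \<delta> e :: real
  defines "K \<equiv> 200 * k ^ 3"
  assumes k: "1 \<le> k" "\<And>v. norm (N3 *v v) \<le> k * norm v" "\<And>v. norm (M1 *v v) \<le> k * norm v"
      "\<And>v. norm (matrix_inv M1 *v v) \<le> k * norm v"
    and p: "0 < p" and \<delta>: "0 < \<delta>" and small: "128 * K\<^sup>2 * \<delta> \<le> 1" and e: "0 \<le> e" "e \<le> p * \<delta>"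
    and cW: "continuous_on {0..} W" and cV: "continuous_on {0..} V"
    and dW: "\<And>t. t > 0 \<Longrightarrow> (W has_vector_derivative ((p * \<delta>) *\<^sub>R D0 + p *\<^sub>R D1) *v W t) (at t)"
    and dV: "\<And>t. t > 0 \<Longrightarrow> (V has_vector_derivative
        - (p *\<^sub>R Dt0 + e *\<^sub>R Dt1 + (p * \<delta>\<^sup>2) *\<^sub>R Dt2) *v V t) (at t)"
    and init: "M1 *v ((mat 1 + \<delta> *\<^sub>R N3) *v V 0) = W 0" and t: "0 \<le> t"
  shows "norm (W t - M1 *v ((mat 1 + \<delta> *\<^sub>R N3) *v V t)) \<le> 55000 * K\<^sup>2 * \<delta> * exp (- (p * \<delta>\<^sup>2 / 2) * t) * norm (W 0)"
proof -
  have k3: "1 \<le> k ^ 3" using k(1) by simp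
  have K200: "200 \<le> K" using k3 by (simp add: K_def)
  have "200 * K \<le> K\<^sup>2" using K200 by (simp add: power2_eq_square)
  then have K2: "40000 \<le> K\<^sup>2" using K200 by linarith
  have \<delta>s: "\<delta> \<le> 1" using mult_right_mono[OF K2, of \<delta>] small \<delta> by linarith
  have \<delta>\<delta>: "\<delta>\<^sup>2 \<le> \<delta>" using \<delta> \<delta>s by (simp add: power2_eq_square)
  have k3\<delta>0: "0 \<le> k ^ 3 * \<delta>" using k(1) \<delta> by simp
  have k3\<delta>: "k ^ 3 * \<delta> \<le> 1/2"
  proof -
    have "K * \<delta> \<le> K\<^sup>2 * \<delta>" using K200 \<delta> by (intro mult_right_mono) (auto simp: power2_eq_square)
    also have "\<dots> \<le> 1" using small \<delta> by (simp add: mult.assoc)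
    finally have "200 * (k^3 * \<delta>) \<le> 1" by (simp add: K_def mult.assoc)
    then show ?thesis by simp
  qed
  let ?A = "(p * \<delta>) *\<^sub>R D0 + p *\<^sub>R D1"
  have dslow: "((\<lambda>t. slow_lt \<delta> (W t)) has_vector_derivative of_real p * (- of_real (\<delta>\<^sup>2) * slow_lt \<delta> (W t)
      + \<i> * of_real (\<delta>\<^sup>2) * (of_real \<delta> * (sum12 (W t) + 2 * W t $ 3) - sum12 (W t)))) (at t)" if t: "t > 0" for t
  proof (rule has_vector_derivative_eq_rhs)
    show "((\<lambda>t. slow_lt \<delta> (W t)) has_vector_derivative slow_lt \<delta> (?A *v W t)) (at t)"
      unfolding slow_lt_def
      by (intro has_vector_derivative_add has_vector_derivative_mult_right vector_derivative_coords
          vector_derivative_nth dW t)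
    show "slow_lt \<delta> (?A *v W t) = of_real p * (- of_real (\<delta>\<^sup>2) * slow_lt \<delta> (W t)
      + \<i> * of_real (\<delta>\<^sup>2) * (of_real \<delta> * (sum12 (W t) + 2 * W t $ 3) - sum12 (W t)))"
      unfolding slow_lt_def system_coords of_real_mult of_real_power by (simp add: power2_eq_square algebra_simps)
  qed
  have dfast: "((\<lambda>t. fast_lt \<delta> z (W t)) has_vector_derivative of_real p * (z * fast_lt \<delta> z (W t)
      + of_real \<delta> * (of_real \<delta> * (1 + z) - 1) * sum12 (W t))) (at t)"
    if z: "z * z + z + 1 = 0" and t: "t > 0" for z t
  proof (rule has_vector_derivative_eq_rhs)
    show "((\<lambda>t. fast_lt \<delta> z (W t)) has_vector_derivative fast_lt \<delta> z (?A *v W t)) (at t)"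
      unfolding fast_lt_def
      by (intro has_vector_derivative_diff has_vector_derivative_mult_right vector_derivative_coords
          vector_derivative_nth dW t)
    \<comment> \<open>The remainder contains the characteristic polynomial of \<open>D1\<close> on the fast pair, evaluated at \<open>z\<close>.\<close>
    have "fast_lt \<delta> z (?A *v W t) - of_real p * (z * fast_lt \<delta> z (W t)
      + of_real \<delta> * (of_real \<delta> * (1 + z) - 1) * sum12 (W t))
      = of_real p * (z * z + z + 1) * (2 * W t $ 3 + \<i> * of_real \<delta> * diff12 (W t))"
      unfolding fast_lt_def system_coords of_real_mult by (simp add: algebra_simps)
    then show "fast_lt \<delta> z (?A *v W t) = of_real p * (z * fast_lt \<delta> z (W t)
      + of_real \<delta> * (of_real \<delta> * (1 + z) - 1) * sum12 (W t))" unfolding z by simp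
  qed
  let ?F = "\<lambda>t. norm (fast_lt \<delta> \<omega> (W t)) + norm (fast_lt \<delta> \<omega>' (W t))"
  have hslow: "norm (\<i> * of_real (\<delta>\<^sup>2) * (of_real \<delta> * (sum12 (W t) + 2 * W t $ 3) - sum12 (W t)))
      \<le> K * \<delta>\<^sup>2 * (\<delta> * norm (slow_lt \<delta> (W t)) + ?F t)" for t
  proof -
    have "norm (of_real \<delta> * (sum12 (W t) + 2 * W t $ 3)) = \<delta> * norm (sum12 (W t) + 2 * W t $ 3)"
      using \<delta> by (simp add: norm_mult)
    also have "\<dots> \<le> 1 * (3 * ?F t)" using \<delta> \<delta>s coords_bound_lt(1)[of \<delta> "W t"] by (intro mult_mono) auto
    finally have "norm (of_real \<delta> * (sum12 (W t) + 2 * W t $ 3) - sum12 (W t))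
        \<le> 8 * (\<delta> * norm (slow_lt \<delta> (W t)) + ?F t)"
      using norm_triangle_ineq4[of "of_real \<delta> * (sum12 (W t) + 2 * W t $ 3)" "sum12 (W t)"]
        coords_bound_lt(2)[OF less_imp_le[OF \<delta>] \<delta>s, of "W t"]
        mult_nonneg_nonneg[OF less_imp_le[OF \<delta>] norm_ge_zero[of "slow_lt \<delta> (W t)"]] by argo
    also have "\<dots> \<le> K * (\<delta> * norm (slow_lt \<delta> (W t)) + ?F t)" using K200 \<delta> by (intro mult_right_mono) auto
    finally have "\<delta>\<^sup>2 * norm (of_real \<delta> * (sum12 (W t) + 2 * W t $ 3) - sum12 (W t))
       \<le> \<delta>\<^sup>2 * (K * (\<delta> * norm (slow_lt \<delta> (W t)) + ?F t))" by (intro mult_left_mono) auto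
    moreover have "norm (\<i> * of_real (\<delta>\<^sup>2) * (of_real \<delta> * (sum12 (W t) + 2 * W t $ 3) - sum12 (W t)))
      = \<delta>\<^sup>2 * norm (of_real \<delta> * (sum12 (W t) + 2 * W t $ 3) - sum12 (W t))"
      by (simp only: norm_mult norm_ii norm_of_real mult_1) simp
    ultimately show ?thesis by (simp only: mult.assoc mult.left_commute[of K])
  qed
  have hfast: "norm (of_real \<delta> * (of_real \<delta> * (1 + z) - 1) * sum12 (W t))
      \<le> K * (\<delta> * ?F t + \<delta>\<^sup>2 * norm (slow_lt \<delta> (W t)))" if z: "norm z = 1" for z t
  proof -
    have "norm (of_real \<delta> * (1 + z)) \<le> 1 * (1 + 1)"
      unfolding norm_mult using \<delta> \<delta>s norm_triangle_ineq[of 1 z] z by (intro mult_mono) auto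
    then have "norm (of_real \<delta> * (1 + z) - 1) \<le> 3"
      using norm_triangle_ineq4[of "of_real \<delta> * (1 + z)" 1] by simp
    then have "norm (of_real \<delta> * (1 + z) - 1) * norm (sum12 (W t)) \<le> 3 * (5 * ?F t + \<delta> * norm (slow_lt \<delta> (W t)))"
      using coords_bound_lt(2)[of \<delta> "W t"] \<delta> \<delta>s by (intro mult_mono) auto
    also have "\<dots> \<le> 15 * (?F t + \<delta> * norm (slow_lt \<delta> (W t)))" using \<delta> by simp
    also have "\<dots> \<le> K * (?F t + \<delta> * norm (slow_lt \<delta> (W t)))" using K200 \<delta> by (intro mult_right_mono) auto
    finally have "\<delta> * (norm (of_real \<delta> * (1 + z) - 1) * norm (sum12 (W t)))
      \<le> \<delta> * (K * (?F t + \<delta> * norm (slow_lt \<delta> (W t))))" using \<delta> by (intro mult_left_mono) auto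
    moreover have "norm (of_real \<delta> * (of_real \<delta> * (1 + z) - 1) * sum12 (W t))
      = \<delta> * (norm (of_real \<delta> * (1 + z) - 1) * norm (sum12 (W t)))"
      using \<delta> by (simp only: norm_mult norm_of_real mult.assoc abs_of_pos)
    moreover have "\<delta> * (K * (?F t + \<delta> * norm (slow_lt \<delta> (W t)))) = K * (\<delta> * ?F t + \<delta>\<^sup>2 * norm (slow_lt \<delta> (W t)))"
      by (simp add: power2_eq_square algebra_simps)
    ultimately show ?thesis by argo
  qed
  interpret slow_fast p "\<delta>\<^sup>2" \<delta> K \<omega> \<omega>' "\<lambda>t. slow_lt \<delta> (W t)" "\<lambda>t. fast_lt \<delta> \<omega> (W t)" "\<lambda>t. fast_lt \<delta> \<omega>' (W t)"
      "\<lambda>t. \<i> * of_real (\<delta>\<^sup>2) * (of_real \<delta> * (sum12 (W t) + 2 * W t $ 3) - sum12 (W t))"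
      "\<lambda>t. of_real \<delta> * (of_real \<delta> * (1 + \<omega>) - 1) * sum12 (W t)"
      "\<lambda>t. of_real \<delta> * (of_real \<delta> * (1 + \<omega>') - 1) * sum12 (W t)"
  proof
    show "continuous_on {0..} (\<lambda>t. slow_lt \<delta> (W t))" "continuous_on {0..} (\<lambda>t. fast_lt \<delta> \<omega> (W t))"
      "continuous_on {0..} (\<lambda>t. fast_lt \<delta> \<omega>' (W t))"
      unfolding slow_lt_def fast_lt_def by (intro continuous_intros continuous_on_coords cW)+
  qed (use p \<delta> K200 small \<delta>\<delta> in \<open>auto simp only: \<omega>_simps intro!: dslow dfast hslow hfast \<omega>_char, auto\<close>)
  define R where "R t = M1 *v V t" for t
  note VV = vector_derivative_nth[OF dV]
  note FR = M1_coords[of "V _", folded R_def]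
  have cR: "continuous_on {0..} R" unfolding R_def
    by (rule bounded_linear.continuous_on[OF matrix_vector_mul_bounded_linear cV])
  note cR' = cR[THEN continuous_on_coords(1)] cR[THEN continuous_on_coords(2)]
  \<comment> \<open>The part of the profile that stems from \<open>M2\<close> is split off; \<open>corr\<close> shows that it has relative size \<open>\<delta>\<close>.\<close>
  have prof: "M1 *v ((mat 1 + \<delta> *\<^sub>R N3) *v V t) = R t + \<delta> *\<^sub>R (M1 *v (N3 *v V t))" for t
  proof -
    have "(\<delta> *\<^sub>R N3) *v V t = \<delta> *\<^sub>R (N3 *v V t)"
      by (simp add: vec_eq_iff matrix_vector_mult_def scaleR_sum_right)
    then show ?thesis
      by (simp add: R_def matrix_vector_mult_add_rdistrib matrix_vector_right_distrib
        linear_scale[OF bounded_linear.linear[OF matrix_vector_mul_bounded_linear]])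
  qed
  have corr: "norm (\<delta> *\<^sub>R (M1 *v (N3 *v V t))) \<le> k ^ 3 * \<delta> * norm (R t)" for t
  proof -
    have "matrix_inv M1 ** M1 = mat 1"
      using M1_invertible someI_ex[of "\<lambda>A'. M1 ** A' = mat 1 \<and> A' ** M1 = mat 1"]
      unfolding invertible_def matrix_inv_def by blast
    then have "V t = matrix_inv M1 *v R t" by (simp add: R_def matrix_vector_mul_assoc)
    then have "norm (V t) \<le> k * norm (R t)" using k(4) by simp
    have "norm (M1 *v (N3 *v V t)) \<le> k * (k * (k * norm (R t)))"
      by (rule order_trans[OF k(3)] mult_left_mono order_trans[OF k(2)] \<open>norm (V t) \<le> k * norm (R t)\<close>)+
        (use k(1) in auto)
    then show ?thesis using mult_left_mono[of _ _ \<delta>] \<delta> by (simp add: power3_eq_cube mult_ac)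
  qed
  have WR0: "norm (W 0 - R 0) \<le> 2 * k ^ 3 * \<delta> * norm (W 0)"
  proof -
    have W0: "W 0 = R 0 + \<delta> *\<^sub>R (M1 *v (N3 *v V 0))" using init prof[of 0] by simp
    have "norm (R 0) \<le> norm (W 0) + norm (\<delta> *\<^sub>R (M1 *v (N3 *v V 0)))"
      using norm_triangle_ineq4[of "W 0" "\<delta> *\<^sub>R (M1 *v (N3 *v V 0))"] by (simp add: W0)
    also have "\<dots> \<le> norm (W 0) + 1/2 * norm (R 0)"
      using corr[of 0] mult_right_mono[OF k3\<delta>, of "norm (R 0)"] by simp
    finally have "norm (R 0) \<le> 2 * norm (W 0)" by simp
    then have "k ^ 3 * \<delta> * norm (R 0) \<le> k ^ 3 * \<delta> * (2 * norm (W 0))" using k3\<delta>0 by (intro mult_left_mono) auto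
    then show ?thesis using corr[of 0] W0 by simp
  qed
  have W0S: "norm (W 0) \<le> 13 * init_size"
    using coords_bound_lt(3)[of \<delta> "W 0"] \<delta> \<delta>s unfolding init_size_def by (simp add: add.assoc)
  \<comment> \<open>All initial deviations from the reference: the one of \<open>M1 V\<close> from \<open>W\<close>, and the corrections in the coordinates.\<close>
  have initb: "4 * norm (W 0 - R 0) + 4 * \<delta> * norm (W 0) \<le> K * \<delta> * init_size"
  proof -
    have "4 * norm (W 0 - R 0) + 4 * \<delta> * norm (W 0) \<le> (8 * k ^ 3 + 4) * (\<delta> * norm (W 0))"
      using WR0 by (simp add: algebra_simps)
    also have "\<dots> \<le> (12 * k ^ 3) * (\<delta> * (13 * init_size))"
      using W0S k(1) k3 \<delta> by (intro mult_mono mult_left_mono) auto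
    also have "\<dots> \<le> K * \<delta> * init_size" using k(1) \<delta> init_size_nonneg by (simp add: K_def)
    finally show ?thesis .
  qed
  have slowD: "slow_lt \<delta> w - diff12 r = diff12 (w - r) + \<i> * of_real \<delta> * (sum12 w + 2 * w $ 3)" for w r
    by (simp add: slow_lt_def coords_diff)
  have fastD: "fast_lt \<delta> z w - (sum12 r - 2 * z * r $ 3)
      = (sum12 (w - r) - 2 * z * (w - r) $ 3) - \<i> * of_real \<delta> * (1 + z) * diff12 w" for w r z
    by (simp add: fast_lt_def coords_diff algebra_simps)
  let ?e = "exp (- (p * \<delta>\<^sup>2 / 2) * t)"
  let ?B = "119 * K\<^sup>2 * \<delta> * init_size * ?e"
  have e1: "((\<lambda>t. diff12 (R t)) has_vector_derivative of_real p * (- of_real (\<delta>\<^sup>2) * diff12 (R t))) (at t)"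
      if "t > 0" for t
    unfolding FR by (rule has_vector_derivative_eq_rhs[OF has_vector_derivative_mult_right[OF VV[OF that]]])
      (simp only: reference_lt_coords[OF p], simp)
  define \<rho> where "\<rho> = - (of_real (e / p) * (1/2 + r3 / 6 * \<i>) + of_real (p * \<delta>\<^sup>2 / p) * (-1/2 + r3 / 18 * \<i>))"
  define \<rho>' where "\<rho>' = - (of_real (e / p) * (1/2 - r3 / 6 * \<i>) + of_real (p * \<delta>\<^sup>2 / p) * (-1/2 - r3 / 18 * \<i>))"
  have e2: "((\<lambda>t. sum12 (R t) - 2 * \<omega> * R t $ 3) has_vector_derivative of_real p * ((\<omega> + \<rho>) * (sum12 (R t) - 2 *
      \<omega> * R t $ 3))) (at t)" if "t > 0" for t
    unfolding FR by (rule has_vector_derivative_eq_rhs[OF has_vector_derivative_mult_right[OF VV[OF that]]])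
      (simp only: reference_lt_coords[OF p] \<rho>_def[symmetric], simp)
  have e3: "((\<lambda>t. sum12 (R t) - 2 * \<omega>' * R t $ 3) has_vector_derivative of_real p * ((\<omega>' + \<rho>') * (sum12 (R t) -
      2 * \<omega>' * R t $ 3))) (at t)" if "t > 0" for t
    unfolding FR by (rule has_vector_derivative_eq_rhs[OF has_vector_derivative_mult_right[OF VV[OF that]]])
      (simp only: reference_lt_coords[OF p] \<rho>'_def[symmetric], simp)
  have \<rho>: "norm \<rho> \<le> K * \<delta>" "norm \<rho>' \<le> K * \<delta>"
  proof -
    have "4 * \<delta> \<le> K * \<delta>" using K200 \<delta> by (intro mult_right_mono) auto
    moreover have "0 \<le> p * \<delta>\<^sup>2" "p * \<delta>\<^sup>2 \<le> p * \<delta>" using p \<delta>\<delta> by simp_all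
    note reference_lt_shift[OF p e this, folded \<rho>_def \<rho>'_def]
    ultimately show "norm \<rho> \<le> K * \<delta>" "norm \<rho>' \<le> K * \<delta>" by linarith+
  qed
  have i1: "norm (slow_lt \<delta> (W 0) - diff12 (R 0)) \<le> K * \<delta> * init_size"
    unfolding slowD using initb norm_triangle_ineq[of "diff12 (W 0 - R 0)" "\<i> * of_real \<delta> * (sum12 (W 0) + 2 * W
        0 $ 3)"]
      norm_slow_corr[of \<delta> "W 0"] norm_coords_le(2)[of "W 0 - R 0"] \<delta> norm_ge_zero[of "W 0 - R 0"] by argo
  have i2: "norm (fast_lt \<delta> z (W 0) - (sum12 (R 0) - 2 * z * R 0 $ 3)) \<le> K * \<delta> * init_size" if "norm z = 1" for z
    unfolding fastD using initb norm_triangle_ineq4[of "sum12 (W 0 - R 0) - 2 * z * (W 0 - R 0) $ 3" "\<i> *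
        of_real \<delta> * (1 + z) * diff12 (W 0)"]
      norm_fast_corr[of z \<delta> "W 0"] norm_fast_pair[of z "W 0 - R 0"] \<delta> that by argo
  have cmp: "norm (slow_lt \<delta> (W t) - diff12 (R t)) \<le> ?B"
    "norm (fast_lt \<delta> \<omega> (W t) - (sum12 (R t) - 2 * \<omega> * R t $ 3)) \<le> ?B"
    "norm (fast_lt \<delta> \<omega>' (W t) - (sum12 (R t) - 2 * \<omega>' * R t $ 3)) \<le> ?B"
    by (rule comparison[OF _ _ _ e1 e2 e3 \<rho> i1 i2 i2 t];
        auto simp: \<omega>_simps intro!: continuous_intros cR cR')+
  have Wt: "norm (W t) \<le> 39 * ?e * init_size"
    using coords_bound_lt(3)[of \<delta> "W t"] energy_decay[OF t] \<delta> \<delta>s by simp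
  have small_corr: "4 * \<delta> * norm (W t) \<le> ?B"
  proof -
    have "4 * \<delta> * norm (W t) \<le> 4 * \<delta> * (39 * ?e * init_size)" using Wt \<delta> by (intro mult_left_mono) auto
    also have "\<dots> = 156 * (\<delta> * ?e * init_size)" by simp
    also have "\<dots> \<le> (119 * K\<^sup>2) * (\<delta> * ?e * init_size)" using K2 \<delta> init_size_nonneg by (intro mult_right_mono) auto
    finally show ?thesis by (simp add: mult_ac)
  qed
  let ?D = "W t - R t"
  have D1: "norm (diff12 ?D) \<le> 2 * ?B"
  proof -
    have "diff12 ?D = (slow_lt \<delta> (W t) - diff12 (R t)) - \<i> * of_real \<delta> * (sum12 (W t) + 2 * W t $ 3)"
      unfolding slowD by simp
    then have "norm (diff12 ?D) \<le> norm (slow_lt \<delta> (W t) - diff12 (R t)) + norm (\<i> * of_real \<delta> * (sum12 (W t) + 2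
        * W t $ 3))"
      by (metis norm_triangle_ineq4)
    then show ?thesis using cmp(1) norm_slow_corr[of \<delta> "W t"] \<delta> small_corr by argo
  qed
  have D2: "norm (sum12 ?D - 2 * z * ?D $ 3) \<le> 2 * ?B"
    if z: "norm z = 1" and b: "norm (fast_lt \<delta> z (W t) - (sum12 (R t) - 2 * z * R t $ 3)) \<le> ?B" for z
  proof -
    have "sum12 ?D - 2 * z * ?D $ 3 = (fast_lt \<delta> z (W t) - (sum12 (R t) - 2 * z * R t $ 3)) + \<i> * of_real \<delta> * (1
        + z) * diff12 (W t)"
      unfolding fastD by simp
    then have "norm (sum12 ?D - 2 * z * ?D $ 3) \<le> norm (fast_lt \<delta> z (W t) - (sum12 (R t) - 2 * z * R t $ 3)) +
        norm (\<i> * of_real \<delta> * (1 + z) * diff12 (W t))"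
      by (metis norm_triangle_ineq)
    then show ?thesis using b norm_fast_corr[OF z, of \<delta> "W t"] \<delta> small_corr by argo
  qed
  have D: "norm ?D \<le> 12 * ?B"
    using norm_le_coords[of ?D] D1 D2[OF _ cmp(2)] D2[OF _ cmp(3)]
      fast_pair_bound[where S = "sum12 ?D" and C = "?D $ 3"] by (simp add: \<omega>_simps)
  have B0: "0 \<le> ?B" using K200 \<delta> init_size_nonneg by auto
  have corrB: "norm (\<delta> *\<^sub>R (M1 *v (N3 *v V t))) \<le> 8 * ?B"
  proof -
    have "norm (R t) \<le> norm (W t) + norm ?D" by (metis norm_minus_commute norm_triangle_sub)
    also have "\<dots> \<le> norm (W t) + 12 * ?B" using D by simp
    finally have "k ^ 3 * \<delta> * norm (R t) \<le> k ^ 3 * \<delta> * (norm (W t) + 12 * ?B)"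
      using k3\<delta>0 by (intro mult_left_mono) auto
    also have "\<dots> = k^3 * \<delta> * norm (W t) + (k ^ 3 * \<delta>) * (12 * ?B)" by (simp only: distrib_left)
    also have "\<dots> \<le> k ^ 3 * \<delta> * norm (W t) + 1/2 * (12 * ?B)" using k3\<delta> B0 by (intro add_left_mono mult_right_mono) auto
    also have "k ^ 3 * \<delta> * norm (W t) \<le> k ^ 3 * \<delta> * (39 * ?e * init_size)" using Wt k3\<delta>0 by (intro mult_left_mono) auto
    also have "\<dots> = (39 * k ^ 3) * (\<delta> * ?e * init_size)" by simp
    also have "\<dots> \<le> (119 * K\<^sup>2) * (\<delta> * ?e * init_size)"
    proof (rule mult_right_mono)
      have "39 * k ^ 3 \<le> K * 1" using k(1) by (simp add: K_def)
      also have "\<dots> \<le> K * (119 * K)" using K200 by (intro mult_left_mono) auto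
      finally show "39 * k ^ 3 \<le> 119 * K\<^sup>2" by (simp add: power2_eq_square)
    qed (use \<delta> init_size_nonneg in auto)
    finally have "k ^ 3 * \<delta> * norm (R t) \<le> 7 * ?B" by (simp add: mult_ac)
    then show ?thesis using corr[of t] B0 by linarith
  qed
  have "W t - M1 *v ((mat 1 + \<delta> *\<^sub>R N3) *v V t) = ?D - \<delta> *\<^sub>R (M1 *v (N3 *v V t))" unfolding prof by simp
  then have "norm (W t - M1 *v ((mat 1 + \<delta> *\<^sub>R N3) *v V t)) \<le> norm ?D + norm (\<delta> *\<^sub>R (M1 *v (N3 *v V t)))"
    by (metis norm_triangle_ineq4)
  also have "\<dots> \<le> 20 * ?B" using D corrB by argo
  also have "\<dots> = 2380 * K\<^sup>2 * \<delta> * ?e * init_size" by simp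
  also have "init_size \<le> 23 * norm (W 0)"
  proof -
    have d1: "4 * \<delta> * norm (W 0) \<le> 4 * norm (W 0)" using \<delta> \<delta>s by (simp add: mult_left_le_one_le)
    have f8: "norm (fast_lt \<delta> z (W 0)) \<le> 8 * norm (W 0)" if "norm z = 1" for z
      using norm_triangle_ineq4[of "sum12 (W 0) - 2 * z * W 0 $ 3" "\<i> * of_real \<delta> * (1 + z) * diff12 (W 0)"]
        norm_fast_pair[OF that, of "W 0"] norm_fast_corr[OF that, of \<delta> "W 0"] \<delta> d1 unfolding fast_lt_def by argo
    have s6: "norm (slow_lt \<delta> (W 0)) \<le> 6 * norm (W 0)"
      using norm_triangle_ineq[of "diff12 (W 0)" "\<i> * of_real \<delta> * (sum12 (W 0) + 2 * W 0 $ 3)"]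
        norm_coords_le[of "W 0"] norm_slow_corr[of \<delta> "W 0"] \<delta> d1 unfolding slow_lt_def by argo
    have "init_size \<le> 22 * norm (W 0)"
      unfolding init_size_def using s6 f8[OF \<omega>_simps(3)] f8[OF \<omega>_simps(4)] by linarith
    then show ?thesis using norm_ge_zero[of "W 0"] by linarith
  qed
  finally have "norm (W t - M1 *v ((mat 1 + \<delta> *\<^sub>R N3) *v V t)) \<le> 2380 * K\<^sup>2 * \<delta> * ?e * (23 * norm (W 0))"
    using K200 \<delta> by (simp add: mult_left_mono)
  also have "\<dots> = 54740 * (K\<^sup>2 * \<delta> * ?e * norm (W 0))" by simp
  also have "\<dots> \<le> 55000 * (K\<^sup>2 * \<delta> * ?e * norm (W 0))" using \<delta> by (intro mult_right_mono) auto
  finally show ?thesis by (simp add: mult.assoc)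
qed

lemma invertible_near_identity:
  fixes A :: "complex^3^3"
  assumes k: "\<And>v. norm (A *v v) \<le> k * norm v" and \<delta>: "0 \<le> \<delta>" "\<delta> * k \<le> 1/2"
  shows "invertible (mat 1 + \<delta> *\<^sub>R A)"
proof -
  have "v = 0" if "(mat 1 + \<delta> *\<^sub>R A) *v v = 0" for v
  proof -
    have "(\<delta> *\<^sub>R A) *v v = \<delta> *\<^sub>R (A *v v)"
      by (simp add: vec_eq_iff matrix_vector_mult_def scaleR_sum_right)
    then have "v = - (\<delta> *\<^sub>R (A *v v))"
      using that by (simp add: matrix_vector_mult_add_rdistrib eq_neg_iff_add_eq_0)
    then have "norm v = \<delta> * norm (A *v v)"
      using \<delta> by (metis abs_of_nonneg norm_minus_cancel norm_scaleR)
    also have "\<dots> \<le> \<delta> * (k * norm v)" using k \<delta> by (intro mult_left_mono) auto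
    also have "\<dots> \<le> 1/2 * norm v" using mult_right_mono[OF \<delta>(2), of "norm v"] by simp
    finally show "v = 0" by simp
  qed
  then have "inj ((*v) (mat 1 + \<delta> *\<^sub>R A))"
    by (metis (no_types, lifting) eq_iff_diff_eq_0 injI matrix_vector_mult_diff_distrib)
  then show ?thesis
    using matrix_left_invertible_injective[of "mat 1 + \<delta> *\<^sub>R A"] invertible_left_inverse by blast
qed

section \<open>The Fourier transform\<close>

lemma norm_scalar_mult_complex: "norm (c *s (v :: complex^3)) = norm c * norm v"
  by (simp add: norm_vec_def norm_mult L2_set_right_distrib)

lemma norm_phase: "norm (cis \<theta> *s (v :: complex^3)) = norm v"
  by (simp add: norm_scalar_mult_complex)

lemma borel_measurable_lebesgue_continuous:
  fixes f :: "'a :: euclidean_space \<Rightarrow> 'b :: topological_space"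
  assumes "continuous_on UNIV f" shows "f \<in> borel_measurable lebesgue"
proof (rule measurable_completion)
  show "f \<in> borel_measurable lborel"
    using borel_measurable_continuous_onI[OF assms] by simp
qed

lemma measurable_phase:
  fixes f :: "real^'n \<Rightarrow> complex^3"
  assumes "f \<in> borel_measurable lebesgue"
  shows "(\<lambda>x. cis (- (x \<bullet> \<xi>)) *s f x) \<in> borel_measurable lebesgue"
proof (rule borel_measurable_continuous_Pair[where H = "(*s)", OF _ assms])
  show "(\<lambda>x. cis (- (x \<bullet> \<xi>))) \<in> borel_measurable lebesgue"
    by (intro borel_measurable_lebesgue_continuous continuous_intros)
  show "continuous_on UNIV (\<lambda>x. fst x *s (snd x :: complex^3))"
    unfolding vector_scalar_mult_def by (intro continuous_intros)
qed

lemma integrable_phase: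
  fixes f :: "real^'n \<Rightarrow> complex^3"
  assumes "integrable lebesgue f"
  shows "integrable lebesgue (\<lambda>x. cis (- (x \<bullet> \<xi>)) *s f x)"
  by (rule Bochner_Integration.integrable_bound[OF assms])
     (use assms in \<open>auto intro: measurable_phase simp: norm_phase\<close>)

lemma fourier_diff:
  fixes f g :: "real^'n \<Rightarrow> complex^3"
  assumes "integrable lebesgue f" "integrable lebesgue g"
  shows "fourier (\<lambda>x. f x - g x) \<xi> = fourier f \<xi> - fourier g \<xi>"
  using integrable_phase[OF assms(1)] integrable_phase[OF assms(2)]
  by (simp add: fourier_def vector_ssub_ldistrib scaleR_diff_right)

lemma fourier_matrix:
  fixes f :: "real^'n \<Rightarrow> complex^3" and A :: "complex^3^3"
  assumes "integrable lebesgue f"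
  shows "fourier (\<lambda>x. A *v f x) \<xi> = A *v fourier f \<xi>"
proof -
  have "(LINT x|lebesgue. cis (- (x \<bullet> \<xi>)) *s (A *v f x)) = (LINT x|lebesgue. A *v (cis (- (x \<bullet> \<xi>)) *s f x))"
    by (simp add: vector_scalar_commute)
  also have "\<dots> = A *v (LINT x|lebesgue. cis (- (x \<bullet> \<xi>)) *s f x)"
    by (rule integral_bounded_linear[OF matrix_vector_mul_bounded_linear integrable_phase[OF assms]])
  finally show ?thesis
    by (simp add: fourier_def linear_scale[OF bounded_linear.linear[OF matrix_vector_mul_bounded_linear]])
qed

text \<open>Continuity serves here to have \<open>fourier f\<close> measurable, which is what allows splitting the nonnegative
integrals in the definition of the \<open>L\<^sup>2\<close> transform.\<close>

lemma continuous_on_fourier: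
  fixes f :: "real^'n \<Rightarrow> complex^3"
  assumes f: "integrable lebesgue f"
  shows "continuous_on UNIV (fourier f)"
proof (rule continuous_at_imp_continuous_on, intro ballI)
  fix \<xi> :: "real^'n"
  show "isCont (fourier f) \<xi>"
    unfolding continuous_at_sequentially comp_def fourier_def
  proof (intro allI impI tendsto_scaleR tendsto_const)
    fix X :: "nat \<Rightarrow> real^'n" assume X: "X \<longlonglongrightarrow> \<xi>"
    show "(\<lambda>n. LINT x|lebesgue. cis (- (x \<bullet> X n)) *s f x) \<longlonglongrightarrow> (LINT x|lebesgue. cis (- (x \<bullet> \<xi>)) *s f x)"
    proof (rule integral_dominated_convergence)
      show "integrable lebesgue (\<lambda>x. norm (f x))" using f by simp
      show "AE x in lebesgue. (\<lambda>n. cis (- (x \<bullet> X n)) *s f x) \<longlonglongrightarrow> cis (- (x \<bullet> \<xi>)) *s f x"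
        unfolding vector_scalar_mult_def
        by (intro AE_I2 tendsto_vec_lambda tendsto_intros X)
      show "AE x in lebesgue. norm (cis (- (x \<bullet> X i)) *s f x) \<le> norm (f x)" for i
        by (simp add: norm_phase)
    qed (use f in \<open>auto intro: measurable_phase\<close>)
  qed
qed

lemma measurable_fourier:
  assumes "integrable lebesgue f"
  shows "fourier f \<in> borel_measurable lebesgue"
  by (rule borel_measurable_lebesgue_continuous[OF continuous_on_fourier[OF assms]])

lemma norm_diff_sq_le: "(norm (a - b))\<^sup>2 \<le> 2 * (norm a)\<^sup>2 + 2 * (norm (b :: 'a :: real_normed_vector))\<^sup>2"
proof -
  have "(norm (a - b))\<^sup>2 \<le> (norm a + norm b)\<^sup>2" by (intro power_mono norm_triangle_ineq4) auto
  also have "\<dots> \<le> 2 * (norm a)\<^sup>2 + 2 * (norm b)\<^sup>2"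
    using zero_le_power2[of "norm a - norm b"] by (simp add: power2_eq_square algebra_simps)
  finally show ?thesis .
qed

lemma L2_fun_diff:
  assumes "L2_fun f" "L2_fun g" shows "L2_fun (\<lambda>x. f x - g x)"
  unfolding L2_fun_def
proof
  show m: "(\<lambda>x. f x - g x) \<in> borel_measurable lebesgue" using assms by (auto simp: L2_fun_def)
  have "integrable lebesgue (\<lambda>x. 2 * (norm (f x))\<^sup>2 + 2 * (norm (g x))\<^sup>2)"
    using assms by (auto simp: L2_fun_def)
  then show "integrable lebesgue (\<lambda>x. (norm (f x - g x))\<^sup>2)"
    by (rule Bochner_Integration.integrable_bound) (use m norm_diff_sq_le in auto)
qed

lemma integrable_truncation:
  fixes f :: "real^'n \<Rightarrow> complex^3"
  assumes "L2_fun f"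
  shows "integrable lebesgue (\<lambda>x. indicator (cball 0 r) x *\<^sub>R f x)"
proof (rule Bochner_Integration.integrable_bound)
  have "integrable lebesgue (indicator (cball 0 r) :: real^'n \<Rightarrow> real)"
    using lmeasurable_cball[of 0 r] by (simp add: fmeasurable_def integrable_indicator_iff)
  then show "integrable lebesgue (\<lambda>x. indicator (cball 0 r) x + (norm (f x))\<^sup>2)"
    using assms by (auto simp: L2_fun_def)
  show "(\<lambda>x. indicator (cball 0 r) x *\<^sub>R f x) \<in> borel_measurable lebesgue"
    using assms by (intro borel_measurable_scaleR borel_measurable_indicator) (auto simp: L2_fun_def)
  have "norm (f x) \<le> 1 + (norm (f x))\<^sup>2" for x
    using zero_le_power2[of "norm (f x) - 1/2"] by (simp add: power2_eq_square algebra_simps)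
  then show "AE x in lebesgue. norm (indicator (cball 0 r) x *\<^sub>R f x) \<le> norm (indicator (cball 0 r) x + (norm (f x))\<^sup>2)"
    by (auto simp: indicator_def)
qed

text \<open>The triangle inequality in \<open>L\<^sup>2\<close>, squared and in a form that is meaningful for infinite norms.\<close>

lemma nn_integral_norm_diff_sq_le:
  fixes f g :: "real^'n \<Rightarrow> complex^3"
  assumes [measurable]: "f \<in> borel_measurable lebesgue" "g \<in> borel_measurable lebesgue"
  shows "(\<integral>\<^sup>+ x. ennreal ((norm (f x - g x))\<^sup>2) \<partial>lebesgue)
    \<le> 2 * (\<integral>\<^sup>+ x. ennreal ((norm (f x))\<^sup>2) \<partial>lebesgue) + 2 * (\<integral>\<^sup>+ x. ennreal ((norm (g x))\<^sup>2) \<partial>lebesgue)"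
proof -
  have "(\<integral>\<^sup>+ x. ennreal ((norm (f x - g x))\<^sup>2) \<partial>lebesgue)
     \<le> (\<integral>\<^sup>+ x. 2 * ennreal ((norm (f x))\<^sup>2) + 2 * ennreal ((norm (g x))\<^sup>2) \<partial>lebesgue)"
  proof (rule nn_integral_mono)
    fix x
    have "ennreal ((norm (f x - g x))\<^sup>2) \<le> ennreal (2 * (norm (f x))\<^sup>2 + 2 * (norm (g x))\<^sup>2)"
      by (rule ennreal_leI[OF norm_diff_sq_le])
    then show "ennreal ((norm (f x - g x))\<^sup>2) \<le> 2 * ennreal ((norm (f x))\<^sup>2) + 2 * ennreal ((norm (g x))\<^sup>2)"
      by (simp add: ennreal_plus ennreal_mult)
  qed
  also have "\<dots> = 2 * (\<integral>\<^sup>+ x. ennreal ((norm (f x))\<^sup>2) \<partial>lebesgue) + 2 * (\<integral>\<^sup>+ x. ennreal ((norm (g x))\<^sup>2) \<partial>lebesgue)"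
    by (simp add: nn_integral_add nn_integral_cmult)
  finally show ?thesis .
qed

lemma tendsto_twice_sum_zero:
  fixes a b c :: "nat \<Rightarrow> ennreal"
  assumes "a \<longlonglongrightarrow> 0" "b \<longlonglongrightarrow> 0" "\<And>k. c k \<le> 2 * a k + 2 * b k"
  shows "c \<longlonglongrightarrow> 0"
proof (rule tendsto_sandwich[OF _ _ tendsto_const])
  have "(\<lambda>k. 2 * a k + 2 * b k) \<longlonglongrightarrow> 2 * 0 + 2 * 0"
    by (intro tendsto_add ennreal_tendsto_cmult assms) auto
  then show "(\<lambda>k. 2 * a k + 2 * b k) \<longlonglongrightarrow> 0" by simp
qed (use assms in auto)

lemma has_fourier_L2_limit:
  assumes "has_fourier_L2 f F"
  shows "(\<lambda>k::nat. \<integral>\<^sup>+ \<xi>. ennreal ((norm (F \<xi> -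
        fourier (\<lambda>x. indicator (cball 0 (real k)) x *\<^sub>R f x) \<xi>))\<^sup>2) \<partial>lebesgue) \<longlonglongrightarrow> 0"
  using assms unfolding has_fourier_L2_def by blast

lemma has_fourier_L2_diff:
  fixes f g :: "real^'n \<Rightarrow> complex^3"
  assumes f: "has_fourier_L2 f F" and g: "has_fourier_L2 g G"
  shows "has_fourier_L2 (\<lambda>x. f x - g x) (\<lambda>\<xi>. F \<xi> - G \<xi>)"
proof -
  let ?T = "\<lambda>f (k::nat) x. indicator (cball 0 (real k)) x *\<^sub>R f x"
  have L2: "L2_fun f" "L2_fun F" "L2_fun g" "L2_fun G" using f g by (auto simp: has_fourier_L2_def)
  then have m: "F \<in> borel_measurable lebesgue" "G \<in> borel_measurable lebesgue" by (auto simp: L2_fun_def)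
  have T: "fourier (?T (\<lambda>x. f x - g x) k) \<xi> = fourier (?T f k) \<xi> - fourier (?T g k) \<xi>" for k \<xi>
    unfolding scaleR_diff_right by (rule fourier_diff; rule integrable_truncation; fact)
  have "(\<integral>\<^sup>+ \<xi>. ennreal ((norm ((F \<xi> - G \<xi>) - fourier (?T (\<lambda>x. f x - g x) k) \<xi>))\<^sup>2) \<partial>lebesgue)
    \<le> 2 * (\<integral>\<^sup>+ \<xi>. ennreal ((norm (F \<xi> - fourier (?T f k) \<xi>))\<^sup>2) \<partial>lebesgue)
      + 2 * (\<integral>\<^sup>+ \<xi>. ennreal ((norm (G \<xi> - fourier (?T g k) \<xi>))\<^sup>2) \<partial>lebesgue)" for k
  proof -
    have "(F \<xi> - G \<xi>) - fourier (?T (\<lambda>x. f x - g x) k) \<xi>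
        = (F \<xi> - fourier (?T f k) \<xi>) - (G \<xi> - fourier (?T g k) \<xi>)" for \<xi>
      unfolding T by simp
    then have "(\<integral>\<^sup>+ \<xi>. ennreal ((norm ((F \<xi> - G \<xi>) - fourier (?T (\<lambda>x. f x - g x) k) \<xi>))\<^sup>2) \<partial>lebesgue)
      = (\<integral>\<^sup>+ \<xi>. ennreal ((norm ((F \<xi> - fourier (?T f k) \<xi>) - (G \<xi> - fourier (?T g k) \<xi>)))\<^sup>2) \<partial>lebesgue)"
      by (intro nn_integral_cong) (rule arg_cong[where f = "\<lambda>v. ennreal ((norm v)\<^sup>2)"])
    also have "\<dots> \<le> 2 * (\<integral>\<^sup>+ \<xi>. ennreal ((norm (F \<xi> - fourier (?T f k) \<xi>))\<^sup>2) \<partial>lebesgue)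
      + 2 * (\<integral>\<^sup>+ \<xi>. ennreal ((norm (G \<xi> - fourier (?T g k) \<xi>))\<^sup>2) \<partial>lebesgue)"
      by (intro nn_integral_norm_diff_sq_le borel_measurable_diff m measurable_fourier integrable_truncation L2)
    finally show ?thesis .
  qed
  then have "(\<lambda>k. \<integral>\<^sup>+ \<xi>. ennreal ((norm ((F \<xi> - G \<xi>) - fourier (?T (\<lambda>x. f x - g x) k) \<xi>))\<^sup>2) \<partial>lebesgue) \<longlonglongrightarrow> 0"
    by (rule tendsto_twice_sum_zero[OF f[THEN has_fourier_L2_limit] g[THEN has_fourier_L2_limit]])
  then show ?thesis unfolding has_fourier_L2_def using L2 by (auto intro: L2_fun_diff)
qed

lemma has_fourier_L2_unique:
  fixes f :: "real^'n \<Rightarrow> complex^3"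
  assumes F: "has_fourier_L2 f F" and G: "has_fourier_L2 f G"
  shows "AE \<xi> in lebesgue. F \<xi> = G \<xi>"
proof -
  let ?T = "\<lambda>(k::nat) x. indicator (cball 0 (real k)) x *\<^sub>R f x"
  have L2: "L2_fun f" "L2_fun F" "L2_fun G" using F G by (auto simp: has_fourier_L2_def)
  then have m[measurable]: "F \<in> borel_measurable lebesgue" "G \<in> borel_measurable lebesgue" by (auto simp: L2_fun_def)
  let ?c = "\<integral>\<^sup>+ \<xi>. ennreal ((norm (F \<xi> - G \<xi>))\<^sup>2) \<partial>lebesgue"
  have "?c \<le> 2 * (\<integral>\<^sup>+ \<xi>. ennreal ((norm (F \<xi> - fourier (?T k) \<xi>))\<^sup>2) \<partial>lebesgue)
      + 2 * (\<integral>\<^sup>+ \<xi>. ennreal ((norm (G \<xi> - fourier (?T k) \<xi>))\<^sup>2) \<partial>lebesgue)" for k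
  proof -
    have "?c = (\<integral>\<^sup>+ \<xi>. ennreal ((norm ((F \<xi> - fourier (?T k) \<xi>) - (G \<xi> - fourier (?T k) \<xi>)))\<^sup>2) \<partial>lebesgue)"
      by simp
    also have "\<dots> \<le> 2 * (\<integral>\<^sup>+ \<xi>. ennreal ((norm (F \<xi> - fourier (?T k) \<xi>))\<^sup>2) \<partial>lebesgue)
      + 2 * (\<integral>\<^sup>+ \<xi>. ennreal ((norm (G \<xi> - fourier (?T k) \<xi>))\<^sup>2) \<partial>lebesgue)"
      by (intro nn_integral_norm_diff_sq_le borel_measurable_diff m measurable_fourier integrable_truncation L2)
    finally show ?thesis .
  qed
  then have "(\<lambda>k::nat. ?c) \<longlonglongrightarrow> 0"
    by (rule tendsto_twice_sum_zero[OF F[THEN has_fourier_L2_limit] G[THEN has_fourier_L2_limit]])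
  then have "?c = 0" by (simp add: LIMSEQ_const_iff)
  then have "AE \<xi> in lebesgue. ennreal ((norm (F \<xi> - G \<xi>))\<^sup>2) = 0"
    by (subst (asm) nn_integral_0_iff_AE) auto
  then show ?thesis by (simp add: AE_mp)
qed

lemma has_fourier_L2_fourier_L2:
  assumes "has_fourier_L2 f F" shows "has_fourier_L2 f (fourier_L2 f)"
  using assms unfolding fourier_L2_def by (metis someI_ex)

text \<open>Interpolation between the bounds \<open>|\<theta>|\<close> and \<open>2\<close>.\<close>

lemma norm_cis_minus_one_le:
  fixes \<theta> \<kappa> :: real
  assumes "0 \<le> \<kappa>" "\<kappa> \<le> 1"
  shows "norm (cis \<theta> - 1) \<le> 2 * \<bar>\<theta>\<bar> powr \<kappa>"
proof -
  have c: "norm (cis \<theta> - 1) = 2 * \<bar>sin (\<theta> / 2)\<bar>"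
    using dist_exp_i_1[of \<theta>] by (simp add: cis_conv_exp)
  consider "\<theta> = 0" | "1 \<le> \<bar>\<theta>\<bar>" | "\<theta> \<noteq> 0" "\<bar>\<theta>\<bar> < 1" by linarith
  then show ?thesis
  proof cases
    case 2
    then have "1 \<le> \<bar>\<theta>\<bar> powr \<kappa>" using assms by (simp add: ge_one_powr_ge_zero)
    then show ?thesis using c abs_sin_le_one[of "\<theta> / 2"] by linarith
  next
    case 3
    then have "\<bar>\<theta>\<bar> powr 1 \<le> \<bar>\<theta>\<bar> powr \<kappa>" using assms by (intro powr_mono') auto
    then show ?thesis using c abs_sin_x_le_abs_x[of "\<theta> / 2"] 3 by simp
  qed simp
qed

lemma L1_weighted_integrable:
  assumes "L1_weighted \<kappa> f" "0 \<le> \<kappa>" shows "integrable lebesgue f"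
proof (rule Bochner_Integration.integrable_bound)
  show "integrable lebesgue (\<lambda>x. (1 + norm x) powr \<kappa> * norm (f x))" "f \<in> borel_measurable lebesgue"
    using assms by (auto simp: L1_weighted_def)
  have "1 * norm (f x) \<le> (1 + norm x) powr \<kappa> * norm (f x)" for x
    using assms by (intro mult_right_mono ge_one_powr_ge_zero) auto
  then show "AE x in lebesgue. norm (f x) \<le> norm ((1 + norm x) powr \<kappa> * norm (f x))" by simp
qed

lemma L1_weighted_norm_nonneg: "0 \<le> L1_weighted_norm \<kappa> f"
  unfolding L1_weighted_norm_def by (intro integral_nonneg_AE) auto

text \<open>The mass is the transform at frequency \<open>0\<close>, up to normalisation,
and \<open>|x \<bullet> \<xi>|\<close> to the power \<open>\<kappa>\<close> can be paid by the weight.\<close>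

lemma norm_fourier_le:
  fixes f :: "real^'n \<Rightarrow> complex^3"
  assumes f: "L1_weighted \<kappa> f" and \<kappa>: "0 \<le> \<kappa>" "\<kappa> \<le> 1"
  shows "norm (fourier f \<xi>) \<le> 2 * (norm \<xi> powr \<kappa> * L1_weighted_norm \<kappa> f + norm (total_mass f))"
proof -
  have int: "integrable lebesgue f" by (rule L1_weighted_integrable[OF f \<kappa>(1)])
  note ph = integrable_phase[OF int, of \<xi>]
  have "norm (LINT x|lebesgue. cis (- (x \<bullet> \<xi>)) *s f x - f x)
     \<le> (LINT x|lebesgue. 2 * norm \<xi> powr \<kappa> * ((1 + norm x) powr \<kappa> * norm (f x)))"
  proof (rule Bochner_Integration.integral_norm_bound_integral)
    show "integrable lebesgue (\<lambda>x. cis (- (x \<bullet> \<xi>)) *s f x - f x)" using ph int by auto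
    show "integrable lebesgue (\<lambda>x. 2 * norm \<xi> powr \<kappa> * ((1 + norm x) powr \<kappa> * norm (f x)))"
      using f by (auto simp: L1_weighted_def)
    fix x :: "real^'n"
    have "cis (- (x \<bullet> \<xi>)) *s f x - f x = (cis (- (x \<bullet> \<xi>)) - 1) *s f x"
      by (simp add: vector_sub_rdistrib)
    also have "norm \<dots> = norm (cis (- (x \<bullet> \<xi>)) - 1) * norm (f x)"
      by (rule norm_scalar_mult_complex)
    also have "\<dots> \<le> (2 * \<bar>x \<bullet> \<xi>\<bar> powr \<kappa>) * norm (f x)"
      using norm_cis_minus_one_le[OF \<kappa>, of "- (x \<bullet> \<xi>)"] by (intro mult_right_mono) auto
    also have "\<dots> \<le> (2 * (norm x * norm \<xi>) powr \<kappa>) * norm (f x)"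
      using Cauchy_Schwarz_ineq2[of x \<xi>] \<kappa> by (intro mult_right_mono mult_left_mono powr_mono2) auto
    also have "(norm x * norm \<xi>) powr \<kappa> = norm \<xi> powr \<kappa> * norm x powr \<kappa>" by (simp add: powr_mult mult.commute)
    also have "(2 * (norm \<xi> powr \<kappa> * norm x powr \<kappa>)) * norm (f x)
        \<le> (2 * (norm \<xi> powr \<kappa> * (1 + norm x) powr \<kappa>)) * norm (f x)"
      using \<kappa> by (intro mult_right_mono mult_left_mono powr_mono2) auto
    finally show "norm (cis (- (x \<bullet> \<xi>)) *s f x - f x) \<le> 2 * norm \<xi> powr \<kappa> * ((1 + norm x) powr \<kappa> * norm (f x))"
      by (simp add: mult_ac)
  qed
  also have "\<dots> = 2 * (norm \<xi> powr \<kappa> * L1_weighted_norm \<kappa> f)" by (simp add: L1_weighted_norm_def mult.assoc)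
  finally have d: "norm ((LINT x|lebesgue. cis (- (x \<bullet> \<xi>)) *s f x) - total_mass f)
      \<le> 2 * (norm \<xi> powr \<kappa> * L1_weighted_norm \<kappa> f)"
    unfolding total_mass_def using ph int by simp
  have c: "norm (fourier f \<xi>) \<le> 1 * norm (LINT x|lebesgue. cis (- (x \<bullet> \<xi>)) *s f x)"
  proof -
    have "1 \<le> (2 * pi) powr (real CARD('n) / 2)" using pi_gt3 by (intro ge_one_powr_ge_zero) auto
    then show ?thesis unfolding fourier_def norm_scaleR by (intro mult_right_mono) auto
  qed
  show ?thesis using c d norm_triangle_sub[of "LINT x|lebesgue. cis (- (x \<bullet> \<xi>)) *s f x" "total_mass f"]
      norm_ge_zero[of "total_mass f"] by argo
qed

section \<open>Decay of low-frequency integrals\<close>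

lemma powr_exp_decay_bound:
  fixes a c \<beta> k :: real
  assumes "0 \<le> a" "0 < c" "0 < \<beta>" "0 \<le> k"
  obtains B where "0 \<le> B" "\<And>r. 0 \<le> r \<Longrightarrow> r powr a * exp (- c * r powr \<beta>) \<le> B / (1 + r) powr k"
proof -
  have "((\<lambda>r. (1 + r) powr (a + k) * exp (- c * r powr \<beta>)) \<longlongrightarrow> 0) at_top"
    using assms by real_asymp
  then have "eventually (\<lambda>r. (1 + r) powr (a + k) * exp (- c * r powr \<beta>) < 1) at_top"
    by (rule order_tendstoD) simp
  then obtain R where R: "\<And>r. R \<le> r \<Longrightarrow> (1 + r) powr (a + k) * exp (- c * r powr \<beta>) < 1"
    by (auto simp: eventually_at_top_linorder)
  \<comment> \<open>The expression is at most \<open>1\<close> beyond \<open>R\<close> and trivially bounded before it.\<close>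
  define B where "B = 1 + (1 + \<bar>R\<bar>) powr (a + k)"
  have "r powr a * exp (- c * r powr \<beta>) \<le> B / (1 + r) powr k" if r: "0 \<le> r" for r
  proof -
    have *: "(1 + r) powr (a + k) * exp (- c * r powr \<beta>) \<le> B"
    proof (cases "R \<le> r")
      case True
      show ?thesis unfolding B_def using R[OF True] powr_ge_zero[of "1 + \<bar>R\<bar>" "a + k"] by linarith
    next
      case False
      have "(1 + r) powr (a + k) * exp (- c * r powr \<beta>) \<le> (1 + \<bar>R\<bar>) powr (a + k) * 1"
        using False r assms by (intro mult_mono powr_mono2) auto
      then show ?thesis by (simp add: B_def)
    qed
    have "r powr a * exp (- c * r powr \<beta>) * (1 + r) powr k \<le> (1 + r) powr a * exp (- c * r powr \<beta>) * (1 + r) powr k"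
      using r assms by (intro mult_right_mono powr_mono2) auto
    also have "\<dots> = (1 + r) powr (a + k) * exp (- c * r powr \<beta>)" by (simp add: powr_add)
    also note *
    finally show ?thesis using r by (simp add: field_simps)
  qed
  then show ?thesis using that[of B] by (auto simp: B_def)
qed

text \<open>The integrand is dominated by a sum of indicators of balls of radius \<open>k + 1\<close>, weighted such that
each of them contributes a multiple of \<open>1 / (k + 1)\<^sup>2\<close>.\<close>

lemma nn_integral_radial_finite:
  fixes a c \<beta> :: real
  assumes "0 \<le> a" "0 < c" "0 < \<beta>"
  shows "(\<integral>\<^sup>+ x. ennreal (norm x powr a * exp (- c * norm x powr \<beta>)) \<partial>(lborel :: 'a :: euclidean_space measure)) < \<infinity>"
proof -
  define n where "n = DIM('a)"
  obtain B where B: "0 \<le> B" "\<And>r. 0 \<le> r \<Longrightarrow> r powr a * exp (- c * r powr \<beta>) \<le> B / (1 + r) powr (real n + 2)"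
    using powr_exp_decay_bound[of a c \<beta> "real n + 2"] assms by auto
  define b where "b k = B / (1 + real k) powr (real n + 2)" for k :: nat
  have b0: "0 \<le> b k" for k using B by (simp add: b_def)
  have "(\<integral>\<^sup>+ x. ennreal (norm x powr a * exp (- c * norm x powr \<beta>)) \<partial>(lborel :: 'a measure))
     \<le> (\<integral>\<^sup>+ x. (\<Sum>k. ennreal (b k) * indicator (cball 0 (1 + real k)) x) \<partial>(lborel :: 'a measure))"
  proof (rule nn_integral_mono)
    fix x :: 'a
    define k where "k = nat \<lfloor>norm x\<rfloor>"
    have k: "real k \<le> norm x" "norm x \<le> 1 + real k" 
      unfolding k_def using norm_ge_zero[of x] by linarith+
    have "norm x powr a * exp (- c * norm x powr \<beta>) \<le> B / (1 + norm x) powr (real n + 2)" by (rule B(2)) simp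
    also have "\<dots> \<le> b k" unfolding b_def using k B(1)
      by (intro divide_left_mono powr_mono2) (auto intro!: mult_pos_pos simp: add_pos_nonneg)
    finally have "ennreal (norm x powr a * exp (- c * norm x powr \<beta>))
        \<le> ennreal (b k) * indicator (cball 0 (1 + real k)) x"
      using k by (simp add: ennreal_leI)
    also have "\<dots> \<le> (\<Sum>k. ennreal (b k) * indicator (cball 0 (1 + real k)) x)"
    proof -
      define h where "h j = ennreal (b j) * indicator (cball 0 (1 + real j)) x" for j
      have "h k \<le> (\<Sum>j. h j)" using sum_le_suminf[of h "{k}"] by simp
      then show ?thesis by (simp only: h_def)
    qed
    finally show "ennreal (norm x powr a * exp (- c * norm x powr \<beta>)) \<le> \<dots>" .
  qed
  also have "\<dots> = (\<Sum>k. \<integral>\<^sup>+ x. ennreal (b k) * indicator (cball 0 (1 + real k)) x \<partial>(lborel :: 'a measure))"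
  proof (rule nn_integral_suminf)
    show "(\<lambda>x. ennreal (b k) * indicator (cball 0 (1 + real k)) x) \<in> borel_measurable (lborel :: 'a measure)" for k
    proof -
      have [measurable]: "cball (0 :: 'a) (1 + real k) \<in> sets borel" by (rule borel_closed[OF closed_cball])
      show ?thesis by measurable
    qed
  qed
  also have "\<dots> = (\<Sum>k. ennreal (B * unit_ball_vol n * (1 / (1 + real k)\<^sup>2)))"
  proof (rule suminf_cong)
    fix k :: nat
    \<comment> \<open>The volume of the ball cancels all but two powers of \<open>1 + k\<close>.\<close>
    have "(\<integral>\<^sup>+ x. ennreal (b k) * indicator (cball 0 (1 + real k)) x \<partial>(lborel :: 'a measure))
       = ennreal (b k) * ennreal (unit_ball_vol n * (1 + real k) ^ n)"
      by (subst nn_integral_cmult_indicator) (auto simp: emeasure_cball n_def)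
    also have "\<dots> = ennreal (b k * (unit_ball_vol n * (1 + real k) ^ n))"
      using b0 by (simp add: ennreal_mult)
    also have "b k * (unit_ball_vol n * (1 + real k) ^ n) = B * unit_ball_vol n * (1 / (1 + real k)\<^sup>2)"
      by (simp add: b_def powr_add powr_realpow add_pos_nonneg)
    finally show "(\<integral>\<^sup>+ x. ennreal (b k) * indicator (cball 0 (1 + real k)) x \<partial>(lborel :: 'a measure))
        = ennreal (B * unit_ball_vol n * (1 / (1 + real k)\<^sup>2))" .
  qed
  also have "\<dots> < \<infinity>"
  proof -
    have "summable (\<lambda>k. 1 / (1 + real k)\<^sup>2)"
      using inverse_power_summable[of 2, where 'a = real] summable_Suc_iff[of "\<lambda>n. inverse (real n ^ 2)"]
      by (simp add: inverse_eq_divide)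
    then have "summable (\<lambda>k. B * unit_ball_vol n * (1 / (1 + real k)\<^sup>2))" by (rule summable_mult)
    then show ?thesis using B(1) by (subst suminf_ennreal2) auto
  qed
  finally show ?thesis .
qed

text \<open>Substitute \<open>x = s y\<close> with \<open>s\<close> equal to \<open>T\<close> to the power \<open>-1/\<beta>\<close>.\<close>

lemma nn_integral_radial_scaling:
  fixes a c \<beta> :: real
  assumes "0 \<le> a" "0 < c" "0 < \<beta>"
  obtains J where "0 \<le> J" "\<And>T. 0 < T \<Longrightarrow>
    (\<integral>\<^sup>+ x. ennreal (norm x powr a * exp (- c * norm x powr \<beta> * T)) \<partial>(lborel :: 'a :: euclidean_space measure))
      = ennreal (J * T powr (- (real DIM('a) + a) / \<beta>))"
proof -
  let ?I = "\<integral>\<^sup>+ x. ennreal (norm x powr a * exp (- c * norm x powr \<beta>)) \<partial>(lborel :: 'a measure)"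
  define J where "J = enn2real ?I"
  have J: "?I = ennreal J" "0 \<le> J" using nn_integral_radial_finite[OF assms, where 'a = 'a] by (simp_all add: J_def)
  have "(\<integral>\<^sup>+ x. ennreal (norm x powr a * exp (- c * norm x powr \<beta> * T)) \<partial>(lborel :: 'a measure))
      = ennreal (J * T powr (- (real DIM('a) + a) / \<beta>))" if T: "0 < T" for T
  proof -
    \<comment> \<open>The scale at which the exponent becomes independent of \<open>T\<close>.\<close>
    define s where "s = T powr (- 1 / \<beta>)"
    have s: "0 < s" using T by (simp add: s_def)
    have s\<beta>: "s powr \<beta> * T = 1"
    proof -
      have "s powr \<beta> = T powr (- 1 / \<beta> * \<beta>)" unfolding s_def by (rule powr_powr)
      also have "- 1 / \<beta> * \<beta> = - 1" using assms by simp
      finally show ?thesis using T by (simp add: powr_minus)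
    qed
    have sn: "s ^ DIM('a) * s powr a = T powr (- (real DIM('a) + a) / \<beta>)"
    proof -
      have "s ^ DIM('a) * s powr a = s powr (real DIM('a) + a)" using s by (simp add: powr_add powr_realpow)
      also have "\<dots> = T powr (- 1 / \<beta> * (real DIM('a) + a))" unfolding s_def by (rule powr_powr)
      also have "- 1 / \<beta> * (real DIM('a) + a) = - (real DIM('a) + a) / \<beta>"
        by (simp only: minus_divide_left[symmetric] times_divide_eq_left mult_1 minus_mult_left[symmetric])
      finally show ?thesis .
    qed
    have "(\<integral>\<^sup>+ x. ennreal (norm x powr a * exp (- c * norm x powr \<beta> * T)) \<partial>(lborel :: 'a measure))
      = (\<integral>\<^sup>+ x. ennreal (s ^ DIM('a)) * ennreal (norm (s *\<^sub>R x) powr a * exp (- c * norm (s *\<^sub>R x) powr \<beta> * T))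
          \<partial>(lborel :: 'a measure))"
      using s by (subst lborel_affine[where c = s and t = 0])
        (auto simp: nn_integral_density nn_integral_distr)
    also have "\<dots> = (\<integral>\<^sup>+ x. ennreal (T powr (- (real DIM('a) + a) / \<beta>)) * ennreal (norm x powr a * exp (- c *
        norm x powr \<beta>)) \<partial>(lborel :: 'a measure))"
    proof (rule nn_integral_cong)
      fix x :: 'a
      have "c * norm (s *\<^sub>R x) powr \<beta> * T = c * norm x powr \<beta> * (s powr \<beta> * T)"
        using s by (simp add: powr_mult)
      then have e: "c * norm (s *\<^sub>R x) powr \<beta> * T = c * norm x powr \<beta>" by (simp add: s\<beta>)
      have "s ^ DIM('a) * (norm (s *\<^sub>R x) powr a * exp (- (c * norm (s *\<^sub>R x) powr \<beta> * T)))
         = (s ^ DIM('a) * s powr a) * (norm x powr a * exp (- (c * norm x powr \<beta>)))"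
        unfolding e using s by (simp add: powr_mult)
      then show "ennreal (s ^ DIM('a)) * ennreal (norm (s *\<^sub>R x) powr a * exp (- c * norm (s *\<^sub>R x) powr \<beta> * T))
        = ennreal (T powr (- (real DIM('a) + a) / \<beta>)) * ennreal (norm x powr a * exp (- c * norm x powr \<beta>))"
        using s unfolding sn by (simp add: ennreal_mult[symmetric])
    qed
    also have "\<dots> = ennreal (T powr (- (real DIM('a) + a) / \<beta>)) * ?I" by (rule nn_integral_cmult) auto
    also have "\<dots> = ennreal (J * T powr (- (real DIM('a) + a) / \<beta>))"
      using J by (simp add: ennreal_mult[symmetric] mult.commute)
    finally show ?thesis .
  qed
  then show ?thesis using that J(2) by blast
qed

lemma lap_symbol_eq: "\<xi> \<noteq> 0 \<Longrightarrow> lap_symbol \<nu> \<xi> = norm \<xi> powr (2 * \<nu>)"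
  by (simp add: lap_symbol_def)

lemma measurable_lap_symbol: "lap_symbol \<nu> \<in> borel_measurable lebesgue"
proof (rule measurable_completion)
  show "lap_symbol \<nu> \<in> borel_measurable lborel"
    unfolding lap_symbol_def[abs_def] by measurable
qed

lemma AE_lebesgue_nonzero: "AE \<xi> in lebesgue. \<xi> \<noteq> (0 :: 'a :: euclidean_space)"
  by (rule AE_completion[OF AE_lborel_singleton])

text \<open>On the ball of radius \<open>\<epsilon>\<close> the time \<open>t\<close> in the exponential can be replaced by \<open>1 + t\<close> at the cost of a constant, so
that the scaling law gives a bound that is uniform down to \<open>t = 0\<close>. The \<open>L\<^sup>2\<close> transform is unique only up to null sets,
which is why the pointwise hypothesis is imposed on an arbitrary transform \<open>F\<close> of \<open>f\<close> almost everywhere.\<close>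

lemma low_frequency_bound:
  fixes \<beta> c g s0 \<kappa> \<epsilon> B :: real
  assumes \<beta>: "0 < \<beta>" and c: "0 < c" and g: "0 \<le> g" and s0: "0 \<le> s0" and \<kappa>: "0 \<le> \<kappa>" "\<kappa> \<le> 1"
    and \<epsilon>: "0 \<le> \<epsilon>" and B: "0 \<le> B"
  obtains C where "0 < C"
    "\<And>(f :: real^'n \<Rightarrow> complex^3) F w0 t. 0 \<le> t \<Longrightarrow> has_fourier_L2 f F \<Longrightarrow> L1_weighted \<kappa> w0 \<Longrightarrow>
       (AE \<xi> in lebesgue. norm (F \<xi>) \<le> indicator (cball 0 \<epsilon>) \<xi> *
          (B * norm \<xi> powr g * exp (- c * norm \<xi> powr \<beta> * t) * norm (fourier w0 \<xi>))) \<Longrightarrow>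
       Hdot_fun s0 f \<and> Hdot_norm s0 f \<le> C *
         ((1 + t) powr (- (real CARD('n) + 2 * (s0 + \<kappa> + g)) / (2 * \<beta>)) * L1_weighted_norm \<kappa> w0
        + (1 + t) powr (- (real CARD('n) + 2 * (s0 + g)) / (2 * \<beta>)) * norm (total_mass w0))"
proof -
  obtain J1 where J1: "0 \<le> J1" "\<And>T. 0 < T \<Longrightarrow>
    (\<integral>\<^sup>+ x. ennreal (norm x powr (2 * (s0 + \<kappa> + g)) * exp (- (2 * c) * norm x powr \<beta> * T)) \<partial>(lborel :: (real^'n)
        measure))
      = ennreal (J1 * T powr (- (real CARD('n) + 2 * (s0 + \<kappa> + g)) / \<beta>))"
    using nn_integral_radial_scaling[of "2 * (s0 + \<kappa> + g)" "2 * c" \<beta>, where 'a = "real^'n"] s0 \<kappa> g c \<beta> by auto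
  obtain J2 where J2: "0 \<le> J2" "\<And>T. 0 < T \<Longrightarrow>
    (\<integral>\<^sup>+ x. ennreal (norm x powr (2 * (s0 + g)) * exp (- (2 * c) * norm x powr \<beta> * T)) \<partial>(lborel :: (real^'n) measure))
      = ennreal (J2 * T powr (- (real CARD('n) + 2 * (s0 + g)) / \<beta>))"
    using nn_integral_radial_scaling[of "2 * (s0 + g)" "2 * c" \<beta>, where 'a = "real^'n"] s0 g c \<beta> by auto
  define D where "D = 2 * B * exp (c * \<epsilon> powr \<beta>)"
  have D: "0 \<le> D" using B by (simp add: D_def)
  define C where "C = 1 + 2 * D * (sqrt J1 + sqrt J2)"
  have "Hdot_fun s0 f \<and> Hdot_norm s0 f \<le> C *
         ((1 + t) powr (- (real CARD('n) + 2 * (s0 + \<kappa> + g)) / (2 * \<beta>)) * L1_weighted_norm \<kappa> w0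
        + (1 + t) powr (- (real CARD('n) + 2 * (s0 + g)) / (2 * \<beta>)) * norm (total_mass w0))"
    if t: "0 \<le> t" and f: "has_fourier_L2 f F" and w0: "L1_weighted \<kappa> w0"
      and F: "AE \<xi> in lebesgue. norm (F \<xi>) \<le> indicator (cball 0 \<epsilon>) \<xi> *
          (B * norm \<xi> powr g * exp (- c * norm \<xi> powr \<beta> * t) * norm (fourier w0 \<xi>))"
    for f F :: "real^'n \<Rightarrow> complex^3" and w0 :: "real^'n \<Rightarrow> complex^3" and t
  proof -
    define X where "X = L1_weighted_norm \<kappa> w0"
    define Y where "Y = norm (total_mass w0)"
    have XY: "0 \<le> X" "0 \<le> Y" by (simp_all add: X_def Y_def L1_weighted_norm_nonneg)
    let ?E = "\<lambda>\<xi> :: real^'n. exp (- (2 * c) * norm \<xi> powr \<beta> * (1 + t))"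
    let ?G1 = "\<lambda>\<xi> :: real^'n. norm \<xi> powr (2 * (s0 + \<kappa> + g)) * ?E \<xi>"
    let ?G2 = "\<lambda>\<xi> :: real^'n. norm \<xi> powr (2 * (s0 + g)) * ?E \<xi>"
    let ?h = "\<lambda>\<xi>. lap_symbol (s0 / 2) \<xi> *\<^sub>R F \<xi>"
    define P1 where "P1 = (1 + t) powr (- (real CARD('n) + 2 * (s0 + \<kappa> + g)) / (2 * \<beta>))"
    define P2 where "P2 = (1 + t) powr (- (real CARD('n) + 2 * (s0 + g)) / (2 * \<beta>))"
    have P1: "(1 + t) powr (- (real CARD('n) + 2 * (s0 + \<kappa> + g)) / \<beta>) = P1\<^sup>2"
      and P2: "(1 + t) powr (- (real CARD('n) + 2 * (s0 + g)) / \<beta>) = P2\<^sup>2"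
  proof -
      have "x / \<beta> = x / (2 * \<beta>) + x / (2 * \<beta>)" for x by simp
      then show "(1 + t) powr (- (real CARD('n) + 2 * (s0 + \<kappa> + g)) / \<beta>) = P1\<^sup>2"
        "(1 + t) powr (- (real CARD('n) + 2 * (s0 + g)) / \<beta>) = P2\<^sup>2"
        unfolding P1_def P2_def power2_eq_square powr_add[symmetric] by metis+
    qed
    have P0: "0 \<le> P1" "0 \<le> P2" by (simp_all add: P1_def P2_def)
    have mF: "F \<in> borel_measurable lebesgue" using f by (auto simp: has_fourier_L2_def L2_fun_def)
    have mh: "?h \<in> borel_measurable lebesgue" by (intro borel_measurable_scaleR measurable_lap_symbol mF)
    have bound: "AE \<xi> in lebesgue. (norm (?h \<xi>))\<^sup>2 \<le> (2 * D\<^sup>2 * X\<^sup>2) * ?G1 \<xi> + (2 * D\<^sup>2 * Y\<^sup>2) * ?G2 \<xi>"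
      using F AE_lebesgue_nonzero
    proof eventually_elim
      case (elim \<xi>)
      define r where "r = norm \<xi>"
      have r: "0 < r" using elim by (simp add: r_def)
      have pos: "0 \<le> (2 * D\<^sup>2 * X\<^sup>2) * ?G1 \<xi> + (2 * D\<^sup>2 * Y\<^sup>2) * ?G2 \<xi>"
          by (intro add_nonneg_nonneg mult_nonneg_nonneg) auto
      show ?case
      proof (cases "norm \<xi> \<le> \<epsilon>")
        case False
        then have "F \<xi> = 0" using elim(1) by simp
        then show ?thesis using pos by simp
      next
        case True
        have sq: "(r powr x * z)\<^sup>2 = r powr (2 * x) * z\<^sup>2" for x z
          by (simp add: power_mult_distrib power2_eq_square flip: powr_add)
        \<comment> \<open>Pass from \<open>t\<close> to \<open>1 + t\<close>, using that \<open>r \<le> \<epsilon>\<close>.\<close>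
        have rb: "r powr \<beta> \<le> \<epsilon> powr \<beta>" using True \<beta> by (intro powr_mono2) (auto simp: r_def)
        have "exp (- c * r powr \<beta> * t) = exp (c * r powr \<beta>) * exp (- c * r powr \<beta> * (1 + t))"
          by (simp add: algebra_simps flip: exp_add)
        also have "\<dots> \<le> exp (c * \<epsilon> powr \<beta>) * exp (- c * r powr \<beta> * (1 + t))"
          using rb c by (intro mult_right_mono) auto
        finally have e: "exp (- c * r powr \<beta> * t) \<le> exp (c * \<epsilon> powr \<beta>) * exp (- c * r powr \<beta> * (1 + t))" .
        have "norm (F \<xi>) \<le> B * r powr g * exp (- c * r powr \<beta> * t) * norm (fourier w0 \<xi>)"
          using elim True by (simp add: r_def)
        also have "\<dots> \<le> B * r powr g * (exp (c * \<epsilon> powr \<beta>) * exp (- c * r powr \<beta> * (1 + t))) * (2 * (r powr \<kappa> * X + Y))"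
          using e B norm_fourier_le[OF w0 \<kappa>, of \<xi>] XY
          by (intro mult_mono mult_left_mono) (auto simp: r_def X_def Y_def intro!: mult_nonneg_nonneg
              add_nonneg_nonneg)
        finally have "r powr s0 * norm (F \<xi>) \<le> r powr s0 * (B * r powr g * (exp (c * \<epsilon> powr \<beta>) * exp (- c * r
            powr \<beta> * (1 + t))) * (2 * (r powr \<kappa> * X + Y)))"
          by (intro mult_left_mono) auto
        also have "\<dots> = (D * exp (- c * r powr \<beta> * (1 + t))) * (r powr (s0 + \<kappa> + g) * X + r powr (s0 + g) * Y)"
          by (simp add: D_def powr_add algebra_simps)
        finally have "norm (?h \<xi>) \<le> (D * exp (- c * r powr \<beta> * (1 + t))) * (r powr (s0 + \<kappa> + g) * X + r powr (s0
            + g) * Y)"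
          using elim by (simp add: lap_symbol_eq r_def)
        then have "(norm (?h \<xi>))\<^sup>2 \<le> ((D * exp (- c * r powr \<beta> * (1 + t))) * (r powr (s0 + \<kappa> + g) * X + r powr
            (s0 + g) * Y))\<^sup>2"
          by (intro power_mono) auto
        also have "\<dots> = (D\<^sup>2 * (exp (- c * r powr \<beta> * (1 + t)))\<^sup>2) * (r powr (s0 + \<kappa> + g) * X + r powr (s0 + g) * Y)\<^sup>2"
          by (simp only: power_mult_distrib)
        also have "\<dots> \<le> (D\<^sup>2 * (exp (- c * r powr \<beta> * (1 + t)))\<^sup>2) * (2 * (r powr (s0 + \<kappa> + g) * X)\<^sup>2 + 2 * (r
            powr (s0 + g) * Y)\<^sup>2)"
          using norm_diff_sq_le[of "r powr (s0 + \<kappa> + g) * X" "- (r powr (s0 + g) * Y)"]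
          by (intro mult_left_mono) auto
        also have "(exp (- c * r powr \<beta> * (1 + t)))\<^sup>2 = ?E \<xi>" by (simp add: r_def flip: exp_double)
        also have "(r powr (s0 + \<kappa> + g) * X)\<^sup>2 = r powr (2 * (s0 + \<kappa> + g)) * X\<^sup>2" by (rule sq)
        also have "(r powr (s0 + g) * Y)\<^sup>2 = r powr (2 * (s0 + g)) * Y\<^sup>2" by (rule sq)
        finally show ?thesis by (simp only: r_def) (simp add: algebra_simps)
      qed
    qed
    define R where "R = (2 * D\<^sup>2 * X\<^sup>2) * (J1 * P1\<^sup>2) + (2 * D\<^sup>2 * Y\<^sup>2) * (J2 * P2\<^sup>2)"
    have R0: "0 \<le> R" using J1 J2 by (simp add: R_def)
    have nn: "(\<integral>\<^sup>+ \<xi>. ennreal ((norm (?h \<xi>))\<^sup>2) \<partial>lebesgue) \<le> ennreal R"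
    proof -
      have "(\<integral>\<^sup>+ \<xi>. ennreal ((norm (?h \<xi>))\<^sup>2) \<partial>lebesgue)
        \<le> (\<integral>\<^sup>+ \<xi>. ennreal ((2 * D\<^sup>2 * X\<^sup>2) * ?G1 \<xi> + (2 * D\<^sup>2 * Y\<^sup>2) * ?G2 \<xi>) \<partial>lebesgue)"
        by (rule nn_integral_mono_AE, rule eventually_mono[OF bound], rule ennreal_leI)
      also have "\<dots> = (\<integral>\<^sup>+ \<xi>. ennreal (2 * D\<^sup>2 * X\<^sup>2) * ennreal (?G1 \<xi>) + ennreal (2 * D\<^sup>2 * Y\<^sup>2) * ennreal (?G2
          \<xi>) \<partial>lborel)"
        unfolding nn_integral_completion by (simp add: ennreal_mult ennreal_plus)
      also have "\<dots> = ennreal (2 * D\<^sup>2 * X\<^sup>2) * (\<integral>\<^sup>+ \<xi>. ennreal (?G1 \<xi>) \<partial>lborel)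
           + ennreal (2 * D\<^sup>2 * Y\<^sup>2) * (\<integral>\<^sup>+ \<xi>. ennreal (?G2 \<xi>) \<partial>lborel)"
        by (simp add: nn_integral_add nn_integral_cmult)
      also have "\<dots> = ennreal (2 * D\<^sup>2 * X\<^sup>2) * ennreal (J1 * P1\<^sup>2) + ennreal (2 * D\<^sup>2 * Y\<^sup>2) * ennreal (J2 * P2\<^sup>2)"
        using t by (simp only: J1(2) J2(2) P1 P2 add_pos_nonneg[OF zero_less_one])
      also have "\<dots> = ennreal R"
        unfolding R_def using J1(1) J2(1) by (simp add: ennreal_mult ennreal_plus)
      finally show ?thesis .
    qed
    have int: "integrable lebesgue (\<lambda>\<xi>. (norm (?h \<xi>))\<^sup>2)"
    proof (rule integrableI_nonneg)
      show "(\<lambda>\<xi>. (norm (?h \<xi>))\<^sup>2) \<in> borel_measurable lebesgue" using mh by measurable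
      show "(\<integral>\<^sup>+ \<xi>. ennreal ((norm (?h \<xi>))\<^sup>2) \<partial>lebesgue) < \<infinity>"
        using nn by (rule order.strict_trans1) simp
    qed simp
    have "L2_fun ?h" using mh int by (simp add: L2_fun_def)
    then have Hdot: "Hdot_fun s0 f" using f unfolding Hdot_fun_def by blast
    have "(LINT \<xi>|lebesgue. (norm (?h \<xi>))\<^sup>2) \<le> R"
      using nn R0 by (subst integral_eq_nn_integral) (use int in \<open>auto intro: enn2real_leI\<close>)
    moreover have "(LINT \<xi>|lebesgue. (norm (lap_symbol (s0 / 2) \<xi> *\<^sub>R fourier_L2 f \<xi>))\<^sup>2)
        = (LINT \<xi>|lebesgue. (norm (?h \<xi>))\<^sup>2)"
    proof (rule integral_cong_AE)
      have ff: "has_fourier_L2 f (fourier_L2 f)" by (rule has_fourier_L2_fourier_L2[OF f])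
      then have "fourier_L2 f \<in> borel_measurable lebesgue" by (auto simp: has_fourier_L2_def L2_fun_def)
      then have "(\<lambda>\<xi>. lap_symbol (s0 / 2) \<xi> *\<^sub>R fourier_L2 f \<xi>) \<in> borel_measurable lebesgue"
        by (intro borel_measurable_scaleR measurable_lap_symbol)
      then show "(\<lambda>\<xi>. (norm (lap_symbol (s0 / 2) \<xi> *\<^sub>R fourier_L2 f \<xi>))\<^sup>2) \<in> borel_measurable lebesgue" by measurable
      show "AE \<xi> in lebesgue. (norm (lap_symbol (s0 / 2) \<xi> *\<^sub>R fourier_L2 f \<xi>))\<^sup>2 = (norm (?h \<xi>))\<^sup>2"
        using has_fourier_L2_unique[OF ff f] by eventually_elim simp
    qed (use int in auto)
    ultimately have "Hdot_norm s0 f \<le> sqrt R" by (simp add: Hdot_norm_def L2_norm_def)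
    also have "\<dots> \<le> sqrt ((2 * D\<^sup>2 * X\<^sup>2) * (J1 * P1\<^sup>2)) + sqrt ((2 * D\<^sup>2 * Y\<^sup>2) * (J2 * P2\<^sup>2))"
      unfolding R_def by (rule sqrt_add_le_add_sqrt) (use J1 J2 in auto)
    also have "\<dots> = sqrt 2 * D * (sqrt J1 * (P1 * X) + sqrt J2 * (P2 * Y))"
      using D XY P0 by (simp add: real_sqrt_mult algebra_simps)
    also have "\<dots> \<le> 2 * D * (sqrt J1 * (P1 * X) + sqrt J2 * (P2 * Y))"
      using real_sqrt_le_mono[of 2 4] D XY P0 J1(1) J2(1) by (intro mult_right_mono) auto
    also have "\<dots> \<le> 2 * D * ((sqrt J1 + sqrt J2) * (P1 * X) + (sqrt J1 + sqrt J2) * (P2 * Y))"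
      using D XY P0 J1(1) J2(1) by (intro mult_left_mono add_mono mult_right_mono) auto
    also have "\<dots> = (2 * D * (sqrt J1 + sqrt J2)) * (P1 * X + P2 * Y)" by (simp add: algebra_simps)
    also have "\<dots> \<le> C * (P1 * X + P2 * Y)"
      using XY P0 by (intro mult_right_mono) (auto simp: C_def)
    finally show ?thesis using Hdot by (simp add: P1_def P2_def X_def Y_def)
  qed
  moreover have "0 < C" using D J1(1) J2(1) by (simp add: C_def add_pos_nonneg)
  ultimately show ?thesis using that[of C] by blast
qed

section \<open>From fixed frequencies to the profile estimates\<close>

lemma cutoff_bounded:
  fixes \<phi> :: "real^'n \<Rightarrow> real"
  assumes "cutoff_partition \<epsilon> N \<phi> \<chi>mid \<chi>ext"
  obtains B where "0 \<le> B" "\<And>\<xi>. \<bar>\<phi> \<xi>\<bar> \<le> B * indicator (cball 0 \<epsilon>) \<xi>"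
proof -
  have supp: "supp \<phi> \<subseteq> cball 0 \<epsilon>" and "smooth \<phi>" using assms by (auto simp: cutoff_partition_def)
  then have cont: "continuous_on UNIV \<phi>" unfolding smooth_def by (metis Ck.simps(1))
  have "compact (\<phi> ` cball 0 \<epsilon>)"
    by (intro compact_continuous_image continuous_on_subset[OF cont]) auto
  then obtain B where B: "\<And>\<xi>. \<xi> \<in> cball 0 \<epsilon> \<Longrightarrow> norm (\<phi> \<xi>) \<le> B"
    using compact_imp_bounded bounded_iff by (metis imageI)
  have "\<bar>\<phi> \<xi>\<bar> \<le> max 0 B * indicator (cball 0 \<epsilon>) \<xi>" for \<xi>
  proof (cases "\<xi> \<in> cball 0 \<epsilon>")
    case False
    then have "\<phi> \<xi> = 0" using supp closure_subset[of "{x. \<phi> x \<noteq> 0}"] by (auto simp: supp_def)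
    then show ?thesis by simp
  qed (use B in fastforce)
  then show ?thesis using that[of "max 0 B"] by auto
qed

lemma solves_system_pointwise:
  assumes "solves_system S A V0 v"
  obtains V where "\<And>t. 0 \<le> t \<Longrightarrow> AE \<xi> in lebesgue. fourier_L2 (v t) \<xi> = V t \<xi>"
    "AE \<xi> in lebesgue. \<xi> \<in> S \<longrightarrow> V 0 \<xi> = V0 \<xi> \<and> continuous_on {0..} (\<lambda>t. V t \<xi>) \<and>
       (\<forall>t>0. ((\<lambda>\<tau>. V \<tau> \<xi>) has_vector_derivative (A \<xi> *v V t \<xi>)) (at t))"
proof -
  obtain V where V: "\<And>t. 0 \<le> t \<Longrightarrow> has_fourier_L2 (v t) (V t)"
    "AE \<xi> in lebesgue. \<xi> \<in> S \<longrightarrow> V 0 \<xi> = V0 \<xi> \<and> continuous_on {0..} (\<lambda>t. V t \<xi>) \<and>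
       (\<forall>t>0. ((\<lambda>\<tau>. V \<tau> \<xi>) has_vector_derivative (A \<xi> *v V t \<xi>)) (at t))"
    using assms unfolding solves_system_def by blast
  have "AE \<xi> in lebesgue. fourier_L2 (v t) \<xi> = V t \<xi>" if "0 \<le> t" for t
    by (rule has_fourier_L2_unique[OF has_fourier_L2_fourier_L2[OF V(1)[OF that]] V(1)[OF that]])
  with V(2) show ?thesis using that by blast
qed

text \<open>The part of the argument that is common to both cases: an estimate for the ordinary differential equations at
every single frequency in the ball gives the estimate for the profile. The initial data \<open>Vin\<close> and the set \<open>S\<close> of
frequencies of the reference system, and the matrices \<open>P\<close> that turn it into the profile, are arbitrary.\<close>

lemma profile_error_bound:
  fixes \<phi> :: "real^'n \<Rightarrow> real" and P :: "real^'n \<Rightarrow> complex^3^3"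
  assumes \<beta>: "0 < \<beta>" and c: "0 < c" and g: "0 \<le> g" and s0: "0 \<le> s0" and \<kappa>: "0 \<le> \<kappa>" "\<kappa> \<le> 1"
    and \<epsilon>: "0 \<le> \<epsilon>" and K: "0 \<le> K" and part: "cutoff_partition \<epsilon> N \<phi> \<chi>mid \<chi>ext"
    and pointwise: "\<And>\<xi> w0 W V t. \<xi> \<noteq> 0 \<Longrightarrow> norm \<xi> \<le> \<epsilon> \<Longrightarrow> L1_weighted \<kappa> w0 \<Longrightarrow> W 0 = fourier w0 \<xi> \<Longrightarrow> V 0 = Vin w0 \<xi> \<Longrightarrow>
       continuous_on {0..} W \<Longrightarrow> continuous_on {0..} V \<Longrightarrow>
       (\<And>t. t > 0 \<Longrightarrow> (W has_vector_derivative A \<xi> *v W t) (at t)) \<Longrightarrow>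
       (\<And>t. t > 0 \<Longrightarrow> (V has_vector_derivative A' \<xi> *v V t) (at t)) \<Longrightarrow> 0 \<le> t \<Longrightarrow>
       norm (W t - P \<xi> *v V t) \<le> K * norm \<xi> powr g * exp (- c * norm \<xi> powr \<beta> * t) * norm (fourier w0 \<xi>)"
  obtains C where "0 < C"
    "\<And>w0 w v u Q t. L1_weighted \<kappa> w0 \<Longrightarrow> solves_system UNIV A (fourier w0) w \<Longrightarrow>
       solves_system S A' (Vin w0) v \<Longrightarrow> supp \<phi> \<subseteq> S \<Longrightarrow> \<forall>t\<ge>0. is_multiplier \<phi> (w t) (u t) \<Longrightarrow>
       \<forall>t\<ge>0. has_fourier_L2 (Q t) (\<lambda>\<xi>. \<phi> \<xi> *\<^sub>R (P \<xi> *v fourier_L2 (v t) \<xi>)) \<Longrightarrow> 0 \<le> t \<Longrightarrow>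
       Hdot_fun s0 (\<lambda>x. u t x - Q t x) \<and> Hdot_norm s0 (\<lambda>x. u t x - Q t x) \<le> C *
         ((1 + t) powr (- (real CARD('n) + 2 * (s0 + \<kappa> + g)) / (2 * \<beta>)) * L1_weighted_norm \<kappa> w0
        + (1 + t) powr (- (real CARD('n) + 2 * (s0 + g)) / (2 * \<beta>)) * norm (total_mass w0))"
proof -
  obtain B where B: "0 \<le> B" "\<And>\<xi>. \<bar>\<phi> \<xi>\<bar> \<le> B * indicator (cball 0 \<epsilon>) \<xi>" using cutoff_bounded[OF part] by blast
  obtain C where C: "0 < C"
    "\<And>(f :: real^'n \<Rightarrow> complex^3) F w0 t. 0 \<le> t \<Longrightarrow> has_fourier_L2 f F \<Longrightarrow> L1_weighted \<kappa> w0 \<Longrightarrow>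
       (AE \<xi> in lebesgue. norm (F \<xi>) \<le> indicator (cball 0 \<epsilon>) \<xi> *
          (B * K * norm \<xi> powr g * exp (- c * norm \<xi> powr \<beta> * t) * norm (fourier w0 \<xi>))) \<Longrightarrow>
       Hdot_fun s0 f \<and> Hdot_norm s0 f \<le> C *
         ((1 + t) powr (- (real CARD('n) + 2 * (s0 + \<kappa> + g)) / (2 * \<beta>)) * L1_weighted_norm \<kappa> w0
        + (1 + t) powr (- (real CARD('n) + 2 * (s0 + g)) / (2 * \<beta>)) * norm (total_mass w0))"
    using low_frequency_bound[OF \<beta> c g s0 \<kappa> \<epsilon> mult_nonneg_nonneg[OF B(1) K]] by blast
  show ?thesis
  proof (rule that[OF C(1)])
    fix w0 :: "real^'n \<Rightarrow> complex^3" and w v u Q :: "real \<Rightarrow> real^'n \<Rightarrow> complex^3" and t :: real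
    assume w0: "L1_weighted \<kappa> w0" and w: "solves_system UNIV A (fourier w0) w"
      and v: "solves_system S A' (Vin w0) v" and S: "supp \<phi> \<subseteq> S" and u: "\<forall>t\<ge>0. is_multiplier \<phi> (w t) (u t)"
      and Q: "\<forall>t\<ge>0. has_fourier_L2 (Q t) (\<lambda>\<xi>. \<phi> \<xi> *\<^sub>R (P \<xi> *v fourier_L2 (v t) \<xi>))" and t: "0 \<le> t"
    obtain W where W1: "\<And>t. 0 \<le> t \<Longrightarrow> AE \<xi> in lebesgue. fourier_L2 (w t) \<xi> = W t \<xi>"
      and W2: "AE \<xi> in lebesgue. \<xi> \<in> UNIV \<longrightarrow> W 0 \<xi> = fourier w0 \<xi> \<and> continuous_on {0..} (\<lambda>t. W t \<xi>) \<and>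
       (\<forall>t>0. ((\<lambda>\<tau>. W \<tau> \<xi>) has_vector_derivative (A \<xi> *v W t \<xi>)) (at t))"
      using solves_system_pointwise[OF w] by blast
    obtain V where V1: "\<And>t. 0 \<le> t \<Longrightarrow> AE \<xi> in lebesgue. fourier_L2 (v t) \<xi> = V t \<xi>"
      and V2: "AE \<xi> in lebesgue. \<xi> \<in> S \<longrightarrow> V 0 \<xi> = Vin w0 \<xi> \<and> continuous_on {0..} (\<lambda>t. V t \<xi>) \<and>
       (\<forall>t>0. ((\<lambda>\<tau>. V \<tau> \<xi>) has_vector_derivative (A' \<xi> *v V t \<xi>)) (at t))"
      using solves_system_pointwise[OF v] by blast
    have "AE \<xi> in lebesgue. norm (\<phi> \<xi> *\<^sub>R fourier_L2 (w t) \<xi> - \<phi> \<xi> *\<^sub>R (P \<xi> *v fourier_L2 (v t) \<xi>))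
       \<le> indicator (cball 0 \<epsilon>) \<xi> * (B * K * norm \<xi> powr g * exp (- c * norm \<xi> powr \<beta> * t) * norm (fourier w0 \<xi>))"
      using W1[OF t] W2 V1[OF t] V2 AE_lebesgue_nonzero
    proof eventually_elim
      case (elim \<xi>)
      show ?case
      proof (cases "\<phi> \<xi> = 0")
        case True
        then show ?thesis using B(1) K by (auto intro!: mult_nonneg_nonneg)
      next
        case False
        then have "\<xi> \<in> S" using S closure_subset[of "{x. \<phi> x \<noteq> 0}"] by (auto simp: supp_def)
        moreover have "\<xi> \<in> cball 0 \<epsilon>" using B(2)[of \<xi>] False by (cases "norm \<xi> \<le> \<epsilon>") auto
        ultimately have pw: "norm (W t \<xi> - P \<xi> *v V t \<xi>)
            \<le> K * norm \<xi> powr g * exp (- c * norm \<xi> powr \<beta> * t) * norm (fourier w0 \<xi>)"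
          using elim w0 t by (intro pointwise[where W = "\<lambda>t. W t \<xi>" and V = "\<lambda>t. V t \<xi>"]) auto
        have "norm (\<phi> \<xi> *\<^sub>R fourier_L2 (w t) \<xi> - \<phi> \<xi> *\<^sub>R (P \<xi> *v fourier_L2 (v t) \<xi>))
            = \<bar>\<phi> \<xi>\<bar> * norm (W t \<xi> - P \<xi> *v V t \<xi>)"
          using elim by (simp add: scaleR_diff_right[symmetric])
        also have "\<dots> \<le> (B * indicator (cball 0 \<epsilon>) \<xi>) * (K * norm \<xi> powr g * exp (- c * norm \<xi> powr \<beta> * t) * norm
            (fourier w0 \<xi>))"
          using pw B by (intro mult_mono) auto
        finally show ?thesis by (simp add: mult_ac)
      qed
    qed
    moreover have "has_fourier_L2 (\<lambda>x. u t x - Q t x) (\<lambda>\<xi>. \<phi> \<xi> *\<^sub>R fourier_L2 (w t) \<xi> - \<phi> \<xi> *\<^sub>R (P \<xi> *v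
        fourier_L2 (v t) \<xi>))"
      using u Q t unfolding is_multiplier_def by (intro has_fourier_L2_diff) auto
    ultimately show "Hdot_fun s0 (\<lambda>x. u t x - Q t x) \<and> Hdot_norm s0 (\<lambda>x. u t x - Q t x) \<le> C *
         ((1 + t) powr (- (real CARD('n) + 2 * (s0 + \<kappa> + g)) / (2 * \<beta>)) * L1_weighted_norm \<kappa> w0
        + (1 + t) powr (- (real CARD('n) + 2 * (s0 + g)) / (2 * \<beta>)) * norm (total_mass w0))"
      by (intro C(2)[OF t _ w0])
  qed
qed

lemma small_radius:
  fixes g \<delta>0 :: real
  assumes "0 < g" "0 < \<delta>0"
  obtains \<epsilon>0 where "0 < \<epsilon>0" "\<epsilon>0 \<le> 1" "\<And>r. 0 \<le> r \<Longrightarrow> r \<le> \<epsilon>0 \<Longrightarrow> r powr g \<le> \<delta>0"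
proof -
  define \<epsilon>0 where "\<epsilon>0 = min 1 (\<delta>0 powr (1 / g))"
  have "r powr g \<le> \<delta>0" if "0 \<le> r" "r \<le> \<epsilon>0" for r
  proof -
    have "r powr g \<le> (\<delta>0 powr (1 / g)) powr g" using that assms by (intro powr_mono2) (auto simp: \<epsilon>0_def)
    also have "\<dots> = \<delta>0" using assms by (simp add: powr_powr)
    finally show ?thesis .
  qed
  then show ?thesis using that[of \<epsilon>0] assms by (auto simp: \<epsilon>0_def)
qed

text \<open>Here \<open>p\<close> is \<open>r\<close> to the power \<open>2\<sigma>\<alpha>\<close> and \<open>\<delta>\<close> is \<open>r\<close> to the power
\<open>g = \<sigma> - 2\<sigma>\<alpha>\<close>, where \<open>r = |\<xi>|\<close>; then \<open>p \<delta>\<^sup>2\<close> is \<open>r\<close> to the power \<open>\<beta> = 2\<sigma> - 2\<sigma>\<alpha>\<close>,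
    and \<open>g/\<beta>\<close> is the additional decay rate. The radius \<open>\<epsilon>\<^sub>0\<close> makes \<open>\<delta>\<close> small enough both for
\<open>frequency_error_lt\<close> and for the invertibility of \<open>I + M2\<close>.\<close>

lemma asymptotic_profile_lt:
  fixes \<sigma> \<alpha> :: real
  assumes \<sigma>: "1 \<le> \<sigma>" and \<alpha>: "0 \<le> \<alpha>" "\<alpha> < 1/2"
  shows "\<exists>\<epsilon>0>0. \<forall>\<epsilon> N (\<chi>int :: real^'n \<Rightarrow> real) \<chi>mid \<chi>ext.
          0 < \<epsilon> \<and> \<epsilon> \<le> \<epsilon>0 \<and> 1 \<le> N \<and> cutoff_partition \<epsilon> N \<chi>int \<chi>mid \<chi>ext \<longrightarrow>
          (\<forall>s s0 \<kappa>. 0 \<le> s \<and> 0 \<le> s0 \<and> s0 \<le> s \<and> 0 \<le> \<kappa> \<and> \<kappa> \<le> 1 \<longrightarrow>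
            (\<exists>C>0. \<forall>w0 w u wt Q.
               Hs_fun s w0 \<and> L1_weighted \<kappa> w0 \<and> is_solution \<sigma> \<alpha> w0 w \<and>
               (\<forall>t\<ge>0. is_multiplier \<chi>int (w t) (u t)) \<and>
               is_reference_lt (supp \<chi>int) \<sigma> \<alpha> w0 wt \<and> is_profile_lt \<chi>int \<sigma> \<alpha> wt Q \<longrightarrow>
               (\<forall>t\<ge>0.
                  Hdot_fun s0 (\<lambda>x. u t x - Q t x) \<and>
                  Hdot_norm s0 (\<lambda>x. u t x - Q t x) \<le>
                    C * ((1 + t) powr (- (real CARD('n) + 2 * (s0 + \<kappa>)) / (2 * (2 * \<sigma> - 2 * \<sigma> * \<alpha>))
                                       - (1 - 2 * \<alpha>) / (2 * (1 - \<alpha>))) * L1_weighted_norm \<kappa> w0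
                       + (1 + t) powr (- (real CARD('n) + 2 * s0) / (2 * (2 * \<sigma> - 2 * \<sigma> * \<alpha>))
                                       - (1 - 2 * \<alpha>) / (2 * (1 - \<alpha>))) * norm (total_mass w0)))))"
proof -
  define g where "g = \<sigma> - 2 * \<sigma> * \<alpha>"
  define \<beta> where "\<beta> = 2 * \<sigma> - 2 * \<sigma> * \<alpha>"
  have g_eq: "g = \<sigma> * (1 - 2 * \<alpha>)" and \<beta>_eq: "\<beta> = 2 * \<sigma> * (1 - \<alpha>)" by (simp_all add: g_def \<beta>_def algebra_simps)
  have g: "0 < g" and \<beta>: "0 < \<beta>" unfolding g_eq \<beta>_eq using \<sigma> \<alpha> by simp_all
  obtain kN where kN: "1 \<le> kN" "\<And>v. norm (N3 *v v) \<le> kN * norm v" using matrix_bound[of N3] by blast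
  obtain kM where kM: "1 \<le> kM" "\<And>v. norm (M1 *v v) \<le> kM * norm v" using matrix_bound[of M1] by blast
  obtain kI where kI: "1 \<le> kI" "\<And>v. norm (matrix_inv M1 *v v) \<le> kI * norm v"
      using matrix_bound[of "matrix_inv M1"] by blast
  define k where "k = max kN (max kM kI)"
  have k1: "1 \<le> k" using kN by (simp add: k_def)
  have k: "norm (N3 *v v) \<le> k * norm v" "norm (M1 *v v) \<le> k * norm v" "norm (matrix_inv M1 *v v) \<le> k * norm v" for v
  proof -
    have "kN \<le> k" "kM \<le> k" "kI \<le> k" by (simp_all add: k_def)
    then have "kN * norm v \<le> k * norm v" "kM * norm v \<le> k * norm v" "kI * norm v \<le> k * norm v"
      by (simp_all add: mult_right_mono)
    then show "norm (N3 *v v) \<le> k * norm v" "norm (M1 *v v) \<le> k * norm v" "norm (matrix_inv M1 *v v) \<le> k * norm v"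
      using kN(2)[of v] kM(2)[of v] kI(2)[of v] by linarith+
  qed
  define K where "K = 200 * k ^ 3"
  have kK: "k \<le> K" using k1 self_le_power[of k 3] by (simp add: K_def)
  have K1: "1 \<le> K" using k1 kK by simp
  obtain \<epsilon>0 where \<epsilon>0: "0 < \<epsilon>0" "\<epsilon>0 \<le> 1" "\<And>r. 0 \<le> r \<Longrightarrow> r \<le> \<epsilon>0 \<Longrightarrow> r powr g \<le> 1 / (128 * K\<^sup>2)"
    using small_radius[OF g, of "1 / (128 * K\<^sup>2)"] K1 by auto
  let ?A = "\<lambda>\<xi> :: real^'n. lap_symbol (\<sigma> / 2) \<xi> *\<^sub>R D0 + lap_symbol (\<sigma> * \<alpha>) \<xi> *\<^sub>R D1"
  let ?A' = "\<lambda>\<xi> :: real^'n. - (lap_symbol (\<sigma> * \<alpha>) \<xi> *\<^sub>R Dt0 + lap_symbol \<sigma> \<xi> *\<^sub>R Dt1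
                + lap_symbol (\<sigma> - \<sigma> * \<alpha>) \<xi> *\<^sub>R Dt2)"
  let ?P = "\<lambda>\<xi> :: real^'n. M1 ** (mat 1 + M2 \<sigma> \<alpha> (norm \<xi>))"
  let ?V0 = "\<lambda>w0 (\<xi> :: real^'n). (matrix_inv (mat 1 + M2 \<sigma> \<alpha> (norm \<xi>)) ** matrix_inv M1) *v fourier w0 \<xi>"
  have pointwise: "norm (W t - ?P \<xi> *v V t) \<le> 55000 * K\<^sup>2 * norm \<xi> powr g * exp (- (1/2) * norm \<xi> powr \<beta> * t) *
      norm (fourier w0 \<xi>)"
    if \<xi>: "\<xi> \<noteq> 0" "norm \<xi> \<le> \<epsilon>0" and W0: "W 0 = fourier w0 \<xi>" and V0: "V 0 = ?V0 w0 \<xi>"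
      and cW: "continuous_on {0..} W" and cV: "continuous_on {0..} V"
      and dW: "\<And>t. t > 0 \<Longrightarrow> (W has_vector_derivative ?A \<xi> *v W t) (at t)"
      and dV: "\<And>t. t > 0 \<Longrightarrow> (V has_vector_derivative ?A' \<xi> *v V t) (at t)" and t: "0 \<le> t"
    for \<xi> :: "real^'n" and w0 W V t
  proof -
    define r where "r = norm \<xi>"
    define p where "p = r powr (2 * (\<sigma> * \<alpha>))"
    define \<delta> where "\<delta> = r powr g"
    have r: "0 < r" "r \<le> 1" using \<xi> \<epsilon>0(2) by (simp_all add: r_def)
    have p: "0 < p" and \<delta>: "0 < \<delta>" using r by (simp_all add: p_def \<delta>_def)
    have p\<delta>: "p * \<delta> = r powr \<sigma>" unfolding p_def \<delta>_def powr_add[symmetric] by (simp add: g_def algebra_simps)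
    have p\<delta>\<delta>: "p * \<delta>\<^sup>2 = r powr \<beta>"
      unfolding p_def \<delta>_def power2_eq_square powr_add[symmetric] by (simp add: g_def \<beta>_def algebra_simps)
    have small: "128 * K\<^sup>2 * \<delta> \<le> 1" using \<epsilon>0(3)[of r] \<xi> K1 r by (simp add: r_def \<delta>_def field_simps)
    have lap: "lap_symbol (\<sigma> * \<alpha>) \<xi> = p" "lap_symbol (\<sigma> / 2) \<xi> = p * \<delta>" "lap_symbol (\<sigma> - \<sigma> * \<alpha>) \<xi> = p * \<delta>\<^sup>2"
      unfolding p\<delta> p\<delta>\<delta> using \<xi> by (simp_all add: lap_symbol_eq p_def r_def \<beta>_def algebra_simps)
    have lap\<sigma>: "0 \<le> lap_symbol \<sigma> \<xi>" "lap_symbol \<sigma> \<xi> \<le> p * \<delta>"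
      unfolding p\<delta> using \<xi> r \<sigma> by (simp_all add: lap_symbol_eq r_def powr_mono')
    have M2: "M2 \<sigma> \<alpha> (norm \<xi>) = \<delta> *\<^sub>R N3" by (simp add: M2_eq \<delta>_def r_def g_def)
    have \<delta>k: "\<delta> * k \<le> 1/2"
    proof -
      have "\<delta> * k \<le> \<delta> * K\<^sup>2" using kK K1 \<delta> self_le_power[of K 2] by (intro mult_left_mono) auto
      then show ?thesis using small by (simp add: mult.commute)
    qed
    have inv: "invertible (mat 1 + \<delta> *\<^sub>R N3)" by (rule invertible_near_identity[OF k(1) _ \<delta>k]) (use \<delta> in simp)
    have init: "M1 *v ((mat 1 + \<delta> *\<^sub>R N3) *v V 0) = W 0"
      unfolding V0 M2 W0 matrix_vector_mul_assoc[symmetric]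
      by (simp only: matrix_inv_mult_right[OF inv] matrix_inv_mult_right[OF M1_invertible])
    have "norm (W t - M1 *v ((mat 1 + \<delta> *\<^sub>R N3) *v V t))
        \<le> 55000 * (200 * k ^ 3)\<^sup>2 * \<delta> * exp (- (p * \<delta>\<^sup>2 / 2) * t) * norm (W 0)"
      by (rule frequency_error_lt[OF k1 k p \<delta> small[unfolded K_def] lap\<sigma> cW cV dW[unfolded lap] dV[unfolded lap]
          init t])
    then show ?thesis
      unfolding p\<delta>\<delta> W0 M2 K_def[symmetric] matrix_vector_mul_assoc[symmetric] by (simp add: \<delta>_def r_def)
  qed
  have exponent: "- (real CARD('n) + 2 * (x + g)) / (2 * \<beta>)
      = - (real CARD('n) + 2 * x) / (2 * (2 * \<sigma> - 2 * \<sigma> * \<alpha>)) - (1 - 2 * \<alpha>) / (2 * (1 - \<alpha>))" for x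
  proof -
    have "2 * g / (2 * \<beta>) = (1 - 2 * \<alpha>) / (2 * (1 - \<alpha>))" 
      using mult_divide_mult_cancel_left[of "2 * \<sigma>" "1 - 2 * \<alpha>" "2 * (1 - \<alpha>)"] \<sigma> unfolding g_eq \<beta>_eq
          by (simp only: mult_ac)
    moreover have "- (real CARD('n) + 2 * (x + g)) / (2 * \<beta>) = - (real CARD('n) + 2 * x) / (2 * \<beta>) - 2 * g / (2 * \<beta>)"
      unfolding diff_divide_distrib[symmetric] by (simp add: algebra_simps)
    ultimately show ?thesis unfolding \<beta>_def by simp
  qed
  show ?thesis
  proof (rule exI[of _ \<epsilon>0], rule conjI, rule \<epsilon>0(1), intro allI impI, elim conjE)
    fix \<epsilon> N s s0 \<kappa> :: real and \<chi>int \<chi>mid \<chi>ext :: "real^'n \<Rightarrow> real"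
    assume \<epsilon>: "0 < \<epsilon>" "\<epsilon> \<le> \<epsilon>0" and part: "cutoff_partition \<epsilon> N \<chi>int \<chi>mid \<chi>ext"
      and s0: "0 \<le> s0" and \<kappa>: "0 \<le> \<kappa>" "\<kappa> \<le> 1"
    obtain C where C: "0 < C" "\<And>w0 w v u Q t. L1_weighted \<kappa> w0 \<Longrightarrow> solves_system UNIV ?A (fourier w0) w \<Longrightarrow>
       solves_system (supp \<chi>int) ?A' (?V0 w0) v \<Longrightarrow> supp \<chi>int \<subseteq> supp \<chi>int \<Longrightarrow> \<forall>t\<ge>0. is_multiplier \<chi>int (w t) (u t) \<Longrightarrow>
       \<forall>t\<ge>0. has_fourier_L2 (Q t) (\<lambda>\<xi>. \<chi>int \<xi> *\<^sub>R (?P \<xi> *v fourier_L2 (v t) \<xi>)) \<Longrightarrow> 0 \<le> t \<Longrightarrow>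
       Hdot_fun s0 (\<lambda>x. u t x - Q t x) \<and> Hdot_norm s0 (\<lambda>x. u t x - Q t x) \<le> C *
         ((1 + t) powr (- (real CARD('n) + 2 * (s0 + \<kappa> + g)) / (2 * \<beta>)) * L1_weighted_norm \<kappa> w0
        + (1 + t) powr (- (real CARD('n) + 2 * (s0 + g)) / (2 * \<beta>)) * norm (total_mass w0))"
    proof (rule profile_error_bound[OF \<beta> _ less_imp_le[OF g] s0 \<kappa> less_imp_le[OF \<epsilon>(1)] _ part,
          where A = ?A and A' = ?A' and P = ?P and Vin = ?V0 and c = "1/2" and K = "55000 * K\<^sup>2" and S = "supp \<chi>int"])
      show "norm (W t - ?P \<xi> *v V t) \<le> 55000 * K\<^sup>2 * norm \<xi> powr g * exp (- (1/2) * norm \<xi> powr \<beta> * t) * norm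
          (fourier w0 \<xi>)"
        if "\<xi> \<noteq> 0" "norm \<xi> \<le> \<epsilon>" "L1_weighted \<kappa> w0" "W 0 = fourier w0 \<xi>" "V 0 = ?V0 w0 \<xi>"
          "continuous_on {0..} W" "continuous_on {0..} V"
          "\<And>t. t > 0 \<Longrightarrow> (W has_vector_derivative ?A \<xi> *v W t) (at t)"
          "\<And>t. t > 0 \<Longrightarrow> (V has_vector_derivative ?A' \<xi> *v V t) (at t)" "0 \<le> t" for \<xi> w0 W V t
        using pointwise[of \<xi> W w0 V t] that \<epsilon>(2) by simp
    qed auto
    show "\<exists>C>0. \<forall>w0 w u wt Q.
               Hs_fun s w0 \<and> L1_weighted \<kappa> w0 \<and> is_solution \<sigma> \<alpha> w0 w \<and>
               (\<forall>t\<ge>0. is_multiplier \<chi>int (w t) (u t)) \<and>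
               is_reference_lt (supp \<chi>int) \<sigma> \<alpha> w0 wt \<and> is_profile_lt \<chi>int \<sigma> \<alpha> wt Q \<longrightarrow>
               (\<forall>t\<ge>0.
                  Hdot_fun s0 (\<lambda>x. u t x - Q t x) \<and>
                  Hdot_norm s0 (\<lambda>x. u t x - Q t x) \<le>
                    C * ((1 + t) powr (- (real CARD('n) + 2 * (s0 + \<kappa>)) / (2 * (2 * \<sigma> - 2 * \<sigma> * \<alpha>))
                                       - (1 - 2 * \<alpha>) / (2 * (1 - \<alpha>))) * L1_weighted_norm \<kappa> w0
                       + (1 + t) powr (- (real CARD('n) + 2 * s0) / (2 * (2 * \<sigma> - 2 * \<sigma> * \<alpha>))
                                       - (1 - 2 * \<alpha>) / (2 * (1 - \<alpha>))) * norm (total_mass w0)))"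
      unfolding is_solution_def is_reference_lt_def is_profile_lt_def exponent[symmetric]
      using C by (intro exI[of _ C]) blast
  qed
qed

text \<open>The roles of the two powers are exchanged: \<open>|\<xi>|\<^sup>\<sigma>\<close> dominates, \<open>g = 2\<sigma>\<alpha> - \<sigma>\<close>, and the slow
rate is \<open>|\<xi>|\<close> to the power \<open>\<beta> = 2\<sigma>\<alpha>\<close>.\<close>

lemma asymptotic_profile_gt:
  fixes \<sigma> \<alpha> :: real
  assumes \<sigma>: "1 \<le> \<sigma>" and \<alpha>: "1/2 < \<alpha>"
  shows "\<exists>\<epsilon>0>0. \<forall>\<epsilon> N (\<chi>int :: real^'n \<Rightarrow> real) \<chi>mid \<chi>ext.
          0 < \<epsilon> \<and> \<epsilon> \<le> \<epsilon>0 \<and> 1 \<le> N \<and> cutoff_partition \<epsilon> N \<chi>int \<chi>mid \<chi>ext \<longrightarrow>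
          (\<forall>s s0 \<kappa>. 0 \<le> s \<and> 0 \<le> s0 \<and> s0 \<le> s \<and> 0 \<le> \<kappa> \<and> \<kappa> \<le> 1 \<longrightarrow>
            (\<exists>C>0. \<forall>w0 w u wb Q.
               Hs_fun s w0 \<and> L1_weighted \<kappa> w0 \<and> is_solution \<sigma> \<alpha> w0 w \<and>
               (\<forall>t\<ge>0. is_multiplier \<chi>int (w t) (u t)) \<and>
               is_reference_gt \<sigma> \<alpha> w0 wb \<and> is_profile_gt \<chi>int wb Q \<longrightarrow>
               (\<forall>t\<ge>0.
                  Hdot_fun s0 (\<lambda>x. u t x - Q t x) \<and>
                  Hdot_norm s0 (\<lambda>x. u t x - Q t x) \<le>
                    C * ((1 + t) powr (- (real CARD('n) + 2 * (s0 + \<kappa>)) / (4 * \<sigma> * \<alpha>)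
                                       - (2 * \<alpha> - 1) / (2 * \<alpha>)) * L1_weighted_norm \<kappa> w0
                       + (1 + t) powr (- (real CARD('n) + 2 * s0) / (4 * \<sigma> * \<alpha>)
                                       - (2 * \<alpha> - 1) / (2 * \<alpha>)) * norm (total_mass w0)))))"
proof -
  define g where "g = 2 * \<sigma> * \<alpha> - \<sigma>"
  define \<beta> where "\<beta> = 2 * \<sigma> * \<alpha>"
  have g_eq: "g = \<sigma> * (2 * \<alpha> - 1)" by (simp add: g_def algebra_simps)
  have g: "0 < g" and \<beta>: "0 < \<beta>" unfolding g_eq \<beta>_def using \<sigma> \<alpha> by simp_all
  obtain \<epsilon>0 where \<epsilon>0: "0 < \<epsilon>0" "\<And>r. 0 \<le> r \<Longrightarrow> r \<le> \<epsilon>0 \<Longrightarrow> r powr g \<le> 1 / 512"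
    using small_radius[OF g, of "1 / 512"] by auto
  let ?A = "\<lambda>\<xi> :: real^'n. lap_symbol (\<sigma> / 2) \<xi> *\<^sub>R D0 + lap_symbol (\<sigma> * \<alpha>) \<xi> *\<^sub>R D1"
  let ?A' = "\<lambda>\<xi> :: real^'n. - (lap_symbol (\<sigma> / 2) \<xi> *\<^sub>R Db0 + lap_symbol (\<sigma> * \<alpha>) \<xi> *\<^sub>R Db1)"
  let ?V0 = "\<lambda>w0 :: real^'n \<Rightarrow> complex^3. fourier (\<lambda>x. matrix_inv M4 *v w0 x)"
  have pointwise: "norm (W t - M4 *v V t) \<le> 29988 * norm \<xi> powr g * exp (- (1/2) * norm \<xi> powr \<beta> * t) * norm
      (fourier w0 \<xi>)"
    if \<xi>: "\<xi> \<noteq> 0" "norm \<xi> \<le> \<epsilon>0" and w0: "integrable lebesgue w0" and W0: "W 0 = fourier w0 \<xi>" and V0: "V 0 = ?V0 w0 \<xi>"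
      and cW: "continuous_on {0..} W" and cV: "continuous_on {0..} V"
      and dW: "\<And>t. t > 0 \<Longrightarrow> (W has_vector_derivative ?A \<xi> *v W t) (at t)"
      and dV: "\<And>t. t > 0 \<Longrightarrow> (V has_vector_derivative ?A' \<xi> *v V t) (at t)" and t: "0 \<le> t"
    for \<xi> :: "real^'n" and w0 W V t
  proof -
    define r where "r = norm \<xi>"
    define q where "q = r powr \<sigma>"
    define \<delta> where "\<delta> = r powr g"
    have r: "0 < r" using \<xi> by (simp add: r_def)
    have q: "0 < q" and \<delta>: "0 < \<delta>" "\<delta> \<le> 1 / 512" using r \<epsilon>0(2)[of r] \<xi> by (simp_all add: q_def \<delta>_def r_def)
    have q\<delta>: "q * \<delta> = r powr \<beta>" unfolding q_def \<delta>_def powr_add[symmetric] by (simp add: g_def \<beta>_def)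
    have lap: "lap_symbol (\<sigma> / 2) \<xi> = q" "lap_symbol (\<sigma> * \<alpha>) \<xi> = q * \<delta>"
      unfolding q\<delta> using \<xi> by (simp_all add: lap_symbol_eq q_def r_def \<beta>_def mult.assoc)
    have init: "M4 *v V 0 = W 0"
      unfolding V0 W0 fourier_matrix[OF w0] by (rule matrix_inv_mult_right[OF M4_invertible])
    have "norm (W t - M4 *v V t) \<le> 29988 * \<delta> * exp (- (q * \<delta> / 2) * t) * norm (W 0)"
      by (rule frequency_error_gt[OF q \<delta> cW cV dW[unfolded lap] dV[unfolded lap] init t])
    then show ?thesis unfolding q\<delta> W0 by (simp add: \<delta>_def r_def)
  qed
  have exponent: "- (real CARD('n) + 2 * (x + g)) / (2 * \<beta>)
      = - (real CARD('n) + 2 * x) / (4 * \<sigma> * \<alpha>) - (2 * \<alpha> - 1) / (2 * \<alpha>)" for x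
  proof -
    have "2 * g / (2 * \<beta>) = (2 * \<alpha> - 1) / (2 * \<alpha>)" 
      using mult_divide_mult_cancel_left[of "2 * \<sigma>" "2 * \<alpha> - 1" "2 * \<alpha>"] \<sigma> unfolding g_eq \<beta>_def by (simp only: mult_ac)
    moreover have "- (real CARD('n) + 2 * (x + g)) / (2 * \<beta>) = - (real CARD('n) + 2 * x) / (2 * \<beta>) - 2 * g / (2 * \<beta>)"
      unfolding diff_divide_distrib[symmetric] by (simp add: algebra_simps)
    ultimately show ?thesis unfolding \<beta>_def by simp
  qed
  show ?thesis
  proof (rule exI[of _ \<epsilon>0], rule conjI, rule \<epsilon>0(1), intro allI impI, elim conjE)
    fix \<epsilon> N s s0 \<kappa> :: real and \<chi>int \<chi>mid \<chi>ext :: "real^'n \<Rightarrow> real"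
    assume \<epsilon>: "0 < \<epsilon>" "\<epsilon> \<le> \<epsilon>0" and part: "cutoff_partition \<epsilon> N \<chi>int \<chi>mid \<chi>ext"
      and s0: "0 \<le> s0" and \<kappa>: "0 \<le> \<kappa>" "\<kappa> \<le> 1"
    obtain C where C: "0 < C" "\<And>w0 w v u Q t. L1_weighted \<kappa> w0 \<Longrightarrow> solves_system UNIV ?A (fourier w0) w \<Longrightarrow>
       solves_system UNIV ?A' (?V0 w0) v \<Longrightarrow> supp \<chi>int \<subseteq> UNIV \<Longrightarrow> \<forall>t\<ge>0. is_multiplier \<chi>int (w t) (u t) \<Longrightarrow>
       \<forall>t\<ge>0. has_fourier_L2 (Q t) (\<lambda>\<xi>. \<chi>int \<xi> *\<^sub>R (M4 *v fourier_L2 (v t) \<xi>)) \<Longrightarrow> 0 \<le> t \<Longrightarrow>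
       Hdot_fun s0 (\<lambda>x. u t x - Q t x) \<and> Hdot_norm s0 (\<lambda>x. u t x - Q t x) \<le> C *
         ((1 + t) powr (- (real CARD('n) + 2 * (s0 + \<kappa> + g)) / (2 * \<beta>)) * L1_weighted_norm \<kappa> w0
        + (1 + t) powr (- (real CARD('n) + 2 * (s0 + g)) / (2 * \<beta>)) * norm (total_mass w0))"
    proof (rule profile_error_bound[OF \<beta> _ less_imp_le[OF g] s0 \<kappa> less_imp_le[OF \<epsilon>(1)] _ part,
          where A = ?A and A' = ?A' and P = "\<lambda>_. M4" and Vin = ?V0 and c = "1/2" and K = 29988 and S = UNIV])
      show "norm (W t - M4 *v V t) \<le> 29988 * norm \<xi> powr g * exp (- (1/2) * norm \<xi> powr \<beta> * t) * norm (fourier w0 \<xi>)"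
        if "\<xi> \<noteq> 0" "norm \<xi> \<le> \<epsilon>" "L1_weighted \<kappa> w0" "W 0 = fourier w0 \<xi>" "V 0 = ?V0 w0 \<xi>"
          "continuous_on {0..} W" "continuous_on {0..} V"
          "\<And>t. t > 0 \<Longrightarrow> (W has_vector_derivative ?A \<xi> *v W t) (at t)"
          "\<And>t. t > 0 \<Longrightarrow> (V has_vector_derivative ?A' \<xi> *v V t) (at t)" "0 \<le> t" for \<xi> w0 W V t
        using pointwise[of \<xi> w0 W V t] that \<epsilon>(2) L1_weighted_integrable[OF that(3) \<kappa>(1)] by simp
    qed auto
    show "\<exists>C>0. \<forall>w0 w u wb Q.
               Hs_fun s w0 \<and> L1_weighted \<kappa> w0 \<and> is_solution \<sigma> \<alpha> w0 w \<and>
               (\<forall>t\<ge>0. is_multiplier \<chi>int (w t) (u t)) \<and>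
               is_reference_gt \<sigma> \<alpha> w0 wb \<and> is_profile_gt \<chi>int wb Q \<longrightarrow>
               (\<forall>t\<ge>0.
                  Hdot_fun s0 (\<lambda>x. u t x - Q t x) \<and>
                  Hdot_norm s0 (\<lambda>x. u t x - Q t x) \<le>
                    C * ((1 + t) powr (- (real CARD('n) + 2 * (s0 + \<kappa>)) / (4 * \<sigma> * \<alpha>)
                                       - (2 * \<alpha> - 1) / (2 * \<alpha>)) * L1_weighted_norm \<kappa> w0
                       + (1 + t) powr (- (real CARD('n) + 2 * s0) / (4 * \<sigma> * \<alpha>)
                                       - (2 * \<alpha> - 1) / (2 * \<alpha>)) * norm (total_mass w0)))"
      unfolding is_solution_def is_reference_gt_def is_profile_gt_def exponent[symmetric]
      using C by (intro exI[of _ C]) blast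
  qed
qed

theorem theorem5p2:
  fixes \<sigma> :: real
  assumes "\<sigma> \<ge> 1"
  shows
    "(\<forall>\<alpha>. 0 \<le> \<alpha> \<and> \<alpha> < 1/2 \<longrightarrow>
       (\<exists>\<epsilon>0>0. \<forall>\<epsilon> N (\<chi>int :: real^'n \<Rightarrow> real) \<chi>mid \<chi>ext.
          0 < \<epsilon> \<and> \<epsilon> \<le> \<epsilon>0 \<and> 1 \<le> N \<and> cutoff_partition \<epsilon> N \<chi>int \<chi>mid \<chi>ext \<longrightarrow>
          (\<forall>s s0 \<kappa>. 0 \<le> s \<and> 0 \<le> s0 \<and> s0 \<le> s \<and> 0 \<le> \<kappa> \<and> \<kappa> \<le> 1 \<longrightarrow>
            (\<exists>C>0. \<forall>w0 w u wt Q.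
               Hs_fun s w0 \<and> L1_weighted \<kappa> w0 \<and> is_solution \<sigma> \<alpha> w0 w \<and>
               (\<forall>t\<ge>0. is_multiplier \<chi>int (w t) (u t)) \<and>
               is_reference_lt (supp \<chi>int) \<sigma> \<alpha> w0 wt \<and> is_profile_lt \<chi>int \<sigma> \<alpha> wt Q \<longrightarrow>
               (\<forall>t\<ge>0.
                  Hdot_fun s0 (\<lambda>x. u t x - Q t x) \<and>
                  Hdot_norm s0 (\<lambda>x. u t x - Q t x) \<le>
                    C * ((1 + t) powr (- (real CARD('n) + 2 * (s0 + \<kappa>)) / (2 * (2 * \<sigma> - 2 * \<sigma> * \<alpha>))
                                       - (1 - 2 * \<alpha>) / (2 * (1 - \<alpha>))) * L1_weighted_norm \<kappa> w0
                       + (1 + t) powr (- (real CARD('n) + 2 * s0) / (2 * (2 * \<sigma> - 2 * \<sigma> * \<alpha>))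
                                       - (1 - 2 * \<alpha>) / (2 * (1 - \<alpha>))) * norm (total_mass w0)))))))
   \<and> (\<forall>\<alpha>. 1/2 < \<alpha> \<and> \<alpha> \<le> 1 \<longrightarrow>
       (\<exists>\<epsilon>0>0. \<forall>\<epsilon> N (\<chi>int :: real^'n \<Rightarrow> real) \<chi>mid \<chi>ext.
          0 < \<epsilon> \<and> \<epsilon> \<le> \<epsilon>0 \<and> 1 \<le> N \<and> cutoff_partition \<epsilon> N \<chi>int \<chi>mid \<chi>ext \<longrightarrow>
          (\<forall>s s0 \<kappa>. 0 \<le> s \<and> 0 \<le> s0 \<and> s0 \<le> s \<and> 0 \<le> \<kappa> \<and> \<kappa> \<le> 1 \<longrightarrow>
            (\<exists>C>0. \<forall>w0 w u wb Q.
               Hs_fun s w0 \<and> L1_weighted \<kappa> w0 \<and> is_solution \<sigma> \<alpha> w0 w \<and>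
               (\<forall>t\<ge>0. is_multiplier \<chi>int (w t) (u t)) \<and>
               is_reference_gt \<sigma> \<alpha> w0 wb \<and> is_profile_gt \<chi>int wb Q \<longrightarrow>
               (\<forall>t\<ge>0.
                  Hdot_fun s0 (\<lambda>x. u t x - Q t x) \<and>
                  Hdot_norm s0 (\<lambda>x. u t x - Q t x) \<le>
                    C * ((1 + t) powr (- (real CARD('n) + 2 * (s0 + \<kappa>)) / (4 * \<sigma> * \<alpha>)
                                       - (2 * \<alpha> - 1) / (2 * \<alpha>)) * L1_weighted_norm \<kappa> w0
                       + (1 + t) powr (- (real CARD('n) + 2 * s0) / (4 * \<sigma> * \<alpha>)
                                       - (2 * \<alpha> - 1) / (2 * \<alpha>)) * norm (total_mass w0)))))))"
  by (intro conjI allI impI; elim conjE)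
    (rule asymptotic_profile_lt[OF assms], assumption+, rule asymptotic_profile_gt[OF assms], assumption)

end
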